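(* Let $k\geqslant1$ be fixed, and let $p(z)=\sum_{n\geqslant0}p_nz^n=\exp\{\sum_{j\geqslant1,(j,k)=1}z^j/j\}$. Let $f(z)=\sum_{n\geqslant0}a_nz^n$ for $|z|<1$, and $S(f;m)=\sum_{j=1}^m a_jjp_{m-j}$. Then for $n\geqslant1$, $$\left|\frac1{p_n}\sum_{j=0}^na_jp_{n-j}-f(e^{-1/n})-\frac{S(f;n)}{np_n}\right|\leqslant C\left(\frac1{n^\beta}\sum_{j=1}^n\frac{|S(f;j)|}{p(e^{-1/j})}j^{\beta-1}+\frac1{p(e^{-1/n})}\sum_{j>n}\frac{|S(f;j)|}{j}e^{-j/n}\right),$$ where $\beta=\gamma_0-\gamma'$, $\gamma'=\max_{1\leqslant j<k_0}\max\{\gamma_j,0\}$, and $C=C(k)$ depends only on $k$.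
   Context: $k_0=\prod_{p\mid k}p$ (product over primes dividing $k$). $\gamma_0=\phi(k)/k$ and, for $1\leqslant j<k_0$, $\gamma_j=\frac{\phi(k)}{k}\mu(l_j)\prod_{p\mid l_j}\frac{1}{p-1}$ with $l_j=k_0/(j,k_0)$; with these, $p(z)=\prod_{j=0}^{k_0-1}(1-ze^{-2\pi ij/k_0})^{-\gamma_j}$. $\phi$ is Euler's totient function and $\mu$ the Möbius function. *)

theory Defs
  imports
    "HOL-Complex_Analysis.Complex_Analysis"
    "HOL-Computational_Algebra.Computational_Algebra"
    "HOL-Number_Theory.Totient"
begin

definition moebius_fun :: "nat \<Rightarrow> int" where
  "moebius_fun n = (if squarefree n then (-1) ^ card (prime_factors n) else 0)"

definition rad :: "nat \<Rightarrow> nat" where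
  "rad k = \<Prod>(prime_factors k)"

definition gam :: "nat \<Rightarrow> nat \<Rightarrow> real" where
  "gam k j =
     (if j = 0 then real (totient k) / real k
      else let l = rad k div gcd j (rad k) in
        real (totient k) / real k * real_of_int (moebius_fun l)
          * (\<Prod>q\<in>prime_factors l. 1 / (real q - 1)))"

text \<open>The index range of the maximum is empty if \<open>rad k = 1\<close>, that is, if \<open>k = 1\<close>;
  the maximum over the empty set is taken to be \<open>0\<close>.\<close>

definition gam_max :: "nat \<Rightarrow> real" where
  "gam_max k = Max (insert 0 ((\<lambda>j. max (gam k j) 0) ` {1..<rad k}))"

definition beta_exp :: "nat \<Rightarrow> real" where
  "beta_exp k = gam k 0 - gam_max k"

definition log_fps :: "nat \<Rightarrow> 'a::field_char_0 fps" where
  "log_fps k = Abs_fps (\<lambda>j. if 1 \<le> j \<and> coprime j k then 1 / of_nat j else 0)"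

definition p_fun :: "nat \<Rightarrow> 'a \<Rightarrow> 'a::{real_normed_field,banach}" where
  "p_fun k z = exp (\<Sum>j. if 1 \<le> j \<and> coprime j k then z ^ j / of_nat j else 0)"

text \<open>The Taylor coefficients of \<open>p_fun k\<close> at \<open>0\<close>; see \<open>p_coeff_sums\<close> below.\<close>

definition p_coeff :: "nat \<Rightarrow> nat \<Rightarrow> real" where
  "p_coeff k n = fps_nth (fps_exp 1 oo log_fps k) n"

definition S_sum :: "nat \<Rightarrow> (nat \<Rightarrow> complex) \<Rightarrow> nat \<Rightarrow> complex" where
  "S_sum k a m = (\<Sum>j=1..m. a j * of_nat j * of_real (p_coeff k (m - j)))"

lemma log_fps_of_real:
  "fps_nth (log_fps k) n = (of_real (fps_nth (log_fps k) n) :: complex)"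
  by (simp add: log_fps_def)

lemma log_fps_power_of_real:
  "fps_nth (log_fps k ^ i) n = (of_real (fps_nth (log_fps k ^ i) n) :: complex)"
proof (induction i arbitrary: n)
  case 0
  show ?case by (cases "n = 0") simp_all
next
  case (Suc i)
  show ?case
    by (simp add: fps_mult_nth Suc.IH[symmetric] log_fps_of_real[symmetric])
qed

lemma p_coeff_complex:
  "of_real (p_coeff k n) = fps_nth (fps_exp (1::complex) oo log_fps k) n"
  by (simp add: p_coeff_def fps_compose_nth log_fps_power_of_real[symmetric])

lemma log_fps_conv_radius: "fps_conv_radius (log_fps k :: complex fps) \<ge> 1"
  unfolding fps_conv_radius_def
proof (rule conv_radius_geI_ex)
  fix r :: real assume r: "0 < r" "ereal r < 1"
  have "summable (\<lambda>n. r ^ n)" using r by (intro summable_geometric) auto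
  then have "summable (\<lambda>n. fps_nth (log_fps k :: complex fps) n * of_real r ^ n)"
  proof (rule summable_comparison_test'[where N = 0])
    fix n :: nat
    show "norm (fps_nth (log_fps k :: complex fps) n * of_real r ^ n) \<le> r ^ n"
      using r by (cases "n = 0") (auto simp: log_fps_def norm_mult norm_power norm_divide field_simps)
  qed
  then show "\<exists>z::complex. norm z = r \<and> summable (\<lambda>n. fps_nth (log_fps k) n * z ^ n)"
    using r by (intro exI[of _ "of_real r"]) auto
qed

lemma p_fun_eval: "p_fun k z = exp (eval_fps (log_fps k) (z::complex))"
  unfolding p_fun_def eval_fps_def log_fps_def
  by (rule arg_cong[of _ _ exp], rule suminf_cong) auto

lemma p_coeff_sums:
  fixes z :: complex
  assumes "norm z < 1"
  shows "(\<lambda>n. of_real (p_coeff k n) * z ^ n) sums p_fun k z"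
proof -
  let ?g = "eval_fps (log_fps k :: complex fps)"
  have pos: "fps_conv_radius (log_fps k :: complex fps) > 0"
    by (rule less_le_trans[OF _ log_fps_conv_radius]) simp
  have "(exp \<circ> ?g) has_fps_expansion (fps_exp 1 oo log_fps k)"
  proof (rule has_fps_expansion_compose)
    show "?g has_fps_expansion log_fps k"
      using pos by (simp add: has_fps_expansion_def)
    show "fps_nth (log_fps k :: complex fps) 0 = 0" by (simp add: log_fps_def)
  qed (rule has_fps_expansion_exp1)
  moreover have "(exp \<circ> ?g) holomorphic_on eball 0 1"
  proof -
    have "?g holomorphic_on eball 0 1"
    proof (rule holomorphic_on_eval_fps)
      show "eball 0 1 \<subseteq> eball 0 (fps_conv_radius (log_fps k :: complex fps))"
        by (auto intro!: less_le_trans[OF _ log_fps_conv_radius])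
    qed
    then show ?thesis by (rule holomorphic_on_compose) (rule holomorphic_on_exp)
  qed
  ultimately have "(\<lambda>n. fps_nth (fps_exp 1 oo log_fps k) n * z ^ n) sums (exp \<circ> ?g) z"
    by (rule has_fps_expansion_imp_sums_complex) (use assms in simp)
  then show ?thesis by (simp add: p_coeff_complex p_fun_eval)
qed

text \<open>The infinite sum in the main inequality always converges, so it never takes the
  default value that \<open>infsum\<close> assigns to a divergent sum.\<close>

lemma S_sum_summable:
  assumes f: "\<And>z::complex. norm z < 1 \<Longrightarrow> (\<lambda>n. a n * z ^ n) sums f z" and n: "n \<ge> 1"
  shows "(\<lambda>j. norm (S_sum k a j) / real j * exp (- (real j / real n))) summable_on {n<..}"
proof -
  define x where "x = exp (- (1 / real n))"
  have x: "0 < x" "x < 1" using n by (auto simp: x_def)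
  obtain y where y: "x < y" "y < 1" using x dense by blast
  let ?A = "\<lambda>i. of_nat i * a i * of_real x ^ i" and ?P = "\<lambda>i. complex_of_real (p_coeff k i) * of_real x ^ i"
  have "summable (\<lambda>i. a i * of_real y ^ i)"
    using f[of "of_real y"] x y by (auto simp: sums_iff)
  from conv_radius_geI[OF this] have "ereal y \<le> conv_radius a"
    using x y by simp
  then have "norm (of_real x :: complex) < conv_radius a"
    by (rule less_le_trans[rotated]) (use x y in simp)
  also have "\<dots> = fps_conv_radius (Abs_fps a)"
    by (simp add: fps_conv_radius_def)
  also have "\<dots> \<le> fps_conv_radius (fps_deriv (Abs_fps a))"
    by (rule fps_conv_radius_deriv)
  also have "\<dots> \<le> fps_conv_radius (fps_X * fps_deriv (Abs_fps a))"
    using fps_conv_radius_mult[of fps_X "fps_deriv (Abs_fps a)"] by simp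
  finally have "norm (of_real x :: complex) < fps_conv_radius (fps_X * fps_deriv (Abs_fps a))" .
  from norm_summable_fps[OF this]
  have "summable (\<lambda>i. norm (fps_nth (fps_X * fps_deriv (Abs_fps a)) i * of_real x ^ i))" .
  moreover have "fps_nth (fps_X * fps_deriv (Abs_fps a)) i * of_real x ^ i = ?A i" for i
    by (cases i) simp_all
  ultimately have A: "summable (\<lambda>i. norm (?A i))" by (simp only:)
  have "summable (\<lambda>i. complex_of_real (p_coeff k i) * of_real y ^ i)"
    using p_coeff_sums[of "of_real y" k] x y by (auto simp: sums_iff)
  from powser_insidea[OF this, of "of_real x"] x y have P: "summable (\<lambda>i. norm (?P i))" by simp
  have "summable (\<lambda>m. \<Sum>i\<le>m. norm (?A i) * norm (?P (m - i)))"
    by (rule summable_Cauchy_product) (use A P in auto)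
  then have "summable (\<lambda>m. norm (S_sum k a m) / real m * exp (- (real m / real n)))"
  proof (rule summable_comparison_test'[where N = 1])
    fix m :: nat assume m: "m \<ge> 1"
    have ex: "exp (- (real m / real n)) = x ^ m"
      by (simp add: x_def flip: exp_of_nat_mult)
    have "norm (S_sum k a m) / real m * x ^ m \<le> norm (S_sum k a m) * x ^ m"
      using m x by (intro mult_right_mono) (auto simp: divide_le_eq mult_le_cancel_left1)
    also have "\<dots> \<le> (\<Sum>i\<in>{1..m}. norm (a i * of_nat i * of_real (p_coeff k (m - i)))) * x ^ m"
      unfolding S_sum_def using x by (intro mult_right_mono norm_sum) auto
    also have "\<dots> = (\<Sum>i\<in>{1..m}. norm (?A i) * norm (?P (m - i)))"
      unfolding sum_distrib_right
    proof (rule sum.cong)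
      fix i assume "i \<in> {1..m}"
      then have "x ^ m = x ^ i * x ^ (m - i)" by (simp flip: power_add)
      then show "norm (a i * of_nat i * of_real (p_coeff k (m - i))) * x ^ m
                 = norm (?A i) * norm (?P (m - i))"
        using x by (simp add: norm_mult norm_power mult_ac)
    qed simp
    also have "\<dots> \<le> (\<Sum>i\<le>m. norm (?A i) * norm (?P (m - i)))"
      by (rule sum_mono2) auto
    finally show "norm (norm (S_sum k a m) / real m * exp (- (real m / real n)))
                  \<le> (\<Sum>i\<le>m. norm (?A i) * norm (?P (m - i)))"
      using x by (simp add: ex)
  qed
  then have "(\<lambda>m. norm (S_sum k a m) / real m * exp (- (real m / real n))) summable_on UNIV"
    by (subst summable_on_UNIV_nonneg_real_iff) auto
  then show ?thesis by (rule summable_on_subset_banach) simp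
qed

end

theory Submission
  imports Defs
begin

text \<open>Let \<open>G\<^sub>m(t) = \<integral>\<^sub>0\<^sup>t s\<^sup>m\<^sup>-\<^sup>1/p(s) ds\<close>. Since \<open>z f'(z) p(z) = \<Sum>\<^sub>m S(f;m) z\<^sup>m\<close>, both
  \<open>f(t)\<close> and the coefficients of \<open>f p\<close> are linear in the numbers \<open>S(f;m)\<close>: up to \<open>a\<^sub>0\<close> they are
  \<open>\<Sum>\<^sub>m S(f;m) G\<^sub>m(t)\<close> and \<open>\<Sum>\<^sub>m S(f;m) u\<^sub>m\<^sub>,\<^sub>n\<close>, where \<open>u\<^sub>m\<^sub>,\<^sub>n\<close> is the \<open>n\<close>-th coefficient of \<open>p G\<^sub>m\<close>. The theorem
  thus reduces to bounding \<open>u\<^sub>m\<^sub>,\<^sub>n/p\<^sub>n - G\<^sub>m(e\<^sup>-\<^sup>1\<^sup>/\<^sup>n)\<close> for \<open>m < n\<close>, and \<open>G\<^sub>m(e\<^sup>-\<^sup>1\<^sup>/\<^sup>n)\<close> for \<open>m \<ge> n\<close>.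

  Because \<open>z p'/p = \<Sum> z\<^sup>j\<close> over \<open>j\<close> coprime to \<open>k\<close>, both \<open>p\<^sub>n\<close> and \<open>u\<^sub>m\<^sub>,\<^sub>n\<close> (for \<open>n > m + k\<close>) satisfy
  \<open>n u\<^sub>n = (n - k) u\<^sub>n\<^sub>-\<^sub>k + \<Sum> u\<^sub>n\<^sub>-\<^sub>j\<close>, summed over \<open>1 \<le> j \<le> k\<close> coprime to \<open>k\<close>. The discrete Fourier
  transform of a window of length \<open>k\<close> diagonalises this recurrence up to terms of relative size
  \<open>n\<^sup>-\<^sup>2\<close>; mode \<open>h\<close> grows like a power of \<open>n\<close> whose exponent is \<open>c\<^sub>k(h)/k - 1\<close> with the Ramanujan sum
  \<open>c\<^sub>k(h)\<close>, and \<open>c\<^sub>k(h)/k\<close> is \<open>0\<close> or one of the \<open>\<gamma>\<^sub>j\<close>. Hence \<open>u\<^sub>m\<^sub>,\<^sub>n/p\<^sub>n\<close> converges to a limit \<open>\<Lambda>\<^sub>m\<close> with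
  error of order \<open>n\<^sup>-\<^sup>\<beta>\<close> and explicit dependence on \<open>m\<close>, and by Abel's theorem \<open>\<Lambda>\<^sub>m = G\<^sub>m(1)\<close>.\<close>

section \<open>Perturbed diagonal recursions\<close>

lemma powr_Bernoulli_le:
  fixes s x :: real
  assumes "0 \<le> s" "s \<le> 1" "-1 < x"
  shows "(1 + x) powr s \<le> 1 + s * x"
  using Youngs_inequality_0[of s "1 - s" "1 + x" 1] assms by (simp add: algebra_simps)

lemma powr_neg_Bernoulli_ge:
  fixes s x :: real
  assumes "0 \<le> s" "s \<le> 1" "0 \<le> x"
  shows "1 - s * x \<le> (1 + x) powr (-s)"
proof -
  have "1 - s * x \<le> 1 / (1 + s * x)"
  proof -
    have "(1 - s * x) * (1 + s * x) \<le> 1" by (simp add: algebra_simps flip: power2_eq_square power_mult_distrib)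
    moreover have "0 \<le> s * x" using assms by simp
    ultimately show ?thesis by (subst pos_le_divide_eq) auto
  qed
  also have "\<dots> \<le> 1 / (1 + x) powr s"
    using assms powr_Bernoulli_le[of s x]
    by (intro divide_left_mono mult_pos_pos) (auto intro: add_pos_nonneg)
  finally show ?thesis by (simp add: powr_minus_divide)
qed

text \<open>Since 1/(1 + x) = 1 - x/(1 + x), this is the Bernoulli bound at the negative point -x/(1
  + x). The denominator 1 + x is the source of the second-order term in \<open>w_le\<close>.\<close>

lemma powr_neg_Bernoulli_le:
  fixes s x :: real
  assumes "0 \<le> s" "s \<le> 1" "0 \<le> x"
  shows "(1 + x) powr (-s) \<le> 1 - s * x / (1 + x)"
proof -
  have "(1 + x) powr (-s) = (1 + (- (x / (1 + x)))) powr s"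
    using assms by (simp add: powr_minus_divide powr_divide field_simps)
  also have "\<dots> \<le> 1 + s * (- (x / (1 + x)))"
    by (rule powr_Bernoulli_le) (use assms in \<open>auto simp: field_simps\<close>)
  finally show ?thesis by simp
qed

text \<open>With its companion below it shows that M powr (-s) changes under M -> M + k by the
  factor 1 - k s/M up to order M^-2. Such powers therefore serve as comparison solutions of the
  recursion.\<close>

lemma powr_neg_shift_ge:
  fixes s M k :: real
  assumes "0 \<le> s" "s \<le> 1" "0 < M" "0 \<le> k"
  shows "(1 - k * s / M) * M powr (-s) \<le> (M + k) powr (-s)"
proof -
  have "(M + k) powr (-s) = M powr (-s) * (1 + k / M) powr (-s)"
    using assms by (subst powr_mult[symmetric]) (auto simp: distrib_left)
  moreover have "1 - s * (k / M) \<le> (1 + k / M) powr (-s)"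
    by (rule powr_neg_Bernoulli_ge) (use assms in auto)
  ultimately show ?thesis using assms
    by (simp add: mult.commute mult_left_mono)
qed

lemma powr_neg_shift_le:
  fixes s M k :: real
  assumes "0 \<le> s" "s \<le> 1" "0 < M" "0 \<le> k"
  shows "(M + k) powr (-s) \<le> (1 - s * k / (M + k)) * M powr (-s)"
proof -
  have "(M + k) powr (-s) = (1 + k / M) powr (-s) * M powr (-s)"
    using assms by (subst powr_mult[symmetric]) (auto simp: distrib_right)
  also have "\<dots> \<le> (1 - s * (k / M) / (1 + k / M)) * M powr (-s)"
    by (intro mult_right_mono powr_neg_Bernoulli_le) (use assms in auto)
  also have "s * (k / M) / (1 + k / M) = s * k / (M + k)"
    using assms by (simp add: divide_simps)
  finally show ?thesis .
qed

lemma powr_neg_double: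
  fixes s M k :: real
  assumes "0 \<le> s" "s \<le> 1" "0 < M" "0 \<le> k" "k \<le> M"
  shows "M powr (-s) \<le> 2 * (M + k) powr (-s)"
proof -
  \<comment> \<open>The factor 2 suffices because k \<le> M gives M + k \<le> 2M, and s \<le> 1
    gives M powr (-s) / 2 \<le> (2M) powr (-s).\<close>
  have "2 powr (s - 1) * (2 * M) powr (-s) = M powr (-s) / 2"
    using assms by (simp add: powr_mult powr_diff powr_minus field_simps)
  moreover have "(2 * M) powr (-s) \<le> (M + k) powr (-s)"
    using assms by (intro powr_mono2') auto
  moreover have "(2::real) powr (s - 1) \<le> 2 powr 0"
    using assms by (intro powr_mono) auto
  ultimately have "M powr (-s) / 2 \<le> 1 * (M + k) powr (-s)"
    by (metis mult_mono powr_ge_zero powr_zero_eq_one rel_simps(76) zero_le_one zero_neq_numeral)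
  then show ?thesis by simp
qed

text \<open>The increments telescope against g, so x is a Cauchy sequence; letting the later index
  tend to infinity leaves g b as the rate of convergence.\<close>

lemma convergent_dominated_telescope:
  fixes x :: "nat \<Rightarrow> 'a::banach" and g :: "nat \<Rightarrow> real"
  assumes step: "\<And>b. norm (x (Suc b) - x b) \<le> g b - g (Suc b)" and g: "g \<longlonglongrightarrow> 0"
  obtains L where "\<And>b. norm (x b - L) \<le> g b"
proof -
  have le: "norm (x (b + d) - x b) \<le> g b - g (b + d)" for b d
  proof (induction d)
    case (Suc d)
    have "norm (x (b + Suc d) - x b) \<le> norm (x (Suc (b + d)) - x (b + d)) + norm (x (b + d) - x b)"
      using norm_triangle_ineq[of "x (Suc (b + d)) - x (b + d)" "x (b + d) - x b"] by simp
    also have "\<dots> \<le> (g (b + d) - g (Suc (b + d))) + (g b - g (b + d))"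
      using Suc step by (intro add_mono)
    finally show ?case by simp
  qed simp
  have "decseq g" by (rule decseq_SucI) (use step in \<open>smt (verit) norm_ge_zero\<close>)
  then have gpos: "g b \<ge> 0" for b using g by (rule decseq_ge)
  have "Cauchy x"
  proof (rule CauchyI)
    fix e :: real assume "e > 0"
    with g obtain B where B: "\<And>b. b \<ge> B \<Longrightarrow> norm (g b) < e / 2"
      by (metis LIMSEQ_iff diff_zero half_gt_zero)
    show "\<exists>B. \<forall>m\<ge>B. \<forall>n\<ge>B. norm (x m - x n) < e"
    proof (intro exI allI impI)
      fix m n assume mn: "m \<ge> B" "n \<ge> B"
      have "norm (x m - x B) < e / 2" if "m \<ge> B" for m
        using le[of B "m - B"] B[of B] gpos[of m] that by simp
      from this[OF mn(1)] this[OF mn(2)] show "norm (x m - x n) < e"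
        using norm_triangle_ineq4[of "x m - x B" "x n - x B"] by simp
    qed
  qed
  then obtain L where L: "x \<longlonglongrightarrow> L" using Cauchy_convergent convergent_def by blast
  have "norm (x b - L) \<le> g b" for b
  proof -
    have "(\<lambda>d. norm (x (d + b) - x b)) \<longlonglongrightarrow> norm (L - x b)"
      by (intro tendsto_intros LIMSEQ_ignore_initial_segment L)
    then have "norm (L - x b) \<le> g b"
      by (rule LIMSEQ_le_const2) (auto simp: add.commute[of _ b] intro!: exI[of _ 0] order_trans[OF le] gpos)
    then show ?thesis by (simp add: norm_minus_commute)
  qed
  then show thesis by (rule that)
qed

text \<open>Abstract form of the transformed recurrence: \<open>y b h\<close> is mode h of the b-th
  window of length k, and \<open>M0 + b * k\<close> is the index just past that window. In the
  application \<open>c h\<close> is a Ramanujan sum, s0 = 1 - \<open>gam k 0\<close> and s1 = 1 -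
  \<open>gam_max k\<close>. Mode 0 is to behave like a power with exponent -s0 and every other mode
  is to have exponent at most -s1, while the modes are coupled only at relative order M^-2. The case
  k = 1 is set apart in \<open>gap\<close> because there s0 = 0 and s1 = 1, but no mode besides 0
  exists.\<close>

locale perturbed_recursion =
  fixes k :: nat and s0 s1 A M0 :: real and c :: "nat \<Rightarrow> real" and y :: "nat \<Rightarrow> nat \<Rightarrow> complex"
  assumes k: "k \<ge> 1" and s0: "0 \<le> s0" and s01: "s0 \<le> s1" and s1: "s1 \<le> 1"
    and gap: "k = 1 \<or> s1 - s0 < 1"
    and c0: "c 0 = k * (1 - s0)"
    and c_le: "\<And>h. 1 \<le> h \<Longrightarrow> h < k \<Longrightarrow> c h \<le> k * (1 - s1)"
    and c_abs: "\<And>h. h < k \<Longrightarrow> \<bar>c h\<bar> \<le> k"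
    and A: "A \<ge> 0" and M0: "M0 \<ge> k"
    and rec: "\<And>b h. h < k \<Longrightarrow> norm (y (Suc b) h - (1 + (c h - k) / (M0 + b * k)) * y b h)
                \<le> A * (\<Sum>h<k. norm (y b h)) / (M0 + b * k)\<^sup>2"
begin

definition M :: "nat \<Rightarrow> real" where "M b = M0 + b * k"
definition T :: "nat \<Rightarrow> real" where "T b = (\<Sum>h<k. norm (y b h))"
text \<open>Growth constant of the total T: the first summand is the second-order loss of
  \<open>factor_le\<close>, the second is the coupling error summed over the k modes.\<close>

definition F :: real where "F = 4 * k\<^sup>2 + k * A"

lemma M_Suc: "M (Suc b) = M b + k" by (simp add: M_def algebra_simps)
lemma M_ge: "M b \<ge> k" using M0 by (simp add: M_def add_increasing2)
lemma M_ge1: "M b \<ge> 1" using M_ge[of b] k by simp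
lemma T_nonneg: "T b \<ge> 0" by (simp add: T_def sum_nonneg)
lemma y_le_T: "h < k \<Longrightarrow> norm (y b h) \<le> T b"
  unfolding T_def by (rule member_le_sum) auto
lemma F_ge: "F \<ge> 4 * k\<^sup>2" "F \<ge> A" "F \<ge> 0" "F \<ge> 4 * k\<^sup>2 + A"
proof -
  have "k * A \<ge> 1 * A" using k A by (intro mult_right_mono) auto
  then show "F \<ge> A" "F \<ge> 4 * k\<^sup>2 + A" "F \<ge> 4 * k\<^sup>2" "F \<ge> 0" using A by (simp_all add: F_def add_increasing)
qed

lemma rec': "h < k \<Longrightarrow> norm (y (Suc b) h - (1 + (c h - k) / M b) * y b h) \<le> A * T b / (M b)\<^sup>2"
  using rec[of h b] by (simp add: M_def T_def)

lemma M_tendsto: "(\<lambda>b. 1 / M b) \<longlonglongrightarrow> 0"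
proof -
  have "filterlim (\<lambda>b. M b) at_top sequentially"
  proof (rule filterlim_at_top_mono[OF filterlim_real_sequentially])
    show "\<forall>\<^sub>F b in sequentially. real b \<le> M b"
    proof (rule always_eventually, rule allI)
      fix b :: nat
      have "real b * 1 \<le> real b * real k" using k by (intro mult_left_mono) auto
      then show "real b \<le> M b" using M0 k by (simp add: M_def)
    qed
  qed
  then show ?thesis using tendsto_divide_0[OF tendsto_const filterlim_at_top_imp_at_infinity] by blast
qed

text \<open>Makes errors of order M^-2 summable by telescoping; the reason is that M b + k \<le> 2 *
  M b and k \<ge> 1.\<close>

lemma inverse_square_telescope: "1 / (M b)\<^sup>2 \<le> 2 * (1 / M b - 1 / M (Suc b))"
proof -
  have M: "M b > 0" "k \<le> M b" "(1::real) \<le> k" using M_ge1[of b] M_ge k by auto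
  have "1 / M b - 1 / M (Suc b) = k / (M b * (M b + k))"
    using M by (simp add: M_Suc field_simps)
  also have "\<dots> \<ge> 1 / (M b * (M b + M b))"
    using M by (intro frac_le mult_left_mono) auto
  also have "1 / (M b * (M b + M b)) = 1 / (2 * (M b)\<^sup>2)" by (simp add: power2_eq_square)
  finally show ?thesis by simp
qed

lemma inverse_diff_nonneg: "0 \<le> 1 / M b - 1 / M (Suc b)"
proof -
  have "0 \<le> 1 / (M b)\<^sup>2" by simp
  then have "0 \<le> 2 * (1 / M b - 1 / M (Suc b))" using inverse_square_telescope by (rule order_trans)
  then show ?thesis unfolding zero_le_mult_iff by simp
qed

text \<open>The upper side is the hypothesis on \<open>c h\<close>. The lower side matters because
  the factor may be negative while M b is comparable to k; there 2t - 1 \<le> 4t^2 with t = k / M b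
  lets the quadratic term absorb it.\<close>

lemma factor_le:
  fixes s :: real
  assumes s: "0 \<le> s" "s \<le> 1" and c: "c h \<le> k * (1 - s)" "h < k"
  shows "\<bar>1 + (c h - k) / M b\<bar> \<le> 1 - k * s / M b + 4 * k\<^sup>2 / (M b)\<^sup>2"
proof -
  have M: "M b > 0" "k \<le> M b" using M_ge1[of b] M_ge by auto
  have sq: "4 * k\<^sup>2 / (M b)\<^sup>2 \<ge> 0" by simp
  have "c h - k \<le> - (k * s)" using c by (simp add: algebra_simps)
  then have "(c h - k) / M b \<le> - (k * s) / M b" using M by (intro divide_right_mono) auto
  then have 1: "1 + (c h - k) / M b \<le> 1 - k * s / M b + 4 * k\<^sup>2 / (M b)\<^sup>2" using sq by linarith
  have 2: "- (1 + (c h - k) / M b) \<le> 1 - k * s / M b + 4 * k\<^sup>2 / (M b)\<^sup>2"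
  proof -
    have "k * s \<le> M b * 1" using M s by (intro mult_mono) auto
    then have a: "k * s / M b \<le> 1" using M by simp
    have "c h - k \<ge> - (2 * k)" using c_abs[OF c(2)] by simp
    then have "(c h - k) / M b \<ge> - (2 * k) / M b" using M by (intro divide_right_mono) auto
    then have b: "- (1 + (c h - k) / M b) \<le> 2 * (k / M b) - 1" by simp
    have "2 * t - 1 \<le> 4 * t\<^sup>2" for t :: real
    proof -
      have "0 \<le> (2 * t - 1/2)\<^sup>2" by simp
      then show ?thesis by (simp add: power2_eq_square algebra_simps)
    qed
    from this[of "k / M b"] have "2 * (k / M b) - 1 \<le> 4 * k\<^sup>2 / (M b)\<^sup>2"
      by (simp add: power_divide)
    then show ?thesis using a b by linarith
  qed
  show ?thesis using 1 2 by linarith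
qed

lemma norm_step:
  fixes s :: real
  assumes "0 \<le> s" "s \<le> 1" "c h \<le> k * (1 - s)" "h < k"
  shows "norm (y (Suc b) h) \<le> (1 - k * s / M b) * norm (y b h) + 4 * k\<^sup>2 / (M b)\<^sup>2 * norm (y b h) + A * T b / (M b)\<^sup>2"
proof -
  have "norm (y (Suc b) h) \<le> norm ((1 + (c h - k) / M b) * y b h) + A * T b / (M b)\<^sup>2"
    using rec'[of h b] assms norm_triangle_ineq2[of "y (Suc b) h" "(1 + (c h - k) / M b) * y b h"] by simp
  also have "norm ((1 + (c h - k) / M b) * y b h) = \<bar>1 + (c h - k) / M b\<bar> * norm (y b h)"
    by (simp only: norm_mult norm_of_real)
  also have "\<dots> \<le> (1 - k * s / M b + 4 * k\<^sup>2 / (M b)\<^sup>2) * norm (y b h)"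
    using factor_le[OF assms] by (intro mult_right_mono) auto
  finally show ?thesis by (simp add: algebra_simps)
qed

text \<open>Because s0 \<le> s1, every mode obeys the multiplier bound of mode 0, so the total
  decays at that rate up to the quadratic error.\<close>

lemma T_step: "T (Suc b) \<le> (1 - k * s0 / M b) * T b + F * T b / (M b)\<^sup>2"
proof -
  have cs: "c h \<le> k * (1 - s0)" if "h < k" for h
  proof (cases "h = 0")
    case False
    then have "c h \<le> k * (1 - s1)" using c_le that by simp
    also have "\<dots> \<le> k * (1 - s0)" using s01 by (intro mult_left_mono) auto
    finally show ?thesis .
  qed (simp add: c0)
  have "T (Suc b) \<le> (\<Sum>h<k. (1 - k * s0 / M b) * norm (y b h) + 4 * k\<^sup>2 / (M b)\<^sup>2 * norm (y b h) + A * T b / (M b)\<^sup>2)"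
    unfolding T_def[of "Suc b"] using s0 s01 s1 cs by (intro sum_mono norm_step) auto
  also have "\<dots> = (1 - k * s0 / M b) * T b + 4 * k\<^sup>2 / (M b)\<^sup>2 * T b + k * (A * T b / (M b)\<^sup>2)"
    by (simp only: sum.distrib T_def sum_distrib_left[symmetric] sum_constant card_lessThan)
  also have "\<dots> = (1 - k * s0 / M b) * T b + F * T b / (M b)\<^sup>2"
    by (simp add: F_def add_divide_distrib algebra_simps)
  finally show ?thesis .
qed

section \<open>Comparison with powers of M and growth of the modes\<close>

definition w :: "real \<Rightarrow> nat \<Rightarrow> real" where "w s b = M b powr (-s)"

lemma w_pos: fixes s :: real shows "w s b > 0" using M_ge1[of b] by (simp add: w_def)

lemma w_ge: fixes s :: real shows "0 \<le> s \<Longrightarrow> s \<le> 1 \<Longrightarrow> (1 - k * s / M b) * w s b \<le> w s (Suc b)"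
  unfolding w_def M_Suc using M_ge1[of b] by (intro powr_neg_shift_ge) auto

lemma w_double: fixes s :: real shows "0 \<le> s \<Longrightarrow> s \<le> 1 \<Longrightarrow> w s b \<le> 2 * w s (Suc b)"
  unfolding w_def M_Suc using M_ge1[of b] M_ge[of b] by (intro powr_neg_double) auto

lemma w_le: fixes s :: real shows "0 \<le> s \<Longrightarrow> s \<le> 1 \<Longrightarrow> w s (Suc b) \<le> (1 - k * s / M b + k\<^sup>2 / (M b)\<^sup>2) * w s b"
proof -
  assume s: "0 \<le> s" "s \<le> 1"
  have M: "M b > 0" using M_ge1[of b] by simp
  have "w s (Suc b) \<le> (1 - s * k / (M b + k)) * w s b"
    unfolding w_def M_Suc using M s by (intro powr_neg_shift_le) auto
  also have "\<dots> \<le> (1 - k * s / M b + k\<^sup>2 / (M b)\<^sup>2) * w s b"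
  proof (intro mult_right_mono)
    have "k * s / M b - s * k / (M b + k) = s * (k\<^sup>2 / (M b * (M b + k)))"
      using M by (simp add: field_simps power2_eq_square)
    also have "\<dots> \<le> 1 * (k\<^sup>2 / (M b * M b))"
      using s M by (intro mult_mono divide_left_mono) auto
    finally show "1 - s * k / (M b + k) \<le> 1 - k * s / M b + k\<^sup>2 / (M b)\<^sup>2" by (simp add: power2_eq_square)
  qed (use w_pos less_imp_le in auto)
  finally show ?thesis .
qed

text \<open>Dividing by the comparison weight turns the contraction into a factor of at most 1;
  moving the inhomogeneity Q from the weight at b + 1 to the weight at b costs the factor 2.\<close>

lemma step_ratio:
  fixes s :: real
  assumes s: "0 \<le> s" "s \<le> 1" and X: "X' \<le> (1 - k * s / M b) * X + Q" "0 \<le> X" "0 \<le> Q"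
  shows "X' / w s (Suc b) \<le> X / w s b + 2 * Q / w s b"
proof -
  have "X' / w s (Suc b) \<le> (1 - k * s / M b) * X / w s (Suc b) + Q / w s (Suc b)"
    using X w_pos[of s "Suc b"] by (metis add_divide_distrib divide_right_mono less_imp_le)
  moreover have "(1 - k * s / M b) * X / w s (Suc b) \<le> X / w s b"
  proof -
    have "(1 - k * s / M b) * w s b * X \<le> w s (Suc b) * X"
      using w_ge[OF s] X by (intro mult_right_mono)
    then show ?thesis using w_pos[of s b] w_pos[of s "Suc b"] by (simp add: field_simps)
  qed
  moreover have "Q / w s (Suc b) \<le> 2 * Q / w s b"
  proof -
    have "Q * w s b \<le> Q * (2 * w s (Suc b))"
      using w_double[OF s] X by (intro mult_left_mono)
    then show ?thesis using w_pos[of s b] w_pos[of s "Suc b"] by (simp add: field_simps)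
  qed
  ultimately show ?thesis by linarith
qed

text \<open>Per step the ratio grows by at most the factor exp (4F (1 / M b - 1 / M (b + 1))), and
  these exponents telescope to at most 4F since M 0 \<ge> 1.\<close>

lemma T_bound: "T b / w s0 b \<le> exp (4 * F) * (T 0 / w s0 0)"
proof -
  define q where "q b = T b / w s0 b" for b
  have q: "q b \<ge> 0" for b using T_nonneg w_pos[of s0 b] by (simp add: q_def)
  have step: "q (Suc b) \<le> exp (4 * F * (1 / M b - 1 / M (Suc b))) * q b" for b
  proof -
    have "q (Suc b) \<le> q b + 2 * (F * T b / (M b)\<^sup>2) / w s0 b"
      unfolding q_def by (rule step_ratio) (use s0 s01 s1 T_step T_nonneg F_ge in auto)
    also have "\<dots> = (1 + 2 * F * (1 / (M b)\<^sup>2)) * q b" by (simp add: q_def add_divide_distrib algebra_simps)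
    also have "\<dots> \<le> (1 + 2 * F * (2 * (1 / M b - 1 / M (Suc b)))) * q b"
      using F_ge q by (intro mult_right_mono add_left_mono mult_left_mono inverse_square_telescope) auto
    also have "\<dots> \<le> exp (4 * F * (1 / M b - 1 / M (Suc b))) * q b"
      using exp_ge_add_one_self[of "4 * F * (1 / M b - 1 / M (Suc b))"] q by (intro mult_right_mono) (auto simp: algebra_simps)
    finally show ?thesis .
  qed
  have "q b \<le> exp (4 * F * (1 / M 0 - 1 / M b)) * q 0"
  proof (induction b)
    case (Suc b)
    have "q (Suc b) \<le> exp (4 * F * (1 / M b - 1 / M (Suc b))) * (exp (4 * F * (1 / M 0 - 1 / M b)) * q 0)"
      using step[of b] Suc by (meson exp_ge_zero mult_left_mono order_trans)
    also have "\<dots> = exp (4 * F * (1 / M 0 - 1 / M (Suc b))) * q 0"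
      by (simp add: algebra_simps flip: exp_add)
    finally show ?case .
  qed simp
  also have "\<dots> \<le> exp (4 * F * 1) * q 0"
  proof -
    have "1 / M 0 \<le> 1" "0 \<le> 1 / M b" using M_ge1[of 0] M_ge1[of b] by simp_all
    then have "1 / M 0 - 1 / M b \<le> 1" by linarith
    then have "exp (4 * F * (1 / M 0 - 1 / M b)) \<le> exp (4 * F * 1)"
      using F_ge by (subst exp_le_cancel_iff, intro mult_left_mono) auto
    then show ?thesis by (rule mult_right_mono) (rule q)
  qed
  finally show ?thesis by (simp add: q_def)
qed

definition G :: real where "G = exp (4 * F)"
lemma G_ge: "G \<ge> 1" using F_ge by (simp add: G_def)

lemma T_le: "T b \<le> G * (T 0 / w s0 0) * w s0 b"
  using T_bound[of b] w_pos[of s0 b] by (simp add: G_def field_simps)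

text \<open>As \<open>c0\<close> is an equality, mode 0 has exactly the factor 1 - k s0/M, which
  agrees with the quotient of consecutive weights up to k^2/M^2. The normalised mode thus has
  increments of order M^-2 and converges at rate 1/M.\<close>

lemma main_limit:
  obtains L where "\<And>b. norm (y b 0 / w s0 b - L) \<le> 8 * F * G * (T 0 / w s0 0) / M b"
proof -
  define q where "q b = y b 0 / w s0 b" for b
  define V where "V = T 0 / w s0 0"
  have V: "V \<ge> 0" using T_nonneg w_pos[of s0 0] by (simp add: V_def)
  have "norm (q (Suc b) - q b) \<le> 8 * F * G * V / M b - 8 * F * G * V / M (Suc b)" for b
  proof -
    let ?l = "1 - k * s0 / M b" and ?w = "w s0 b" and ?w' = "w s0 (Suc b)"
    note wp = w_pos[of s0 b] w_pos[of s0 "Suc b"]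
    have M: "M b > 0" using M_ge1[of b] by simp
    have l: "1 + (c 0 - k) / M b = ?l" by (simp add: c0 algebra_simps diff_divide_distrib)
    have eq: "q (Suc b) - q b = (y (Suc b) 0 - ?l * y b 0) / ?w' + y b 0 * of_real ((?l * ?w - ?w') / (?w * ?w'))"
      using wp by (simp add: q_def field_simps)
    have r: "norm (y (Suc b) 0 - ?l * y b 0) \<le> A * T b / (M b)\<^sup>2"
      using rec'[of 0 b] k by (simp add: l[symmetric])
    have d: "\<bar>?l * ?w - ?w'\<bar> \<le> k\<^sup>2 / (M b)\<^sup>2 * ?w"
      using w_le[of s0 b] w_ge[of s0 b] s0 s01 s1 by (simp add: algebra_simps)
    have "norm (q (Suc b) - q b) \<le> norm (y (Suc b) 0 - ?l * y b 0) / ?w' + norm (y b 0) * (\<bar>?l * ?w - ?w'\<bar> / (?w * ?w'))"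
      unfolding eq by (rule order_trans[OF norm_triangle_ineq]) (use wp in \<open>simp add: norm_divide norm_mult abs_mult del: of_real_mult of_real_diff of_real_divide\<close>)
    also have "\<dots> \<le> (A * T b / (M b)\<^sup>2) / ?w' + T b * ((k\<^sup>2 / (M b)\<^sup>2 * ?w) / (?w * ?w'))"
      using wp y_le_T[of 0 b] k T_nonneg r d by (intro add_mono divide_right_mono mult_mono) auto
    also have "\<dots> = (A + k\<^sup>2) * (T b / (M b)\<^sup>2) / ?w'"
      using wp by (simp add: distrib_right add_divide_distrib)
    also have "\<dots> \<le> F * (T b / (M b)\<^sup>2) / ?w'"
      using F_ge T_nonneg wp by (intro divide_right_mono mult_right_mono) (auto simp: F_def intro: order_trans)
    also have "\<dots> \<le> F * (G * V * ?w / (M b)\<^sup>2) / ?w'"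
      using F_ge T_nonneg wp T_le[of b] by (intro divide_right_mono mult_left_mono) (auto simp: V_def)
    also have "\<dots> = F * G * V * (1 / (M b)\<^sup>2) * (?w / ?w')" by simp
    also have "\<dots> \<le> F * G * V * (2 * (1 / M b - 1 / M (Suc b))) * 2"
    proof (intro mult_mono inverse_square_telescope)
      show "?w / ?w' \<le> 2" using w_double[of s0 b] s0 s01 s1 wp by (simp add: divide_le_eq)
    qed (use F_ge G_ge V wp inverse_diff_nonneg[of b] in \<open>simp_all del: diff_ge_0_iff_ge\<close>)
    also have "\<dots> \<le> 8 * (F * G * V) * (1 / M b) - 8 * (F * G * V) * (1 / M (Suc b))"
    proof -
      have "p * (2 * (u - v)) * 2 \<le> 8 * p * u - 8 * p * v" if "0 \<le> p * (u - v)" for p u v :: real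
        using that by (simp add: algebra_simps)
      moreover have "0 \<le> F * G * V * (1 / M b - 1 / M (Suc b))"
        by (intro mult_nonneg_nonneg inverse_diff_nonneg) (use F_ge G_ge V in auto)
      ultimately show ?thesis .
    qed
    also have "\<dots> = 8 * F * G * V / M b - 8 * F * G * V / M (Suc b)" by (simp only: mult.assoc times_divide_eq_right mult_1_right)
    finally show ?thesis .
  qed
  moreover have "(\<lambda>b. 8 * F * G * V / M b) \<longlonglongrightarrow> 0"
    using tendsto_mult_right_zero[OF M_tendsto, of "8 * F * G * V"] by simp
  ultimately obtain L where "\<And>b. norm (q b - L) \<le> 8 * F * G * V / M b"
    by (rule convergent_dominated_telescope) blast
  then show thesis by (intro that[of L]) (simp add: q_def V_def)
qed

text \<open>Relative to \<open>w s1\<close>, the inhomogeneity F T/M^2 with T of order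
  \<open>w s0\<close> has size M powr (-1 - s) with s = 1 - s1 + s0 > 0. This is summable, so the
  coupling to the dominant mode does not spoil the exponent s1.\<close>

lemma oscillation_bound:
  assumes h: "1 \<le> h" "h < k"
  shows "norm (y b h) \<le> (1 + 4 * F * G / (1 - s1 + s0)) * T 0 * (M b / M 0) powr (-s1)"
proof -
  define s where "s = 1 - s1 + s0"
  have s: "0 < s" "s \<le> 1" using gap h s01 by (auto simp: s_def)
  have s1': "0 \<le> s1" using s0 s01 by simp
  define g where "g b = M b powr (-s)" for b
  define V where "V b = norm (y b h) / w s1 b" for b
  define P where "P = T 0 / w s0 0"
  have P: "P \<ge> 0" using T_nonneg w_pos[of s0 0] by (simp add: P_def)
  \<comment> \<open>Discrete integration of M powr (-1 - s): each term is bounded by an increment of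
    the antiderivative.\<close>
  have g: "g b / M b \<le> 2 / s * (g b - g (Suc b))" for b
  proof -
    have M: "M b > 0" "k \<le> M b" "(1::real) \<le> k" using M_ge1[of b] M_ge k by auto
    have "g (Suc b) \<le> (1 - s * k / (M b + k)) * g b"
      unfolding g_def M_Suc using M s by (intro powr_neg_shift_le) auto
    then have 1: "s * k / (M b + k) * g b \<le> g b - g (Suc b)" by (simp add: left_diff_distrib)
    have "s * 1 / (M b + M b) * g b \<le> s * k / (M b + k) * g b"
      using M s by (intro mult_right_mono frac_le mult_left_mono) (auto simp: g_def)
    then have "s * 1 / (M b + M b) * g b \<le> g b - g (Suc b)" using 1 by linarith
    then have "2 / s * (s * 1 / (M b + M b) * g b) \<le> 2 / s * (g b - g (Suc b))"
      using s by (intro mult_left_mono) auto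
    then show ?thesis using s M by simp
  qed
  have step: "V (Suc b) \<le> V b + 2 * F * G * P * (2 / s * (g b - g (Suc b)))" for b
  proof -
    have wp: "w s1 b > 0" by (rule w_pos)
    have M: "M b > 0" using M_ge1[of b] by simp
    have "V (Suc b) \<le> V b + 2 * (F * T b / (M b)\<^sup>2) / w s1 b"
      unfolding V_def
    proof (rule step_ratio)
      have "norm (y (Suc b) h) \<le> (1 - k * s1 / M b) * norm (y b h) + 4 * k\<^sup>2 / (M b)\<^sup>2 * norm (y b h) + A * T b / (M b)\<^sup>2"
        using s1' s1 h c_le by (intro norm_step) auto
      moreover have "4 * k\<^sup>2 / (M b)\<^sup>2 * norm (y b h) \<le> 4 * k\<^sup>2 / (M b)\<^sup>2 * T b"
        using y_le_T h by (intro mult_left_mono) auto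
      moreover have "4 * k\<^sup>2 / (M b)\<^sup>2 * T b + A * T b / (M b)\<^sup>2 = (4 * k\<^sup>2 + A) * T b / (M b)\<^sup>2"
        by (simp add: distrib_right add_divide_distrib)
      moreover have "(4 * k\<^sup>2 + A) * T b / (M b)\<^sup>2 \<le> F * T b / (M b)\<^sup>2"
        using F_ge T_nonneg by (intro divide_right_mono mult_right_mono) auto
      ultimately show "norm (y (Suc b) h) \<le> (1 - k * s1 / M b) * norm (y b h) + F * T b / (M b)\<^sup>2" by linarith
    qed (use s1' s1 F_ge T_nonneg in auto)
    also have "2 * (F * T b / (M b)\<^sup>2) / w s1 b \<le> 2 * (F * (G * P * w s0 b) / (M b)\<^sup>2) / w s1 b"
      using T_le[of b] F_ge wp by (intro divide_right_mono mult_left_mono) (auto simp: P_def)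
    also have "\<dots> = 2 * F * G * P * (g b / M b)"
    proof -
      have "g b / M b = M b powr (-s - 1)"
        using powr_diff[of "M b" "-s" 1] M by (simp add: g_def)
      also have "-s - 1 = - s0 - (- s1) - 2" by (simp add: s_def)
      also have "M b powr (- s0 - (- s1) - 2) = w s0 b / w s1 b / (M b)\<^sup>2"
        using M by (simp only: powr_diff w_def powr_numeral)
      finally show ?thesis by (simp add: mult_ac)
    qed
    also have "\<dots> \<le> 2 * F * G * P * (2 / s * (g b - g (Suc b)))"
      using F_ge G_ge P by (intro mult_left_mono g) auto
    finally show ?thesis by simp
  qed
  have "V b \<le> V 0 + 2 * F * G * P * (2 / s * (g 0 - g b))" for b
  proof (induction b)
    case (Suc b)
    have "p * (2 / s * (g 0 - g b)) + p * (2 / s * (g b - g (Suc b))) = p * (2 / s * (g 0 - g (Suc b)))" for p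
      by (simp only: distrib_left[symmetric] diff_add_cancel add_diff_eq)
    from this[of "2 * F * G * P"] show ?case using step[of b] Suc by linarith
  qed simp
  also have "2 * F * G * P * (2 / s * (g 0 - g b)) \<le> 2 * F * G * P * (2 / s * g 0)"
    using F_ge G_ge P s by (intro mult_left_mono) (auto simp: g_def)
  also have "2 * F * G * P * (2 / s * g 0) = 4 * F * G / s * (P * g 0)" by simp
  also have "4 * F * G / s * (P * g 0) \<le> 4 * F * G / s * (T 0 / w s1 0)"
  proof -
    have M: "M 0 \<ge> 1" by (rule M_ge1)
    \<comment> \<open>The exponent equals s1 - 1, which is at most s1, so the accumulated coupling
      error is of no larger order than the initial data measured by \<open>w s1 0\<close>.\<close>
    have "g 0 / w s0 0 = M 0 powr (- s - - s0)" by (simp only: g_def w_def powr_diff)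
    also have "\<dots> \<le> M 0 powr s1" using M s1 by (intro powr_mono) (auto simp: s_def)
    also have "\<dots> = 1 / w s1 0" by (simp add: w_def powr_minus_divide)
    finally have "T 0 * (g 0 / w s0 0) \<le> T 0 * (1 / w s1 0)" using T_nonneg by (intro mult_left_mono)
    then have "P * g 0 \<le> T 0 / w s1 0" by (simp add: P_def)
    then show ?thesis using F_ge G_ge s by (intro mult_left_mono) auto
  qed
  also have "V 0 \<le> T 0 / w s1 0" unfolding V_def using y_le_T h w_pos[of s1 0] by (intro divide_right_mono) auto
  finally have "V b \<le> (1 + 4 * F * G / s) * (T 0 / w s1 0)"
    by (simp only: distrib_right mult_1_left)
  then have "norm (y b h) \<le> (1 + 4 * F * G / s) * (T 0 / w s1 0) * w s1 b"
    using w_pos[of s1 b] by (simp add: V_def divide_le_eq)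
  also have "\<dots> = (1 + 4 * F * G / s) * T 0 * (w s1 b / w s1 0)" by simp
  also have "w s1 b / w s1 0 = (M b / M 0) powr (-s1)"
    using M_ge1[of b] M_ge1[of 0] by (simp add: w_def powr_divide)
  finally show ?thesis by (simp add: s_def)
qed

end

section \<open>The recurrence and its discrete Fourier transform\<close>

definition units_upto :: "nat \<Rightarrow> nat set" where
  "units_upto k = {j \<in> {1..k}. coprime j k}"

definition zeta :: "nat \<Rightarrow> complex" where "zeta k = cis (2 * pi / k)"

lemma zeta_power_eq_1_iff: "k > 0 \<Longrightarrow> zeta k ^ n = 1 \<longleftrightarrow> k dvd n"
proof -
  assume k: "k > 0"
  have "zeta k ^ n = exp (2 * of_real pi * \<i> * of_nat n / of_nat k)"
    by (simp add: zeta_def cis_conv_exp mult_ac flip: exp_of_nat_mult)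
  then show ?thesis using complex_root_unity_eq_1[of k n] k by simp
qed

lemma norm_zeta [simp]: "norm (zeta k) = 1" by (simp add: zeta_def)

lemma zeta_nonzero [simp]: "zeta k \<noteq> 0" by (simp add: zeta_def)

lemma zeta_power_period: "zeta k ^ k = 1"
  using zeta_power_eq_1_iff[of k k] by (cases "k > 0") auto

lemma sum_root_of_unity_powers:
  fixes w :: complex
  assumes "w ^ k = 1"
  shows "(\<Sum>i<k. w ^ i) = (if w = 1 then of_nat k else 0)"
  using assms by (auto simp: geometric_sum)

text \<open>The phase depends on the absolute index i and not on i - N, so moving the window by k
  leaves all phases unchanged.\<close>

definition window_transform :: "nat \<Rightarrow> (nat \<Rightarrow> complex) \<Rightarrow> nat \<Rightarrow> nat \<Rightarrow> complex" where
  "window_transform k u N h = (\<Sum>i=N..<N + k. u i * zeta k ^ (h * i))"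

lemma window_transform_inversion:
  assumes k: "k > 0" and i: "i \<in> {N..<N + k}"
  shows "of_nat k * u i = (\<Sum>h<k. window_transform k u N h / zeta k ^ (h * i))"
proof -
  have "(\<Sum>h<k. window_transform k u N h / zeta k ^ (h * i))
      = (\<Sum>j=N..<N + k. u j * (\<Sum>h<k. (zeta k ^ j / zeta k ^ i) ^ h))"
    unfolding window_transform_def sum_divide_distrib sum_distrib_left
    by (subst sum.swap) (simp add: power_divide mult.commute flip: power_mult)
  also have "\<dots> = (\<Sum>j=N..<N + k. if j = i then of_nat k * u i else 0)"
  proof (rule sum.cong[OF refl])
    fix j assume j: "j \<in> {N..<N + k}"
    have "(zeta k ^ j / zeta k ^ i) ^ k = 1"
      by (metis (no_types, lifting) div_self mult.commute power_divide power_mult power_one zeta_power_period zero_neq_one)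
    then have *: "(\<Sum>h<k. (zeta k ^ j / zeta k ^ i) ^ h) = (if zeta k ^ j / zeta k ^ i = 1 then of_nat k else 0)"
      by (rule sum_root_of_unity_powers)
    \<comment> \<open>Two indices of one window of length k that are congruent modulo k coincide;
      this is the orthogonality relation.\<close>
    have "zeta k ^ j / zeta k ^ i = 1 \<longleftrightarrow> j = i"
    proof
      assume eq: "zeta k ^ j / zeta k ^ i = 1"
      show "j = i"
      proof (rule linorder_cases[of i j])
        assume "i < j"
        with eq have "zeta k ^ (j - i) = 1" by (simp add: power_diff)
        then have "k dvd j - i" using k zeta_power_eq_1_iff by blast
        then show ?thesis using \<open>i < j\<close> i j by (auto dest!: dvd_imp_le)
      next
        assume "j < i"
        with eq have "zeta k ^ (i - j) = 1" by (simp add: power_diff)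
        then have "k dvd i - j" using k zeta_power_eq_1_iff by blast
        then show ?thesis using \<open>j < i\<close> i j by (auto dest!: dvd_imp_le)
      qed simp
    qed simp
    with * show "u j * (\<Sum>h<k. (zeta k ^ j / zeta k ^ i) ^ h) = (if j = i then of_nat k * u i else 0)"
      by simp
  qed
  also have "\<dots> = of_nat k * u i" using i by simp
  finally show ?thesis by simp
qed

lemma norm_le_window_transform:
  assumes k: "k > 0" and i: "i \<in> {N..<N + k}"
  shows "norm (u i) \<le> (\<Sum>h<k. norm (window_transform k u N h))"
proof -
  have "1 * norm (u i) \<le> of_nat k * norm (u i)" using k by (intro mult_right_mono) auto
  also have "\<dots> = norm (\<Sum>h<k. window_transform k u N h / zeta k ^ (h * i))"
    by (simp flip: window_transform_inversion[OF k i] add: norm_mult)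
  also have "\<dots> \<le> (\<Sum>h<k. norm (window_transform k u N h / zeta k ^ (h * i)))" by (rule norm_sum)
  finally show ?thesis by (simp add: norm_divide norm_power)
qed

section \<open>A priori bounds and the one-step law of the recurrence\<close>

definition coprime_recurrence :: "nat \<Rightarrow> (nat \<Rightarrow> complex) \<Rightarrow> nat \<Rightarrow> bool" where
  "coprime_recurrence k u N \<longleftrightarrow> (\<forall>i\<ge>N. of_nat (i + k) * u (i + k) = of_nat i * u i + (\<Sum>j\<in>units_upto k. u (i + k - j)))"

lemma finite_units_upto [simp]: "finite (units_upto k)" by (simp add: units_upto_def)

lemma card_units_upto_le: "card (units_upto k) \<le> k"
proof -
  have "units_upto k \<subseteq> {1..k}" by (auto simp: units_upto_def)
  from card_mono[OF _ this] show ?thesis by simp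
qed

text \<open>A maximum principle: (i + k) u (i + k) is a combination of earlier values with total
  weight i + card (units_upto k) \<le> i + k, so the bound on the first window persists.\<close>

lemma coprime_recurrence_bounded:
  assumes rec: "coprime_recurrence k u N" and W: "\<And>i. i \<in> {N..<N + k} \<Longrightarrow> norm (u i) \<le> W" and k: "k > 0"
    and i: "i \<ge> N"
  shows "norm (u i) \<le> W"
  using i
proof (induction i rule: less_induct)
  case (less n)
  show ?case
  proof (cases "n < N + k")
    case False
    define i where "i = n - k"
    have n: "n = i + k" "i \<ge> N" using False by (auto simp: i_def)
    have W0: "W \<ge> 0" using W[of N] k by (auto intro: order_trans[OF norm_ge_zero])
    have "real n * norm (u n) = norm (of_nat i * u i + (\<Sum>j\<in>units_upto k. u (i + k - j)))"
      using rec n unfolding coprime_recurrence_def by (metis norm_mult norm_of_nat)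
    also have "\<dots> \<le> real i * norm (u i) + (\<Sum>j\<in>units_upto k. norm (u (i + k - j)))"
      by (rule order_trans[OF norm_triangle_ineq]) (intro add_mono norm_sum, simp add: norm_mult)
    also have "\<dots> \<le> real i * W + (\<Sum>j\<in>units_upto k. W)"
      using less n k by (intro add_mono mult_left_mono sum_mono less.IH) (auto simp: units_upto_def)
    also have "(\<Sum>j\<in>units_upto k. W) \<le> real k * W"
      using W0 card_units_upto_le[of k] by (simp add: mult_right_mono)
    also have "real i * W + real k * W = real n * W" by (simp add: n distrib_right)
    finally show ?thesis using n k by simp
  qed (use less W in auto)
qed

lemma coprime_recurrence_step:
  assumes rec: "coprime_recurrence k u N" and W: "\<And>i. i \<ge> N \<Longrightarrow> norm (u i) \<le> W" and k: "k > 0"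
    and i: "i \<ge> N"
  shows "norm (u (i + k) - u i) \<le> 2 * real k * W / real (N + k)"
    and "u (i + k) - u i = ((\<Sum>j\<in>units_upto k. u (i + k - j)) - of_nat k * u i) / of_nat (i + k)"
    and "norm ((\<Sum>j\<in>units_upto k. u (i + k - j)) - of_nat k * u i) \<le> 2 * real k * W"
proof -
  have W0: "W \<ge> 0" using W[of N] by (auto intro: order_trans[OF norm_ge_zero])
  have "of_nat (i + k) * u (i + k) = of_nat i * u i + (\<Sum>j\<in>units_upto k. u (i + k - j))"
    using rec i unfolding coprime_recurrence_def by blast
  then have "of_nat (i + k) * (u (i + k) - u i) = (\<Sum>j\<in>units_upto k. u (i + k - j)) - of_nat k * u i"
    by (simp add: algebra_simps)
  moreover have "(of_nat (i + k) :: complex) \<noteq> 0" using k by (simp flip: of_nat_add)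
  ultimately show eq: "u (i + k) - u i = ((\<Sum>j\<in>units_upto k. u (i + k - j)) - of_nat k * u i) / of_nat (i + k)"
    by (metis nonzero_mult_div_cancel_left)
  have "norm ((\<Sum>j\<in>units_upto k. u (i + k - j)) - of_nat k * u i) \<le> (\<Sum>j\<in>units_upto k. norm (u (i + k - j))) + k * norm (u i)"
    by (rule order_trans[OF norm_triangle_ineq4]) (intro add_mono norm_sum, simp add: norm_mult)
  also have "\<dots> \<le> (\<Sum>j\<in>units_upto k. W) + k * W"
    using i by (intro add_mono mult_left_mono sum_mono W) (auto simp: units_upto_def)
  also have "(\<Sum>j\<in>units_upto k. W) \<le> k * W"
    using W0 card_units_upto_le[of k] by (simp add: mult_right_mono)
  finally show b: "norm ((\<Sum>j\<in>units_upto k. u (i + k - j)) - of_nat k * u i) \<le> 2 * real k * W" by (simp add: mult_ac)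
  have "norm (u (i + k) - u i) \<le> 2 * real k * W / real (i + k)"
    unfolding eq norm_divide norm_of_nat by (rule divide_right_mono[OF b]) simp
  also have "\<dots> \<le> 2 * real k * W / real (N + k)" using W0 k i by (intro divide_left_mono mult_pos_pos) auto
  finally show "norm (u (i + k) - u i) \<le> 2 * real k * W / real (N + k)" .
qed

text \<open>Advancing the window by one index drops N + l and adds N + l + k, which carries the same
  phase.\<close>

lemma window_transform_shift:
  assumes "k > 0"
  shows "window_transform k u (N + l) h - window_transform k u N h
       = (\<Sum>i=N..<N + l. (u (i + k) - u i) * zeta k ^ (h * i))"
proof (induction l)
  case (Suc l)
  have per: "zeta k ^ (h * (N + l + k)) = zeta k ^ (h * (N + l))"
    by (simp add: distrib_left power_add power_mult[of _ k h, folded mult.commute] zeta_power_period mult.commute[of h k] power_mult)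
  have "window_transform k u (N + Suc l) h = (\<Sum>i=N + l..<Suc (N + l + k). u i * zeta k ^ (h * i)) - u (N + l) * zeta k ^ (h * (N + l))"
    using assms by (simp add: window_transform_def sum.atLeast_Suc_lessThan[of "N + l"])
  also have "\<dots> = window_transform k u (N + l) h + (u (N + l + k) - u (N + l)) * zeta k ^ (h * (N + l))"
    by (simp add: window_transform_def per left_diff_distrib)
  finally show ?case using Suc by (simp add: algebra_simps)
qed simp

text \<open>If all weights 1/(i + k) were equal to 1/M and the transform did not change within k
  steps, the recurrence would be diagonal with multiplier 1 + (c - k)/M. \<open>E1\<close> and
  \<open>E2\<close> measure these two replacements; each is at most 2 k^3 W/M^2.\<close>

lemma window_transform_step:
  fixes c :: real
  assumes rec: "coprime_recurrence k u N" and W: "\<And>i. i \<ge> N \<Longrightarrow> norm (u i) \<le> W" and k: "k > 0"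
    and c: "(\<Sum>j\<in>units_upto k. zeta k ^ (h * j)) = of_real c"
  shows "norm (window_transform k u (N + k) h - (1 + (c - real k) / real (N + k)) * window_transform k u N h)
          \<le> 4 * real k ^ 3 * W / (real (N + k))\<^sup>2"
proof -
  let ?Y = "\<lambda>N. window_transform k u N h" and ?z = "\<lambda>i. zeta k ^ (h * i)"
  let ?B = "\<lambda>i. (\<Sum>j\<in>units_upto k. u (i + k - j)) - of_nat k * u i"
  define M where "M = real (N + k)"
  have M: "M > 0" using k by (simp add: M_def)
  have W0: "W \<ge> 0" using W[of N] by (auto intro: order_trans[OF norm_ge_zero])
  have J: "j \<in> units_upto k \<Longrightarrow> 1 \<le> j \<and> j \<le> k" for j by (simp add: units_upto_def)
  have zk: "?z (i + k) = ?z i" for i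
    by (simp add: distrib_left power_add mult.commute[of h k] power_mult zeta_power_period)
  have 1: "?Y (N + k) - ?Y N = (\<Sum>i=N..<N + k. ?B i / of_nat (i + k) * ?z i)"
    unfolding window_transform_shift[OF k]
    by (rule sum.cong) (use coprime_recurrence_step(2)[OF rec W k] in auto)
  \<comment> \<open>Reindexing by i + k - j extracts the phase of j and leaves the window shifted by
    k - j; once the shift is ignored, the phases sum to the multiplier c.\<close>
  have 2: "(\<Sum>i=N..<N + k. ?B i * ?z i) = (\<Sum>j\<in>units_upto k. ?z j * ?Y (N + k - j)) - of_nat k * ?Y N"
  proof -
    have "(\<Sum>i=N..<N + k. u (i + k - j) * ?z i) = ?z j * ?Y (N + k - j)" if j: "j \<in> units_upto k" for j
    proof -
      have "(\<Sum>i=N..<N + k. u (i + k - j) * ?z i) = (\<Sum>i=N..<N + k. u (i + (k - j)) * (?z j * ?z (i + (k - j))))"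
      proof (rule sum.cong[OF refl])
        fix i
        have "?z j * ?z (i + (k - j)) = ?z (i + k)"
          using J[OF j] by (simp flip: power_add distrib_left)
        then show "u (i + k - j) * ?z i = u (i + (k - j)) * (?z j * ?z (i + (k - j)))"
          using J[OF j] zk by simp
      qed
      also have "\<dots> = (\<Sum>i=N + (k - j)..<N + k + (k - j). u i * (?z j * ?z i))"
        by (rule sum.shift_bounds_nat_ivl[symmetric])
      also have "\<dots> = ?z j * ?Y (N + k - j)"
        using J[OF j] by (simp add: window_transform_def sum_distrib_left mult_ac add_ac)
      finally show ?thesis .
    qed
    then have "(\<Sum>j\<in>units_upto k. \<Sum>i=N..<N + k. u (i + k - j) * ?z i) = (\<Sum>j\<in>units_upto k. ?z j * ?Y (N + k - j))"
      by (rule sum.cong[OF refl])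
    then show ?thesis
      by (simp add: left_diff_distrib sum_subtractf sum_distrib_right window_transform_def sum_distrib_left mult.assoc
          sum.swap[of _ "units_upto k"])
  qed
  define E1 where "E1 = (\<Sum>i=N..<N + k. ?B i * (1 / of_nat (i + k) - 1 / of_real M) * ?z i)"
  define E2 where "E2 = (\<Sum>j\<in>units_upto k. ?z j * (?Y (N + k - j) - ?Y N)) / of_real M"
  have eq: "?Y (N + k) - (1 + (c - real k) / real (N + k)) * ?Y N = E1 + E2"
  proof -
    have "(\<Sum>i=N..<N + k. ?B i * (1 / of_nat (i + k) - 1 / of_real M) * ?z i)
        = (?Y (N + k) - ?Y N) - (\<Sum>i=N..<N + k. ?B i * ?z i) / of_real M"
    proof -
      have "(\<Sum>i=N..<N + k. b i * (1 / of_nat (i + k) - 1 / of_real M) * ?z i)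
        = (\<Sum>i=N..<N + k. b i / of_nat (i + k) * ?z i) - (\<Sum>i=N..<N + k. b i * ?z i) / of_real M" for b :: "nat \<Rightarrow> complex"
        by (simp add: right_diff_distrib left_diff_distrib sum_subtractf sum_divide_distrib)
      from this[of ?B] show ?thesis unfolding 1 .
    qed
    moreover have "(\<Sum>j\<in>units_upto k. ?z j * (?Y (N + k - j) - ?Y N)) = (\<Sum>j\<in>units_upto k. ?z j * ?Y (N + k - j)) - of_real c * ?Y N"
      by (simp add: right_diff_distrib sum_subtractf c[symmetric] sum_distrib_right)
    moreover have "(1 + (c - real k) / real (N + k)) * ?Y N = ?Y N + (of_real c * ?Y N - of_nat k * ?Y N) / of_real M"
      by (simp add: M_def algebra_simps diff_divide_distrib)
    ultimately show ?thesis
      unfolding E1_def E2_def 2 by (simp add: diff_divide_distrib)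
  qed
  have bound1: "norm E1 \<le> (\<Sum>i=N..<N + k. 2 * real k * W * (k / M\<^sup>2))"
    unfolding E1_def
  proof (rule sum_norm_le)
    fix i assume i: "i \<in> {N..<N + k}"
    have "norm (1 / of_nat (i + k) - 1 / of_real M :: complex) \<le> k / M\<^sup>2"
    proof -
      have "(1 / of_nat (i + k) - 1 / of_real M :: complex) = of_real (1 / real (i + k) - 1 / M)" by simp
      also have "norm \<dots> = 1 / M - 1 / real (i + k)"
        unfolding norm_of_real using i k frac_le[of 1 1 M "real (i + k)"] M by (simp add: M_def abs_real_def)
      also have "\<dots> = (real i - real N) / (M * real (i + k))" using M k by (simp add: M_def field_simps)
      also have "\<dots> \<le> k / (M * M)" using i M by (intro frac_le mult_left_mono) (auto simp: M_def)
      finally show ?thesis by (simp add: power2_eq_square)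
    qed
    then show "norm (?B i * (1 / of_nat (i + k) - 1 / of_real M) * ?z i) \<le> 2 * real k * W * (k / M\<^sup>2)"
      using coprime_recurrence_step(3)[OF rec W k, of i] i W0
      unfolding norm_mult by (simp add: norm_power mult_mono del: of_nat_add times_divide_eq_right)
  qed
  have "norm E2 \<le> (\<Sum>j\<in>units_upto k. k * (2 * real k * W / M)) / M"
  proof -
    have "norm (?Y (N + k - j) - ?Y N) \<le> k * (2 * real k * W / M)" if j: "j \<in> units_upto k" for j
    proof -
      have "?Y (N + k - j) - ?Y N = (\<Sum>i=N..<N + (k - j). (u (i + k) - u i) * ?z i)"
        using window_transform_shift[OF k, of u N "k - j"] J[OF j] by simp
      also have "norm \<dots> \<le> (\<Sum>i=N..<N + (k - j). 2 * real k * W / M)"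
        by (rule sum_norm_le) (use coprime_recurrence_step(1)[OF rec W k] in \<open>auto simp: norm_mult norm_power M_def\<close>)
      also have "\<dots> \<le> k * (2 * real k * W / M)"
        using M W0 by (simp add: mult_right_mono divide_right_mono)
      finally show ?thesis .
    qed
    then have "norm (\<Sum>j\<in>units_upto k. ?z j * (?Y (N + k - j) - ?Y N)) \<le> (\<Sum>j\<in>units_upto k. k * (2 * real k * W / M))"
      by (intro sum_norm_le) (simp add: norm_mult norm_power)
    then show ?thesis
      unfolding E2_def norm_divide using M by (simp only: norm_of_real abs_of_pos divide_right_mono less_imp_le)
  qed
  also have "(\<Sum>j\<in>units_upto k. k * (2 * real k * W / M)) / M \<le> k * (k * (2 * real k * W / M)) / M"
  proof -
    have *: "(\<Sum>j\<in>units_upto k. B) \<le> k * B" if "B \<ge> 0" for B :: real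
      using that card_units_upto_le[of k] by (simp add: mult_right_mono)
    have "k * (2 * real k * W / M) \<ge> 0" using M W0 by simp
    from *[OF this] show ?thesis by (rule divide_right_mono) (rule less_imp_le[OF M])
  qed
  finally have bound2: "norm E2 \<le> k * (k * (2 * real k * W / M)) / M" .
  have "norm (E1 + E2) \<le> k * (2 * real k * W * (k / M\<^sup>2)) + k * (k * (2 * real k * W / M)) / M"
    using norm_triangle_ineq[of E1 E2] bound1 bound2 by simp
  also have "\<dots> = 4 * real k ^ 3 * W / M\<^sup>2"
    by (simp add: power2_eq_square power3_eq_cube)
  finally show ?thesis by (simp only: eq M_def)
qed

lemma coprime_recurrence_shift: "coprime_recurrence k u N \<Longrightarrow> N \<le> N' \<Longrightarrow> coprime_recurrence k u N'"
  by (auto simp: coprime_recurrence_def)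

text \<open>The statement on the window sum ties L to the initial data: it bounds L from above, and
  for positive coefficients it shows that L does not vanish. The pointwise statement keeps the
  dependence on the starting index N explicit, as the summation over m requires.\<close>

proposition coprime_recurrence_asymptotics:
  fixes k :: nat and s0 s1 :: real and c :: "nat \<Rightarrow> real"
  assumes k: "k \<ge> 1" and s0: "0 \<le> s0" and s01: "s0 \<le> s1" and s1: "s1 \<le> 1"
    and gap: "k = 1 \<or> s1 - s0 < 1"
    and c: "\<And>h. h < k \<Longrightarrow> (\<Sum>j\<in>units_upto k. zeta k ^ (h * j)) = of_real (c h)"
    and c0: "c 0 = k * (1 - s0)"
    and c_le: "\<And>h. 1 \<le> h \<Longrightarrow> h < k \<Longrightarrow> c h \<le> k * (1 - s1)"
  obtains C where "C \<ge> 0"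
    and "\<And>u N W. coprime_recurrence k u N \<Longrightarrow> (\<And>i. i \<in> {N..<N + k} \<Longrightarrow> norm (u i) \<le> W) \<Longrightarrow>
      \<exists>L. norm ((\<Sum>i=N..<N + k. u i) - of_nat k * L * of_real (real (N + k) powr (-s0))) \<le> C * W / real (N + k) \<and>
        (\<forall>n\<ge>N. n \<ge> 1 \<longrightarrow> norm (u n - L * of_real (real n powr (-s0))) \<le> C * W * (real n / real (N + k)) powr (-s1))"
proof -
  have c_abs: "\<bar>c h\<bar> \<le> k" if "h < k" for h
  proof -
    have "\<bar>c h\<bar> = norm (\<Sum>j\<in>units_upto k. zeta k ^ (h * j))" using c[OF that] by simp
    also have "\<dots> \<le> (\<Sum>j\<in>units_upto k. 1)" by (rule sum_norm_le) (simp add: norm_power)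
    also have "\<dots> \<le> k" using card_units_upto_le[of k] by simp
    finally show ?thesis .
  qed
  define A where "A = 4 * real k ^ 3"
  define F where "F = 4 * (real k)\<^sup>2 + k * A"
  define G where "G = exp (4 * F)"
  define C1 where "C1 = 8 * F * G * real k ^ 2"
  \<comment> \<open>For k = 1 the denominator 1 - s1 + s0 may be 0, but then there are no
    oscillating modes.\<close>
  define C2 where "C2 = (if k = 1 then 0 else (1 + 4 * F * G / (1 - s1 + s0)) * real k ^ 2)"
  define C3 where "C3 = real k ^ 2 + C1"
  define C where "C = C1 + k * C2 + k * C3"
  have A: "A \<ge> 0" by (simp add: A_def)
  have F: "F \<ge> 0" using A by (simp add: F_def)
  have G: "G > 0" by (simp add: G_def)
  have C1: "C1 \<ge> 0" using F G by (simp add: C1_def)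
  have C2: "C2 \<ge> 0" using F G gap s0 s1 by (auto simp: C2_def intro!: mult_nonneg_nonneg add_nonneg_nonneg divide_nonneg_nonneg)
  have C3: "C3 \<ge> 0" using C1 by (simp add: C3_def)
  have C: "C \<ge> 0" using C1 C2 C3 by (simp add: C_def)
  \<comment> \<open>Since s1 - s0 \<le> 1, an error smaller than the main term by the factor 1/x
    still fits into the oscillation bound.\<close>
  have aux: "(x / M) powr (-s0) / x \<le> (x / M) powr (-s1)" if "x \<ge> 1" "M \<ge> 1" for x M :: real
  proof -
    have "(x / M) powr (s1 - s0) \<le> x powr (s1 - s0)"
      using that s01 by (intro powr_mono2) (auto simp: divide_le_eq mult_le_cancel_left1)
    also have "\<dots> \<le> x powr 1" using that s0 s1 by (intro powr_mono) auto
    finally have "(x / M) powr (s1 - s0) / x \<le> 1" using that by simp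
    then have "(x / M) powr (-s1) * ((x / M) powr (s1 - s0) / x) \<le> (x / M) powr (-s1) * 1"
      by (intro mult_left_mono) auto
    then show ?thesis by (simp flip: powr_add)
  qed
  show thesis
  proof (rule that[OF C])
    fix u :: "nat \<Rightarrow> complex" and N :: nat and W :: real
    assume rec: "coprime_recurrence k u N" and W: "\<And>i. i \<in> {N..<N + k} \<Longrightarrow> norm (u i) \<le> W"
    have W0: "W \<ge> 0" using W[of N] k by (auto intro: order_trans[OF norm_ge_zero])
    define M0 where "M0 = real (N + k)"
    define y where "y b = window_transform k u (N + b * k)" for b
    interpret P: perturbed_recursion k s0 s1 A M0 c y
    proof
      fix b h assume h: "h < k"
      let ?T = "\<Sum>h<k. norm (y b h)"
      have rec_b: "coprime_recurrence k u (N + b * k)" using rec by (rule coprime_recurrence_shift) simp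
      \<comment> \<open>The locale measures the error by the transform of the current window, so the
        maximum principle is restarted at N + b k with the total over that window as bound.\<close>
      have bd: "norm (u i) \<le> ?T" if "i \<ge> N + b * k" for i
        by (rule coprime_recurrence_bounded[OF rec_b _ _ that])
          (use norm_le_window_transform k in \<open>auto simp: y_def\<close>)
      have M: "M0 + b * k = real (N + b * k + k)" by (simp add: M0_def)
      have s: "y (Suc b) = window_transform k u (N + b * k + k)" by (simp add: y_def add_ac)
      show "norm (y (Suc b) h - (1 + (c h - k) / (M0 + b * k)) * y b h) \<le> A * ?T / (M0 + b * k)\<^sup>2"
        using window_transform_step[OF rec_b bd _ c[OF h]] k unfolding M A_def s by (simp add: y_def)
    qed (use k s0 s01 s1 gap c0 c_le c_abs A in \<open>auto simp: M0_def\<close>)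
    have FG: "P.F = F" "P.G = G" by (simp_all add: P.F_def P.G_def F_def G_def)
    have M0: "M0 \<ge> 1" using k by (simp add: M0_def)
    have M_0: "P.M 0 = M0" by (simp add: P.M_def)
    define w0 where "w0 = M0 powr (-s0)"
    have w0: "w0 > 0" "P.w s0 0 = w0" using M0 by (simp_all add: w0_def P.w_def M_0)
    have T0: "P.T 0 \<le> real k ^ 2 * W"
    proof -
      have "norm (y 0 h) \<le> (\<Sum>i=N..<N + k. W)" for h
        unfolding y_def window_transform_def mult_0 add_0_right using W by (intro sum_norm_le) (auto simp: norm_mult norm_power)
      then have "P.T 0 \<le> (\<Sum>h<k. k * W)" unfolding P.T_def by (intro sum_mono) simp
      then show ?thesis by (simp add: power2_eq_square)
    qed
    obtain L where L: "\<And>b. norm (y b 0 / P.w s0 b - L) \<le> 8 * F * G * (P.T 0 / w0) / P.M b"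
      using P.main_limit unfolding FG w0 by blast
    have L': "norm (y b 0 / P.w s0 b - L) \<le> C1 * W / w0 / P.M b" for b
    proof -
      have "8 * F * G * (P.T 0 / w0) / P.M b \<le> 8 * F * G * (real k ^ 2 * W / w0) / P.M b"
        using T0 F G w0 P.M_ge1[of b] by (intro divide_right_mono mult_left_mono) auto
      then show ?thesis using L[of b] by (simp add: C1_def mult_ac)
    qed
    have normL: "norm L \<le> C3 * W / w0"
    proof -
      have "norm L \<le> norm (y 0 0 / w0) + C1 * W / w0 / M0"
        using L'[of 0] norm_triangle_ineq4[of "y 0 0 / w0" "y 0 0 / w0 - L"] by (simp add: w0 M_0)
      also have "norm (y 0 0 / w0) \<le> real k ^ 2 * W / w0"
        using P.y_le_T[of 0 0] T0 k w0 by (auto simp: norm_divide intro!: divide_right_mono)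
      also have "C1 * W / w0 / M0 \<le> C1 * W / w0 / 1"
        using C1 W0 w0 M0 by (intro divide_left_mono) auto
      finally show ?thesis by (simp add: C3_def distrib_right add_divide_distrib)
    qed
    \<comment> \<open>Mode 0 is a sum of k consecutive values, so its limit constant is k times the
      constant for single values.\<close>
    have kL: "of_nat k * (L / of_nat k) = L" using k by simp
    have first: "norm ((\<Sum>i=N..<N + k. u i) - L * of_real w0) \<le> C * W / M0"
    proof -
      have y00: "y 0 0 = (\<Sum>i=N..<N + k. u i)" by (simp add: y_def window_transform_def)
      have "y 0 0 - L * of_real w0 = (y 0 0 / w0 - L) * of_real w0" using w0 by (simp add: field_simps)
      also have "norm \<dots> \<le> C1 * W / w0 / M0 * w0"
        unfolding norm_mult using L'[of 0] w0 C1 W0 M0 by (intro mult_mono) (auto simp: M_0)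
      also have "\<dots> = C1 * W / M0" using w0 by simp
      also have "\<dots> \<le> C * W / M0" using C1 C2 C3 W0 M0 by (intro divide_right_mono mult_right_mono) (auto simp: C_def)
      finally show ?thesis by (simp add: y00)
    qed
    have second: "norm (u n - L / of_nat k * of_real (real n powr (-s0))) \<le> C * W * (real n / M0) powr (-s1)"
      if n: "n \<ge> N" "n \<ge> 1" for n
    proof -
      \<comment> \<open>The window that contains n; inverting the transform there recovers u
        n.\<close>
      define b where "b = (n - N) div k"
      have "k * b \<le> n - N" "n - N < k * b + k"
        using k dividend_less_times_div[of k "n - N"] by (simp_all add: b_def)
      then have nb: "N + b * k \<le> n" "n < N + b * k + k" using n by (auto simp: mult.commute)
      have Mb: "P.M b = real (N + b * k + k)" by (simp only: P.M_def) (simp add: M0_def)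
      have Mn: "n \<le> P.M b" "P.M b \<le> n + k" using nb unfolding Mb by linarith+
      have r1: "real n \<ge> 1" using n by simp
      let ?r = "(real n / M0) powr (-s1)"
      have r: "(P.M b / M0) powr (-s1) \<le> ?r"
        using Mn r1 M0 s0 s01 by (intro powr_mono2') (auto simp: divide_right_mono)
      have split: "of_nat k * u n = y b 0 + (\<Sum>h=1..<k. y b h / zeta k ^ (h * n))"
      proof -
        have "of_nat k * u n = (\<Sum>h<k. y b h / zeta k ^ (h * n))"
          unfolding y_def by (rule window_transform_inversion) (use k nb in auto)
        also have "{..<k} = insert 0 {1..<k}" using k by auto
        finally show ?thesis by simp
      qed
      have osc: "norm (\<Sum>h=1..<k. y b h / zeta k ^ (h * n)) \<le> k * (C2 * W * ?r)"
      proof -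
        have "norm (\<Sum>h=1..<k. y b h / zeta k ^ (h * n)) \<le> (\<Sum>h=1..<k. C2 * W * ?r)"
        proof (rule sum_norm_le)
          fix h assume h: "h \<in> {1..<k}"
          have "norm (y b h) \<le> (1 + 4 * F * G / (1 - s1 + s0)) * P.T 0 * (P.M b / M0) powr (-s1)"
            using P.oscillation_bound[of h b] h by (simp add: FG M_0)
          also have "\<dots> \<le> (1 + 4 * F * G / (1 - s1 + s0)) * (real k ^ 2 * W) * ?r"
            using T0 F G W0 r gap h P.T_nonneg by (intro mult_mono) (auto intro!: add_nonneg_nonneg mult_nonneg_nonneg divide_nonneg_nonneg)
          also have "\<dots> = C2 * W * ?r" using h by (simp add: C2_def)
          finally show "norm (y b h / zeta k ^ (h * n)) \<le> C2 * W * ?r"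
            by (simp add: norm_divide norm_power)
        qed
        also have "\<dots> \<le> k * (C2 * W * ?r)" using C2 W0 by (simp add: mult_right_mono)
        finally show ?thesis .
      qed
      have main: "norm (y b 0 - L * of_real (P.w s0 b)) \<le> C1 * W * ?r"
      proof -
        have wb: "P.w s0 b > 0" by (rule P.w_pos)
        have "y b 0 - L * of_real (P.w s0 b) = (y b 0 / P.w s0 b - L) * of_real (P.w s0 b)" using wb by (simp add: field_simps)
        also have "norm \<dots> \<le> C1 * W / w0 / P.M b * P.w s0 b"
          unfolding norm_mult using L'[of b] wb w0 C1 W0 P.M_ge1[of b] by (intro mult_mono) auto
        also have "\<dots> = C1 * W * ((P.M b / M0) powr (-s0) / P.M b)"
          using M0 P.M_ge1[of b] by (simp add: w0_def P.w_def powr_divide)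
        also have "\<dots> \<le> C1 * W * ((P.M b / M0) powr (-s1))"
          using C1 W0 M0 P.M_ge1[of b] by (intro mult_left_mono aux) auto
        also have "\<dots> \<le> C1 * W * ?r" using r C1 W0 by (intro mult_left_mono) auto
        finally show ?thesis .
      qed
      \<comment> \<open>n and \<open>P.M b\<close> differ by at most k, so exchanging their powers
        costs a relative error of order k/n, which \<open>aux\<close> absorbs.\<close>
      have change: "norm (L * of_real (P.w s0 b) - L * of_real (real n powr (-s0))) \<le> k * (C3 * W * ?r)"
      proof -
        have "(1 - (P.M b - n) * s0 / n) * n powr (-s0) \<le> (n + (P.M b - n)) powr (-s0)"
          using s0 s01 s1 Mn r1 by (intro powr_neg_shift_ge) auto
        then have "n powr (-s0) - P.w s0 b \<le> (P.M b - n) * s0 / n * n powr (-s0)"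
          by (simp add: P.w_def algebra_simps)
        also have "\<dots> \<le> real k * 1 / n * n powr (-s0)"
          using Mn s0 s01 s1 r1 by (intro mult_right_mono divide_right_mono mult_mono) auto
        finally have up: "n powr (-s0) - P.w s0 b \<le> real k * 1 / n * n powr (-s0)" .
        have "P.w s0 b \<le> n powr (-s0)"
          unfolding P.w_def using s0 Mn r1 by (intro powr_mono2') auto
        with up have "\<bar>P.w s0 b - n powr (-s0)\<bar> \<le> real k * 1 / n * n powr (-s0)" by simp
        moreover have "norm (L * of_real (P.w s0 b) - L * of_real (real n powr (-s0))) = norm L * \<bar>P.w s0 b - n powr (-s0)\<bar>"
          by (simp only: right_diff_distrib[symmetric] of_real_diff[symmetric] norm_mult norm_of_real)
        ultimately have "norm (L * of_real (P.w s0 b) - L * of_real (real n powr (-s0))) \<le> C3 * W / w0 * (real k * 1 / n * n powr (-s0))"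
          using normL C3 W0 w0 by (simp only:) (intro mult_mono, auto)
        also have "\<dots> = k * (C3 * W * ((n / M0) powr (-s0) / n))"
          using M0 r1 by (simp add: w0_def powr_divide)
        also have "\<dots> \<le> k * (C3 * W * ?r)"
          using C3 W0 M0 r1 by (intro mult_left_mono aux) auto
        finally show ?thesis .
      qed
      have eq: "of_nat k * u n - L * of_real (real n powr (-s0))
          = (\<Sum>h=1..<k. y b h / zeta k ^ (h * n)) + (y b 0 - L * of_real (P.w s0 b))
            + (L * of_real (P.w s0 b) - L * of_real (real n powr (-s0)))"
        unfolding split by simp
      have "norm (of_nat k * u n - L * of_real (real n powr (-s0))) \<le> k * (C2 * W * ?r) + C1 * W * ?r + k * (C3 * W * ?r)"
        unfolding eq by (intro order_trans[OF norm_triangle_ineq] add_mono osc main change)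
      also have "\<dots> = C * W * ?r" by (simp add: C_def algebra_simps)
      finally have b: "norm (of_nat k * u n - L * of_real (real n powr (-s0))) \<le> C * W * ?r" .
      have "u n - L / of_nat k * of_real (real n powr (-s0)) = (of_nat k * u n - L * of_real (real n powr (-s0))) / of_nat k"
        using k by (simp add: diff_divide_distrib)
      also have "norm \<dots> \<le> C * W * ?r / k"
        unfolding norm_divide norm_of_nat by (intro divide_right_mono b) simp
      also have "\<dots> \<le> C * W * ?r / 1"
        using k C W0 by (intro divide_left_mono) auto
      finally show ?thesis by simp
    qed
    show "\<exists>L. norm ((\<Sum>i=N..<N + k. u i) - of_nat k * L * of_real (real (N + k) powr (-s0))) \<le> C * W / real (N + k) \<and>
        (\<forall>n\<ge>N. n \<ge> 1 \<longrightarrow> norm (u n - L * of_real (real n powr (-s0))) \<le> C * W * (real n / real (N + k)) powr (-s1))"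
      using first second unfolding w0_def M0_def by (intro exI[of _ "L / of_nat k"]) (unfold kL, blast)
  qed
qed

section \<open>Ramanujan sums\<close>

lemma prod_primes_dvd_iff:
  fixes T :: "nat set"
  assumes "finite T" "\<And>q. q \<in> T \<Longrightarrow> prime q"
  shows "\<Prod>T dvd n \<longleftrightarrow> (\<forall>q\<in>T. q dvd n)"
  using assms
proof (induction T)
  case (insert q T)
  have "coprime q (\<Prod>T)"
    using insert by (intro prod_coprime_right) (metis insertCI primes_coprime)
  then show ?case using insert by (auto simp: divides_mult dest: dvd_mult_left dvd_mult_right)
qed simp

lemma prime_factors_prod_primes:
  fixes T :: "nat set"
  assumes "finite T" "\<And>q. q \<in> T \<Longrightarrow> prime q"
  shows "prime_factors (\<Prod>T) = T"
proof -
  have "\<Prod>T \<noteq> 0" using assms by (metis prod_zero_iff not_prime_0)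
  moreover have "q dvd \<Prod>T \<longleftrightarrow> q \<in> T" if "prime q" for q
  proof -
    have "q dvd \<Prod>T \<longleftrightarrow> (\<exists>x\<in>T. q dvd x)" using that assms by (simp add: prime_dvd_prod_iff)
    also have "\<dots> \<longleftrightarrow> q \<in> T" using that assms primes_dvd_imp_eq[of q] dvd_refl[of q] by blast
    finally show ?thesis .
  qed
  ultimately show ?thesis using assms by (auto simp: prime_factors_dvd)
qed

text \<open>Expand the product over the primes q of k of 1 minus the indicator of q dvd j.
  Squarefree divisors are encoded as sets T of primes, so the Moebius value is (-1) ^ card
  T.\<close>

lemma coprime_indicator_expansion:
  fixes j k :: nat
  assumes k: "k > 0"
  shows "(if coprime j k then 1 else 0 :: 'a::comm_ring_1)
       = (\<Sum>T\<in>Pow (prime_factors k). if \<Prod>T dvd j then (-1) ^ card T else 0)"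
proof -
  let ?P = "prime_factors k"
  have "(if coprime j k then 1 else 0 :: 'a) = (\<Prod>q\<in>?P. (if q dvd j then -1 else 0) + 1)"
  proof (cases "coprime j k")
    case True
    then have "\<not> q dvd j" if "q \<in> ?P" for q
      using that by (metis coprime_common_divisor in_prime_factors_imp_dvd in_prime_factors_imp_prime not_prime_unit)
    then show ?thesis using True by simp
  next
    case False
    then have "gcd j k \<noteq> 1" by (simp add: coprime_iff_gcd_eq_1)
    then obtain q where "prime q" "q dvd gcd j k" using prime_factor_nat by blast
    then have "q dvd j" "q dvd k" by auto
    then have "q \<in> ?P" using k \<open>prime q\<close> by (auto simp: prime_factors_dvd)
    then have "\<exists>q\<in>?P. (if q dvd j then -1 else 0 :: 'a) + 1 = 0" using \<open>q dvd j\<close> by auto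
    then have "(\<Prod>q\<in>?P. (if q dvd j then -1 else 0 :: 'a) + 1) = 0" by (intro prod_zero) auto
    then show ?thesis using False by simp
  qed
  also have "\<dots> = (\<Sum>T\<in>Pow ?P. \<Prod>q\<in>T. if q dvd j then -1 else 0)"
    by (subst prod_add) simp_all
  also have "\<dots> = (\<Sum>T\<in>Pow ?P. if \<Prod>T dvd j then (-1) ^ card T else 0)"
  proof (rule sum.cong[OF refl])
    fix T assume "T \<in> Pow ?P"
    then have T: "finite T" "\<And>q. q \<in> T \<Longrightarrow> prime q" by (auto intro: finite_subset)
    show "(\<Prod>q\<in>T. if q dvd j then -1 else 0 :: 'a) = (if \<Prod>T dvd j then (-1) ^ card T else 0)"
    proof (cases "\<forall>q\<in>T. q dvd j")
      case True
      then show ?thesis using prod_primes_dvd_iff[OF T] by simp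
    next
      case False
      then have "\<exists>q\<in>T. (if q dvd j then -1 else 0 :: 'a) = 0" by auto
      then have "(\<Prod>q\<in>T. if q dvd j then -1 else 0 :: 'a) = 0" by (intro prod_zero T)
      moreover have "\<not> \<Prod>T dvd j" using False prod_primes_dvd_iff[OF T, of j] by blast
      ultimately show ?thesis by simp
    qed
  qed
  finally show ?thesis .
qed

text \<open>With m = k/d the sum runs over the powers of w = zeta k ^ (h * d), which satisfies w ^ m
  = 1; it is m or 0 according to whether w = 1.\<close>

lemma sum_zeta_multiples:
  assumes k: "k > 0" and d: "d dvd k"
  shows "(\<Sum>j | j \<in> {1..k} \<and> d dvd j. zeta k ^ (h * j)) = (if k dvd h * d then of_nat (k div d) else 0)"
proof -
  obtain m where m: "k = d * m" using d by blast
  have m0: "m > 0" "d > 0" using k m by auto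
  define w where "w = zeta k ^ (h * d)"
  have wm: "w ^ m = 1"
    by (simp add: w_def zeta_power_eq_1_iff[OF k] flip: power_mult) (simp add: m)
  have "(\<Sum>j | j \<in> {1..k} \<and> d dvd j. zeta k ^ (h * j)) = (\<Sum>i\<in>{1..m}. w ^ i)"
  proof (rule sum.reindex_bij_witness[of _ "\<lambda>i. d * i" "\<lambda>j. j div d"])
    fix j assume "j \<in> {j. j \<in> {1..k} \<and> d dvd j}"
    then show "d * (j div d) = j" "j div d \<in> {1..m}" "w ^ (j div d) = zeta k ^ (h * j)"
      using m0 by (auto simp: m w_def mult.assoc simp flip: power_mult elim!: dvdE)
  next
    fix i assume "i \<in> {1..m}"
    then show "d * i div d = i" "d * i \<in> {j. j \<in> {1..k} \<and> d dvd j}"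
      using m0 by (auto simp: m)
  qed
  also have "\<dots> = (\<Sum>i<m. w ^ i)"
  proof -
    have "{..<m} = insert 0 {1..<m}" "{1..m} = insert m {1..<m}" using m0 by auto
    then show ?thesis using wm by simp
  qed
  also have "\<dots> = (if k dvd h * d then of_nat (k div d) else 0)"
    using m0 unfolding sum_root_of_unity_powers[OF wm] unfolding w_def zeta_power_eq_1_iff[OF k] by (simp add: m)
  finally show ?thesis .
qed

text \<open>The classical \<Sum> \<mu>(k/d) d over the common divisors d of h and k, with k/d =
  \<Prod>T; only squarefree k/d contribute. Being real, it can serve as the multiplier of a
  mode.\<close>

definition ramanujan_sum :: "nat \<Rightarrow> nat \<Rightarrow> real" where
  "ramanujan_sum k h = (\<Sum>T\<in>Pow (prime_factors k). if k dvd h * \<Prod>T then (-1) ^ card T * (real k / real (\<Prod>T)) else 0)"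

lemma prod_subset_prime_factors_dvd:
  "k > 0 \<Longrightarrow> T \<subseteq> prime_factors k \<Longrightarrow> \<Prod>T dvd (k::nat)"
  by (subst prod_primes_dvd_iff) (auto intro: finite_subset)

lemma sum_zeta_units:
  assumes k: "k > 0"
  shows "(\<Sum>j\<in>units_upto k. zeta k ^ (h * j)) = of_real (ramanujan_sum k h)"
proof -
  have "(\<Sum>j\<in>units_upto k. zeta k ^ (h * j)) = (\<Sum>j\<in>{1..k}. (if coprime j k then 1 else 0) * zeta k ^ (h * j))"
    unfolding units_upto_def by (subst sum.inter_filter) (auto intro!: sum.cong)
  also have "\<dots> = (\<Sum>T\<in>Pow (prime_factors k). (-1) ^ card T * (\<Sum>j\<in>{1..k}. if \<Prod>T dvd j then zeta k ^ (h * j) else 0))"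
    unfolding coprime_indicator_expansion[OF k] sum_distrib_right sum_distrib_left
    by (subst sum.swap) (auto intro!: sum.cong)
  also have "\<dots> = (\<Sum>T\<in>Pow (prime_factors k). (-1) ^ card T * (if k dvd h * \<Prod>T then of_nat (k div \<Prod>T) else 0))"
    using prod_subset_prime_factors_dvd[OF k] by (intro sum.cong) (auto simp flip: sum_zeta_multiples[OF k] sum.inter_filter)
  also have "\<dots> = of_real (ramanujan_sum k h)"
    unfolding ramanujan_sum_def of_real_sum
  proof (rule sum.cong[OF refl])
    fix T assume "T \<in> Pow (prime_factors k)"
    then have "real (k div \<Prod>T) = real k / real (\<Prod>T)" using prod_subset_prime_factors_dvd[OF k] by (intro real_of_nat_div) auto
    then have "of_nat (k div \<Prod>T) = (of_real (real k / real (\<Prod>T)) :: complex)" by (metis of_real_of_nat_eq)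
    then show "(-1) ^ card T * (if k dvd h * \<Prod>T then of_nat (k div \<Prod>T) else 0)
      = (of_real (if k dvd h * \<Prod>T then (-1) ^ card T * (real k / real (\<Prod>T)) else 0) :: complex)"
      by simp
  qed
  finally show ?thesis .
qed

section \<open>The exponents \<gamma> as normalised Ramanujan sums, and their extremes\<close>

lemma gam_max_nonneg: "gam_max k \<ge> 0"
  unfolding gam_max_def by (rule Max_ge) auto

lemma gam_le_gam_max: "1 \<le> j \<Longrightarrow> j < rad k \<Longrightarrow> gam k j \<le> gam_max k"
proof -
  assume "1 \<le> j" "j < rad k"
  then have "max (gam k j) 0 \<le> gam_max k"
    unfolding gam_max_def by (intro Max_ge) auto
  then show ?thesis by simp
qed

lemma rad_pos: "rad k > 0"
  unfolding rad_def by (auto intro!: Nat.gr0I simp: in_prime_factors_iff)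

text \<open>Hoelder's evaluation. With Q the primes of l = k / gcd h k, the condition k dvd h *
  \<Prod>T says Q \<subseteq> T, so T = Q \<union> R factors the sum into an Euler product over the
  primes outside Q. Completing it to all primes of k produces \<open>totient k / k\<close> and
  leaves 1/(q - 1) for q in Q. The index rad k / l divides rad k, so the modulus that
  \<open>gam\<close> attaches to it is again l.\<close>

lemma ramanujan_sum_eq_gam:
  assumes k: "k > 0" and h: "k div gcd h k dvd rad k"
  shows "ramanujan_sum k h = k * gam k (if k dvd h then 0 else rad k div (k div gcd h k))"
proof -
  define l where "l = k div gcd h k"
  let ?P = "prime_factors k"
  define Q where "Q = prime_factors l"
  have l0: "l > 0" "l dvd k" using k by (auto simp: l_def div_greater_zero_iff intro: gcd_le2_nat dvdI[of _ _ "gcd h k"])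
  have sq: "squarefree l"
  proof (rule squarefree_mono)
    show "l dvd rad k" using h by (simp add: l_def)
    show "squarefree (rad k)" unfolding rad_def
      by (rule squarefree_prod_coprime) (auto intro: primes_coprime squarefree_prime)
  qed
  have QP: "Q \<subseteq> ?P" using l0 k unfolding Q_def by (intro dvd_prime_factors) auto
  have finQ: "finite Q" "\<And>q. q \<in> Q \<Longrightarrow> prime q" by (auto simp: Q_def)
  have lQ: "l = \<Prod>Q"
    using sq l0 prod_prime_factors[of l] unfolding Q_def by (simp add: squarefree_factorial_semiring')
  have dvd_iff: "k dvd h * \<Prod>T \<longleftrightarrow> Q \<subseteq> T" if T: "T \<subseteq> ?P" for T
  proof -
    have fT: "finite T" "\<And>q. q \<in> T \<Longrightarrow> prime q" using T by (auto intro: finite_subset)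
    have "k dvd h * \<Prod>T \<longleftrightarrow> l dvd \<Prod>T"
    proof -
      have "k = gcd h k * l" by (simp add: l_def)
      moreover have "h = gcd h k * (h div gcd h k)" by simp
      ultimately have "k dvd h * \<Prod>T \<longleftrightarrow> gcd h k * l dvd gcd h k * (h div gcd h k * \<Prod>T)" by (metis mult.assoc)
      also have "\<dots> \<longleftrightarrow> l dvd h div gcd h k * \<Prod>T" using k by simp
      also have "\<dots> \<longleftrightarrow> l dvd \<Prod>T"
        using k by (intro coprime_dvd_mult_right_iff) (auto simp: l_def coprime_commute intro: div_gcd_coprime)
      finally show ?thesis .
    qed
    also have "\<dots> \<longleftrightarrow> (\<forall>q\<in>Q. q dvd \<Prod>T)" unfolding lQ by (rule prod_primes_dvd_iff[OF finQ])
    also have "\<dots> \<longleftrightarrow> Q \<subseteq> prime_factors (\<Prod>T)"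
    proof -
      have "\<Prod>T \<noteq> 0" using fT by (metis prod_zero_iff not_prime_0)
      then have "prime_factors (\<Prod>T) = {q. prime q \<and> q dvd \<Prod>T}" by (rule prime_factors_dvd)
      then show ?thesis using finQ(2) by (auto simp add: subset_iff Ball_def)
    qed
    finally show ?thesis by (simp add: prime_factors_prod_primes[OF fT])
  qed
  have "ramanujan_sum k h = (\<Sum>T | T \<in> Pow ?P \<and> Q \<subseteq> T. (-1) ^ card T * (real k / real (\<Prod>T)))"
    unfolding ramanujan_sum_def by (subst sum.inter_filter) (auto intro!: sum.cong simp: dvd_iff)
  also have "\<dots> = (\<Sum>R\<in>Pow (?P - Q). (-1) ^ card (Q \<union> R) * (real k / real (\<Prod>(Q \<union> R))))"
    by (rule sum.reindex_bij_witness[of _ "\<lambda>R. Q \<union> R" "\<lambda>T. T - Q"]) (use QP in \<open>auto simp: Un_absorb1\<close>)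
  also have "\<dots> = (\<Sum>R\<in>Pow (?P - Q). (-1) ^ card Q * (real k / real l) * (\<Prod>q\<in>R. - (1 / real q)))"
  proof (rule sum.cong[OF refl])
    fix R assume "R \<in> Pow (?P - Q)"
    then have R: "finite R" "Q \<inter> R = {}" by (auto intro: finite_subset)
    then show "(-1) ^ card (Q \<union> R) * (real k / real (\<Prod>(Q \<union> R))) = (-1) ^ card Q * (real k / real l) * (\<Prod>q\<in>R. - (1 / real q))"
      using finQ by (simp add: card_Un_disjoint prod.union_disjoint power_add lQ prod_uminus prod_dividef)
  qed
  also have "\<dots> = (-1) ^ card Q * (real k / real l) * (\<Prod>q\<in>?P - Q. - (1 / real q) + 1)"
    by (subst prod_add) (simp_all add: sum_distrib_left)
  also have "\<dots> = k * ((\<Prod>q\<in>?P. 1 - 1 / real q) * (-1) ^ card Q * (\<Prod>q\<in>Q. 1 / (real q - 1)))"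
  proof -
    have 1: "(\<Prod>q\<in>?P. 1 - 1 / real q) = (\<Prod>q\<in>?P - Q. 1 - 1 / real q) * (\<Prod>q\<in>Q. 1 - 1 / real q)"
      by (rule prod.subset_diff[OF QP]) auto
    have 2: "(\<Prod>q\<in>Q. 1 - 1 / real q) * (\<Prod>q\<in>Q. 1 / (real q - 1)) = (\<Prod>q\<in>Q. 1 / real q)"
      unfolding prod.distrib[symmetric]
    proof (rule prod.cong[OF refl])
      fix q assume "q \<in> Q"
      then have "q > 1" using finQ prime_gt_1_nat by blast
      then show "(1 - 1 / real q) * (1 / (real q - 1)) = 1 / real q" by (simp add: field_simps)
    qed
    have 3: "(\<Prod>q\<in>Q. 1 / real q) = 1 / l" by (simp add: lQ prod_dividef)
    have "(\<Prod>q\<in>?P. 1 - 1 / real q) * (-1) ^ card Q * (\<Prod>q\<in>Q. 1 / (real q - 1))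
        = (-1) ^ card Q * (\<Prod>q\<in>?P - Q. 1 - 1 / real q) * ((\<Prod>q\<in>Q. 1 - 1 / real q) * (\<Prod>q\<in>Q. 1 / (real q - 1)))"
      unfolding 1 by (simp only: mult_ac)
    then show ?thesis unfolding 2 3 by simp
  qed
  also have "(\<Prod>q\<in>?P. 1 - 1 / real q) = totient k / k"
    using totient_formula2[of k] k by simp
  finally have *: "ramanujan_sum k h = k * (totient k / k * (-1) ^ card Q * (\<Prod>q\<in>Q. 1 / (real q - 1)))" .
  show ?thesis
  proof (cases "k dvd h")
    case True
    then have "l = 1" using k by (simp add: l_def gcd_proj2_if_dvd_nat)
    then show ?thesis using True * by (simp add: gam_def Q_def)
  next
    case False
    have j: "rad k div l * l = rad k" "rad k div l \<noteq> 0" using h rad_pos[of k] by (auto simp: l_def[symmetric])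
    have "gcd (rad k div l) (rad k) = rad k div l" using j(1) by (intro gcd_nat.absorb1) (metis dvd_triv_left)
    moreover have "rad k div (rad k div l) = l" using j by (metis nonzero_mult_div_cancel_left)
    ultimately show ?thesis
      using False * j sq by (simp add: gam_def Let_def moebius_fun_def Q_def l_def[symmetric])
  qed
qed

lemma ramanujan_sum_0: "k > 0 \<Longrightarrow> ramanujan_sum k 0 = k * gam k 0"
  by (subst ramanujan_sum_eq_gam) auto

text \<open>If k / gcd h k does not divide rad k, no set T satisfies the condition in
  \<open>ramanujan_sum\<close> and the value is 0; this is where the positive part in
  \<open>gam_max\<close> enters. Otherwise l > 1 puts the index rad k / l into the range of the
  maximum.\<close>

lemma ramanujan_sum_le:
  assumes "1 \<le> h" "h < k"
  shows "ramanujan_sum k h \<le> k * gam_max k"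
proof (cases "k div gcd h k dvd rad k")
  case True
  define l where "l = k div gcd h k"
  have nd: "\<not> k dvd h" using assms by (auto dest: dvd_imp_le)
  have "gcd h k \<le> h" using assms by (intro gcd_le1_nat) simp
  with assms(2) have "gcd h k < k" by (rule le_less_trans[rotated])
  moreover have "k = gcd h k * l" by (simp add: l_def)
  ultimately have "l \<noteq> 0" "l \<noteq> 1" using assms by (metis less_irrefl mult_0_right not_less0, metis less_irrefl mult_1_right)
  then have "l > 1" by simp
  then have "rad k div l < rad k" "rad k div l \<ge> 1"
    using True rad_pos[of k] by (auto simp: l_def[symmetric] div_greater_zero_iff dvd_imp_le Suc_le_eq)
  then have "gam k (rad k div l) \<le> gam_max k" by (intro gam_le_gam_max)
  then show ?thesis using ramanujan_sum_eq_gam[OF _ True] assms nd by (simp add: l_def[symmetric])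
next
  case False
  have "ramanujan_sum k h = 0" unfolding ramanujan_sum_def
  proof (rule sum.neutral, rule ballI)
    fix T assume "T \<in> Pow (prime_factors k)"
    then have fT: "T \<subseteq> prime_factors k" "finite T" "\<And>q. q \<in> T \<Longrightarrow> prime q" by (auto intro: finite_subset)
    have "\<Prod>T dvd rad k" unfolding rad_def by (rule prod_dvd_prod_subset) (use fT in auto)
    moreover have "k div gcd h k dvd \<Prod>T" if "k dvd h * \<Prod>T"
    proof -
      have "k div gcd h k dvd h * \<Prod>T div gcd h k"
        using that by (intro div_dvd_div[THEN iffD2]) auto
      then have "k div gcd h k dvd h div gcd h k * \<Prod>T" by (simp add: dvd_div_mult)
      moreover have "coprime (k div gcd h k) (h div gcd h k)"
        using assms by (subst coprime_commute) (auto intro: div_gcd_coprime)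
      ultimately show ?thesis using coprime_dvd_mult_right_iff by blast
    qed
    ultimately have "\<not> k dvd h * \<Prod>T" using False dvd_trans by blast
    then show "(if k dvd h * \<Prod>T then (-1) ^ card T * (real k / real (\<Prod>T)) else 0) = 0" by simp
  qed
  then show ?thesis using gam_max_nonneg by simp
qed

text \<open>Only \<mu>(l) = 1 with l > 1 is delicate: then l has a positive even number of primes,
  so one of them exceeds 2 and its factor 1/(q - 1) is below 1. Strictness yields \<beta> >
  0.\<close>

lemma gam_less_gam_0:
  assumes k: "k > 0" and j: "1 \<le> j" "j < rad k"
  shows "gam k j < gam k 0"
proof -
  define l where "l = rad k div gcd j (rad k)"
  let ?pr = "\<Prod>q\<in>prime_factors l. 1 / (real q - 1)"
  have "gcd j (rad k) \<le> j" using j by (intro gcd_le1_nat) simp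
  with j(2) have "gcd j (rad k) < rad k" by (rule le_less_trans[rotated])
  moreover have "rad k = gcd j (rad k) * l" by (simp add: l_def)
  ultimately have "l \<noteq> 0" "l \<noteq> 1" using j by (metis less_irrefl mult_0_right not_less0, metis less_irrefl mult_1_right)
  then have l: "l > 1" by simp
  have factor: "0 \<le> 1 / (real q - 1)" "1 / (real q - 1) \<le> 1" if "q \<in> prime_factors l" for q
  proof -
    have "q \<ge> 2" using that prime_ge_2_nat by blast
    then show "0 \<le> 1 / (real q - 1)" "1 / (real q - 1) \<le> 1" by (simp_all add: divide_le_eq)
  qed
  have "real_of_int (moebius_fun l) * ?pr < 1"
  proof (cases "moebius_fun l = 1")
    case False
    then have "real_of_int (moebius_fun l) \<le> 0" by (auto simp: moebius_fun_def minus_one_power_iff)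
    moreover have "?pr \<ge> 0" by (intro prod_nonneg factor)
    ultimately have "real_of_int (moebius_fun l) * ?pr \<le> 0" by (rule mult_nonpos_nonneg)
    then show ?thesis by linarith
  next
    case True
    then have "even (card (prime_factors l))" by (auto simp: moebius_fun_def minus_one_power_iff split: if_splits)
    moreover have "prime_factors l \<noteq> {}" using l by (simp add: prime_factorization_empty_iff)
    then have "card (prime_factors l) \<noteq> 0" by simp
    ultimately have "card (prime_factors l) > 1" by (cases "card (prime_factors l)" rule: nat.exhaust) (auto simp del: card_0_eq intro: Nat.gr0I)
    then have "\<not> prime_factors l \<subseteq> {2}" using card_mono[of "{2}" "prime_factors l"] by auto
    then obtain q where q: "q \<in> prime_factors l" "q \<noteq> 2" by auto
    then have "q > 2" using prime_ge_2_nat[OF in_prime_factors_imp_prime[OF q(1)]] by simp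
    then have "1 / (real q - 1) < 1" by simp
    moreover have "?pr = 1 / (real q - 1) * (\<Prod>q\<in>prime_factors l - {q}. 1 / (real q - 1))"
      by (rule prod.remove) (use q in auto)
    moreover have "(\<Prod>q\<in>prime_factors l - {q}. 1 / (real q - 1)) \<le> 1"
      by (rule prod_le_1) (use factor in auto)
    moreover have "(\<Prod>q\<in>prime_factors l - {q}. 1 / (real q - 1)) \<ge> 0"
      by (rule prod_nonneg) (use factor in auto)
    ultimately have "?pr < 1" using factor(1)[OF q(1)] mult_left_le[of "\<Prod>q\<in>prime_factors l - {q}. 1 / (real q - 1)" "1 / (real q - 1)"]
      by linarith
    then show ?thesis using True by simp
  qed
  moreover have "totient k / k > 0" using k by simp
  ultimately have "totient k / k * (real_of_int (moebius_fun l) * ?pr) < totient k / k * 1"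
    by (rule mult_strict_left_mono)
  then show ?thesis using j by (simp add: gam_def Let_def l_def[symmetric] mult.assoc)
qed

lemma gam_0_bounds: "k > 0 \<Longrightarrow> 0 < gam k 0 \<and> gam k 0 \<le> 1 \<and> (k > 1 \<longrightarrow> gam k 0 < 1)"
  using totient_le[of k] totient_less[of k] by (auto simp: gam_def)

lemma gam_max_less: "k > 0 \<Longrightarrow> gam_max k < gam k 0"
  unfolding gam_max_def using gam_less_gam_0[of k] gam_0_bounds[of k]
  by (subst Max_less_iff) auto

section \<open>Power series with logarithmic weight\<close>

definition P_fps :: "nat \<Rightarrow> complex fps" where "P_fps k = fps_exp 1 oo log_fps k"

text \<open>The logarithmic derivative z p'/p. Its coefficients have period k from index 1 on, and
  the coefficient at 0 vanishes.\<close>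

definition D_fps :: "nat \<Rightarrow> complex fps" where
  "D_fps k = Abs_fps (\<lambda>j. if 1 \<le> j \<and> coprime j k then 1 else 0)"

lemma P_fps_nth: "fps_nth (P_fps k) n = of_real (p_coeff k n)"
  by (simp add: P_fps_def p_coeff_complex)

lemma P_fps_deriv: "fps_X * fps_deriv (P_fps k) = D_fps k * P_fps k"
proof -
  have "fps_deriv (P_fps k) = P_fps k * fps_deriv (log_fps k)"
    unfolding P_fps_def by (subst fps_compose_deriv) (simp_all add: log_fps_def)
  moreover have "fps_X * fps_deriv (log_fps k) = D_fps k"
  proof (rule fps_ext)
    fix n show "fps_nth (fps_X * fps_deriv (log_fps k)) n = fps_nth (D_fps k) n"
      by (cases n) (simp_all add: log_fps_def D_fps_def del: of_nat_Suc)
  qed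
  ultimately show ?thesis by (metis mult.assoc mult.commute)
qed

lemma fps_ode_coeff:
  assumes "fps_X * fps_deriv C = D_fps k * C + E"
  shows "of_nat n * fps_nth C n = (\<Sum>j=0..n. fps_nth (D_fps k) j * fps_nth C (n - j)) + fps_nth E n"
proof -
  have "fps_nth (fps_X * fps_deriv C) n = of_nat n * fps_nth C n" by (cases n) auto
  then show ?thesis unfolding assms by (simp add: fps_mult_nth)
qed

text \<open>Compare coefficients i and i + k: by periodicity of \<open>D_fps\<close>, the part of
  the longer convolution beyond j = k reproduces i times coefficient i, and the part up to k is the
  sum over units. E has died out at both indices.\<close>

lemma fps_ode_coprime_recurrence:
  assumes ode: "fps_X * fps_deriv C = D_fps k * C + E" and E: "\<And>n. n \<ge> N \<Longrightarrow> fps_nth E n = 0"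
    and k: "k > 0"
  shows "coprime_recurrence k (fps_nth C) N"
  unfolding coprime_recurrence_def
proof (intro allI impI)
  fix i assume i: "i \<ge> N"
  let ?D = "fps_nth (D_fps k)"
  have D: "?D (j + k) = ?D j" if "j \<ge> 1" for j using that by (simp add: D_fps_def coprime_iff_gcd_eq_1)
  have "of_nat (i + k) * fps_nth C (i + k) = (\<Sum>j=0..i + k. ?D j * fps_nth C (i + k - j))"
    using fps_ode_coeff[OF ode, of "i + k"] E[of "i + k"] i by simp
  also have "{0..i + k} = insert 0 ({1..k} \<union> {1 + k..i + k})" by auto
  also have "(\<Sum>j\<in>insert 0 ({1..k} \<union> {1 + k..i + k}). ?D j * fps_nth C (i + k - j))
      = (\<Sum>j=1..k. ?D j * fps_nth C (i + k - j)) + (\<Sum>j=1 + k..i + k. ?D j * fps_nth C (i + k - j))"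
    by (subst sum.insert, simp, simp, subst sum.union_disjoint) (auto simp: D_fps_def)
  also have "(\<Sum>j=1..k. ?D j * fps_nth C (i + k - j)) = (\<Sum>j\<in>units_upto k. fps_nth C (i + k - j))"
    unfolding units_upto_def by (subst sum.inter_filter) (auto intro!: sum.cong simp: D_fps_def)
  also have "(\<Sum>j=1 + k..i + k. ?D j * fps_nth C (i + k - j)) = (\<Sum>j=1..i. ?D j * fps_nth C (i - j))"
    by (subst sum.shift_bounds_cl_nat_ivl) (auto intro!: sum.cong simp: D)
  also have "\<dots> = (\<Sum>j=0..i. ?D j * fps_nth C (i - j))"
    by (rule sum.mono_neutral_left) (auto simp: D_fps_def)
  also have "\<dots> = of_nat i * fps_nth C i"
    using fps_ode_coeff[OF ode, of i] E[of i] i by simp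
  finally show "of_nat (i + k) * fps_nth C (i + k) = of_nat i * fps_nth C i + (\<Sum>j\<in>units_upto k. fps_nth C (i + k - j))"
    by simp
qed

lemma p_coeff_0 [simp]: "p_coeff k 0 = 1"
  by (simp add: p_coeff_def fps_compose_nth)

lemma p_coeff_recurrence: "real n * p_coeff k n = (\<Sum>j\<in>{j\<in>{1..n}. coprime j k}. p_coeff k (n - j))"
proof -
  have "of_nat n * fps_nth (P_fps k) n = (\<Sum>j=0..n. fps_nth (D_fps k) j * fps_nth (P_fps k) (n - j)) + fps_nth 0 n"
    by (rule fps_ode_coeff) (simp add: P_fps_deriv)
  also have "\<dots> = (\<Sum>j=0..n. if 1 \<le> j \<and> coprime j k then of_real (p_coeff k (n - j)) else 0)"
    by (auto simp: P_fps_nth D_fps_def intro!: sum.cong)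
  also have "\<dots> = (\<Sum>j\<in>{j\<in>{0..n}. 1 \<le> j \<and> coprime j k}. of_real (p_coeff k (n - j)))"
    by (rule sum.inter_filter[symmetric]) simp
  also have "{j\<in>{0..n}. 1 \<le> j \<and> coprime j k} = {j\<in>{1..n}. coprime j k}" by auto
  finally have "complex_of_real (real n * p_coeff k n) = of_real (\<Sum>j\<in>{j\<in>{1..n}. coprime j k}. p_coeff k (n - j))"
    by (simp add: P_fps_nth)
  then show ?thesis by (simp only: of_real_eq_iff)
qed

text \<open>The index j = 1 is coprime to every k, so the sum in the recurrence is nonempty and
  positivity propagates.\<close>

lemma p_coeff_pos: "p_coeff k n > 0"
proof (induction n rule: less_induct)
  case (less n)
  show ?case
  proof (cases "n = 0")
    case False
    have "(\<Sum>j\<in>{j\<in>{1..n}. coprime j k}. p_coeff k (n - j)) > 0"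
      using False by (intro sum_pos less.IH) (auto intro!: exI[of _ 1])
    then have "real n * p_coeff k n > 0" by (simp only: p_coeff_recurrence)
    then show ?thesis by (simp add: zero_less_mult_iff)
  qed simp
qed

lemma p_coeff_nonneg: "p_coeff k n \<ge> 0"
  using p_coeff_pos less_imp_le by blast

lemma p_coeff_1: "p_coeff 1 n = 1"
proof (induction n rule: less_induct)
  case (less n)
  have "real n * p_coeff 1 n = (\<Sum>j\<in>{1..n}. 1)"
    unfolding p_coeff_recurrence by (rule sum.cong) (use less in auto)
  then show ?case by (cases "n = 0") auto
qed

section \<open>Radii of convergence and p on the unit interval\<close>

lemma fps_conv_radius_geI:
  fixes C :: "'a::{banach, real_normed_div_algebra} fps"
  assumes "\<And>t. 0 < t \<Longrightarrow> t < 1 \<Longrightarrow> summable (\<lambda>n. fps_nth C n * of_real t ^ n)"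
  shows "fps_conv_radius C \<ge> 1"
  unfolding fps_conv_radius_def by (rule conv_radius_geI_ex') (use assms in \<open>auto simp: one_ereal_def\<close>)

lemma fps_conv_radius_bounded:
  fixes C :: "complex fps"
  assumes "\<And>n. norm (fps_nth C n) \<le> B"
  shows "fps_conv_radius C \<ge> 1"
proof (rule fps_conv_radius_geI)
  fix t :: real assume t: "0 < t" "t < 1"
  have "summable (\<lambda>n. B * t ^ n)" using t by (intro summable_mult summable_geometric) auto
  then show "summable (\<lambda>n. fps_nth C n * of_real t ^ n)"
    by (rule summable_comparison_test'[where N = 0])
      (use assms t in \<open>auto simp: norm_mult norm_power intro!: mult_right_mono\<close>)
qed

lemma fps_conv_radius_P: "fps_conv_radius (P_fps k) \<ge> 1"
proof (rule fps_conv_radius_geI)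
  fix t :: real assume "0 < t" "t < 1"
  then show "summable (\<lambda>n. fps_nth (P_fps k) n * of_real t ^ n)"
    using p_coeff_sums[of "of_real t" k] by (simp add: P_fps_nth sums_iff)
qed

lemma fps_conv_radius_D: "fps_conv_radius (D_fps k) \<ge> 1"
  by (rule fps_conv_radius_bounded[where B = 1]) (simp add: D_fps_def)

lemma norm_less_radius: "norm z < 1 \<Longrightarrow> fps_conv_radius C \<ge> 1 \<Longrightarrow> ereal (norm z) < fps_conv_radius C"
  by (metis ereal_less(3) less_le_trans)

lemma eval_P_fps: "norm z < 1 \<Longrightarrow> eval_fps (P_fps k) z = p_fun k z"
  using p_coeff_sums[of z k] unfolding eval_fps_def by (simp add: P_fps_nth sums_iff)

lemma summable_log_series:
  fixes t :: real
  assumes "0 \<le> t" "t < 1"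
  shows "summable (\<lambda>j. if 1 \<le> j \<and> coprime j k then t ^ j / of_nat j else 0)"
proof (rule summable_comparison_test'[where N = 0])
  show "summable (\<lambda>n. t ^ n)" using assms by (intro summable_geometric) auto
  show "norm (if 1 \<le> j \<and> coprime j k then t ^ j / of_nat j else 0) \<le> t ^ j" for j
    using assms by (auto simp: divide_le_eq mult_le_cancel_left1)
qed

lemma p_fun_of_real:
  assumes "0 \<le> t" "t < 1"
  shows "p_fun k (of_real t :: complex) = of_real (p_fun k t)"
proof -
  have "(\<Sum>j. if 1 \<le> j \<and> coprime j k then (of_real t :: complex) ^ j / of_nat j else 0)
      = (\<Sum>j. of_real (if 1 \<le> j \<and> coprime j k then t ^ j / of_nat j else 0))"
    by (intro suminf_cong) auto
  also have "\<dots> = of_real (\<Sum>j. if 1 \<le> j \<and> coprime j k then t ^ j / of_nat j else 0)"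
    by (intro suminf_of_real[symmetric] summable_log_series assms)
  finally show ?thesis by (simp add: p_fun_def exp_of_real)
qed

lemma p_fun_pos: "p_fun k (t::real) > 0"
  by (simp add: p_fun_def)

lemma p_fun_sums:
  assumes "0 \<le> t" "t < 1"
  shows "(\<lambda>n. p_coeff k n * t ^ n) sums p_fun k (t::real)"
proof -
  have "(\<lambda>n. complex_of_real (p_coeff k n * t ^ n)) sums of_real (p_fun k t)"
    using p_coeff_sums[of "of_real t" k] assms by (simp add: p_fun_of_real)
  then show ?thesis by (simp only: sums_of_real_iff)
qed

lemma p_fun_mono:
  assumes "0 \<le> s" "s \<le> t" "t < 1"
  shows "p_fun k s \<le> p_fun k (t::real)"
  by (rule sums_le[OF _ p_fun_sums p_fun_sums])
    (use assms in \<open>auto intro!: mult_left_mono power_mono p_coeff_nonneg\<close>)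

lemma p_fun_1: "0 \<le> t \<Longrightarrow> t < 1 \<Longrightarrow> p_fun 1 (t::real) = 1 / (1 - t)"
  using p_fun_sums[of t 1] geometric_sums[of t] unfolding p_coeff_1 by (simp add: sums_iff)

text \<open>The series of log p for k is a part of the one for k = 1, where p = 1/(1 - t). Each term
  increases in t, so log p grows by no more than log (1/(1 - t)) does.\<close>

lemma p_fun_growth:
  assumes "0 \<le> s" "s \<le> t" "t < 1"
  shows "(1 - t) * p_fun k t \<le> (1 - s) * p_fun k (s::real)"
proof -
  let ?a = "\<lambda>k t j. if 1 \<le> j \<and> coprime j k then t ^ j / of_nat j else (0::real)"
  have sm: "summable (?a k t)" "summable (?a k s)" for k
    by (rule summable_log_series; use assms in simp)+
  have "suminf (?a k t) - suminf (?a k s) = (\<Sum>j. ?a k t j - ?a k s j)"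
    by (rule suminf_diff[OF sm])
  also have "\<dots> \<le> (\<Sum>j. ?a 1 t j - ?a 1 s j)"
  proof (rule suminf_le)
    show "?a k t j - ?a k s j \<le> ?a 1 t j - ?a 1 s j" for j
    proof -
      have "s ^ j / j \<le> t ^ j / j" using assms by (intro divide_right_mono power_mono) auto
      then show ?thesis by auto
    qed
  qed (intro summable_diff sm)+
  also have "\<dots> = suminf (?a 1 t) - suminf (?a 1 s)"
    by (rule suminf_diff[OF sm, symmetric])
  finally have "p_fun k t / p_fun k s \<le> p_fun 1 t / p_fun 1 s"
    unfolding p_fun_def exp_diff[symmetric] exp_le_cancel_iff .
  also have "\<dots> = (1 - s) / (1 - t)" using assms p_fun_1[of s] p_fun_1[of t] by simp
  finally show ?thesis using assms p_fun_pos[of k s] by (simp add: field_simps)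
qed

lemma fps_conv_radius_ode:
  assumes ode: "fps_X * fps_deriv C = D_fps k * C + E" and C: "fps_conv_radius C \<ge> 1"
  shows "fps_conv_radius E \<ge> 1"
proof -
  have E: "E = fps_X * fps_deriv C - D_fps k * C" using ode by simp
  have "fps_conv_radius (fps_deriv C) \<ge> 1" using C fps_conv_radius_deriv[of C] by (rule order_trans)
  then have 1: "fps_conv_radius (fps_X * fps_deriv C) \<ge> 1"
    using fps_conv_radius_mult[of fps_X "fps_deriv C"] by (auto intro: order_trans)
  have 2: "fps_conv_radius (D_fps k * C) \<ge> 1"
    using fps_conv_radius_mult[of "D_fps k" C] C fps_conv_radius_D[of k] by (meson min.boundedI order_trans)
  show ?thesis unfolding E using fps_conv_radius_diff 1 2 by (meson min.boundedI order_trans)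
qed

section \<open>Quotients C/p on the unit interval\<close>

definition ratio_fun :: "nat \<Rightarrow> complex fps \<Rightarrow> real \<Rightarrow> complex" where
  "ratio_fun k C t = eval_fps C (of_real t) / of_real (p_fun k t)"

text \<open>Since z p' = D p, the terms with D cancel in the quotient rule. For E = z^m the
  derivative is the integrand of \<open>G\<^sub>m\<close>.\<close>

lemma has_field_derivative_ratio:
  assumes ode: "fps_X * fps_deriv C = D_fps k * C + E" and C: "fps_conv_radius C \<ge> 1"
    and z: "norm z < 1" "z \<noteq> 0"
  shows "((\<lambda>z. eval_fps C z / p_fun k z) has_field_derivative eval_fps E z / (z * p_fun k z)) (at z)"
proof -
  note E = fps_conv_radius_ode[OF ode C]
  note rC = norm_less_radius[OF z(1) C] and rP = norm_less_radius[OF z(1) fps_conv_radius_P[of k]]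
    and rD = norm_less_radius[OF z(1) fps_conv_radius_D[of k]] and rE = norm_less_radius[OF z(1) E]
  have rC': "ereal (norm z) < fps_conv_radius (fps_deriv C)"
    using rC fps_conv_radius_deriv by (rule less_le_trans)
  have rP': "ereal (norm z) < fps_conv_radius (fps_deriv (P_fps k))"
    using rP fps_conv_radius_deriv by (rule less_le_trans)
  have rDC: "ereal (norm z) < fps_conv_radius (D_fps k * C)"
    using rD rC fps_conv_radius_mult[of "D_fps k" C] by (metis less_le_trans min_less_iff_conj)
  have eC: "z * eval_fps (fps_deriv C) z = eval_fps (D_fps k) z * eval_fps C z + eval_fps E z"
    using arg_cong[OF ode, of "\<lambda>F. eval_fps F z"] rC rC' rD rE rDC
    by (simp add: eval_fps_mult eval_fps_add)
  have eP: "z * eval_fps (fps_deriv (P_fps k)) z = eval_fps (D_fps k) z * eval_fps (P_fps k) z"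
    using arg_cong[OF P_fps_deriv[of k], of "\<lambda>F. eval_fps F z"] rP rP' rD
    by (simp add: eval_fps_mult)
  have nz: "eval_fps (P_fps k) z \<noteq> 0" using z by (simp add: eval_P_fps p_fun_def)
  let ?c = "eval_fps C z" and ?c' = "eval_fps (fps_deriv C) z"
    and ?p = "eval_fps (P_fps k) z" and ?p' = "eval_fps (fps_deriv (P_fps k)) z"
  have "((\<lambda>z. eval_fps C z / eval_fps (P_fps k) z) has_field_derivative (?c' * ?p - ?c * ?p') / (?p * ?p)) (at z)"
    by (intro DERIV_divide has_field_derivative_eval_fps rC rP nz)
  moreover have "(?c' * ?p - ?c * ?p') / (?p * ?p) = eval_fps E z / (z * p_fun k z)"
  proof -
    have "z * (?c' * ?p - ?c * ?p') = (z * ?c') * ?p - ?c * (z * ?p')" by (simp add: algebra_simps)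
    also have "\<dots> = eval_fps E z * ?p" unfolding eC eP by (simp add: algebra_simps)
    finally have "?c' * ?p - ?c * ?p' = eval_fps E z * ?p / z" using z by (simp add: field_simps)
    then show ?thesis using nz z by (simp add: eval_P_fps)
  qed
  ultimately have "((\<lambda>z. eval_fps C z / eval_fps (P_fps k) z) has_field_derivative eval_fps E z / (z * p_fun k z)) (at z)"
    by simp
  \<comment> \<open>The evaluated series is identified with \<open>p_fun\<close> only inside the
    unit disc, so the replacement is made in a neighbourhood of z.\<close>
  then show ?thesis
  proof (rule DERIV_cong_ev[THEN iffD1, rotated -1])
    have "eventually (\<lambda>w. w \<in> ball 0 1) (nhds z)" using z by (intro eventually_nhds_in_open) auto
    then show "\<forall>\<^sub>F w in nhds z. eval_fps C w / eval_fps (P_fps k) w = eval_fps C w / p_fun k w"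
      by eventually_elim (simp add: eval_P_fps)
  qed auto
qed

lemma has_vector_derivative_ratio_fun:
  assumes ode: "fps_X * fps_deriv C = D_fps k * C + E" and C: "fps_conv_radius C \<ge> 1"
    and t: "0 < t" "t < 1"
  shows "(ratio_fun k C has_vector_derivative eval_fps E (of_real t) / of_real (t * p_fun k t)) (at t)"
proof -
  have "((\<lambda>t. eval_fps C (of_real t) / p_fun k (of_real t)) has_vector_derivative
     eval_fps E (of_real t) / (of_real t * p_fun k (of_real t))) (at t)"
    using has_field_derivative_ratio[OF ode C, of "of_real t"] t
    by (intro has_vector_derivative_real_field) auto
  then have "((\<lambda>t. eval_fps C (of_real t) / p_fun k (of_real t)) has_vector_derivative
     eval_fps E (of_real t) / of_real (t * p_fun k t)) (at t)"
    using t by (simp add: p_fun_of_real)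
  then show ?thesis
  proof (rule has_vector_derivative_transform_within_open)
    show "open {0<..<1::real}" "t \<in> {0<..<1}" using t by auto
  qed (auto simp: ratio_fun_def p_fun_of_real)
qed

lemma continuous_on_ratio_fun:
  assumes C: "fps_conv_radius C \<ge> 1" and x: "x < 1"
  shows "continuous_on {0..x} (ratio_fun k C)"
proof -
  have "continuous_on {0..x} (\<lambda>t. eval_fps C (of_real t) / eval_fps (P_fps k) (of_real t))"
  proof (intro continuous_on_divide continuous_on_compose2[OF continuous_on_eval_fps] continuous_intros)
    show "(of_real ` {0..x} :: complex set) \<subseteq> eball 0 (fps_conv_radius C)"
      "(of_real ` {0..x} :: complex set) \<subseteq> eball 0 (fps_conv_radius (P_fps k))"
    proof -
      have "z \<in> eball 0 (fps_conv_radius C)" "z \<in> eball 0 (fps_conv_radius (P_fps k))"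
        if "z \<in> of_real ` {0..x}" for z :: complex
      proof -
        have "norm z < 1" using that x by auto
        then show "z \<in> eball 0 (fps_conv_radius C)" "z \<in> eball 0 (fps_conv_radius (P_fps k))"
          using norm_less_radius[OF _ C] norm_less_radius[OF _ fps_conv_radius_P] by auto
      qed
      then show "(of_real ` {0..x} :: complex set) \<subseteq> eball 0 (fps_conv_radius C)"
        "(of_real ` {0..x} :: complex set) \<subseteq> eball 0 (fps_conv_radius (P_fps k))" by blast+
    qed
  qed (use x in \<open>auto simp: eval_P_fps p_fun_def\<close>)
  then show ?thesis
    by (rule continuous_on_eq) (use x in \<open>auto simp: ratio_fun_def eval_P_fps p_fun_of_real\<close>)
qed

lemma ratio_fun_0: "fps_nth C 0 = 0 \<Longrightarrow> ratio_fun k C 0 = 0"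
  by (simp add: ratio_fun_def eval_fps_at_0)

text \<open>The derivative s^(m-1)/p(s) is at most 1/p(x) on the interval because p increases, and
  the length is at most 1 - x. Uniformity in t allows t to approach 1 later.\<close>

lemma ratio_fun_increment:
  assumes ode: "fps_X * fps_deriv C = D_fps k * C + fps_X ^ m" and C: "fps_conv_radius C \<ge> 1"
    and m: "m \<ge> 1" and x: "0 < x" "x \<le> t" "t < 1"
  shows "norm (ratio_fun k C t - ratio_fun k C x) \<le> (1 - x) / p_fun k x"
proof (cases "x = t")
  case False
  then have xt: "x < t" using x by simp
  have "norm (ratio_fun k C t - ratio_fun k C x) \<le> t / p_fun k x - x / p_fun k x"
  proof (rule differentiable_bound_general[OF xt, where f' = "\<lambda>s. eval_fps (fps_X ^ m) (of_real s) / of_real (s * p_fun k s)" and \<phi>' = "\<lambda>_. 1 / p_fun k x"])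
    show "continuous_on {x..t} (ratio_fun k C)"
      using continuous_on_ratio_fun[OF C x(3)] by (rule continuous_on_subset) (use x in auto)
    show "continuous_on {x..t} (\<lambda>s. s / p_fun k x)" by (intro continuous_intros) (simp add: less_imp_neq[OF p_fun_pos, symmetric])
    fix s assume s: "x < s" "s < t"
    show "(ratio_fun k C has_vector_derivative eval_fps (fps_X ^ m) (of_real s) / of_real (s * p_fun k s)) (at s)"
      using s x by (intro has_vector_derivative_ratio_fun ode C) auto
    show "((\<lambda>s. s / p_fun k x) has_vector_derivative 1 / p_fun k x) (at s)"
      using p_fun_pos[of k x] by (auto intro!: derivative_eq_intros simp: has_real_derivative_iff_has_vector_derivative[symmetric])
    have "s ^ m \<le> s ^ 1" using s x m by (intro power_decreasing) auto
    then have "s ^ m / s \<le> 1" using s x by simp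
    moreover have "1 / p_fun k s \<le> 1 / p_fun k x"
      using s x p_fun_mono[of x s k] p_fun_pos[of k x] by (intro divide_left_mono) (auto intro!: mult_pos_pos p_fun_pos)
    ultimately have "s ^ m / s * (1 / p_fun k s) \<le> 1 * (1 / p_fun k x)"
      using s x p_fun_pos[of k s] by (intro mult_mono) auto
    then show "norm (eval_fps (fps_X ^ m) (of_real s) / of_real (s * p_fun k s) :: complex) \<le> 1 / p_fun k x"
      using s x p_fun_pos[of k s] by (simp add: norm_divide norm_mult norm_power)
  qed
  also have "\<dots> \<le> (1 - x) / p_fun k x"
    using x p_fun_pos[of k x] by (simp flip: diff_divide_distrib add: divide_right_mono)
  finally show ?thesis .
qed (use x p_fun_pos[of k x] in simp)

text \<open>The function \<open>\<Psi>\<close> dominates \<open>ratio_fun k C\<close> because \<open>(1 - t) p(t)\<close> decreases and because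
  \<open>(n + 1) H(t) \<le> t H'(t)\<close> for a power series \<open>H\<close> vanishing to order \<open>n\<close>.\<close>

lemma ratio_fun_tail_bound:
  assumes ode: "fps_X * fps_deriv C = D_fps k * C + E" and C: "fps_conv_radius C \<ge> 1" and C0: "fps_nth C 0 = 0"
    and E: "\<And>j. j \<le> n \<Longrightarrow> fps_nth E j = 0" and x: "0 < x" "x < 1" "1 - x \<ge> 1 / (real n + 1)"
  shows "summable (\<lambda>j. norm (fps_nth E j) / real j * x ^ j)"
    and "norm (ratio_fun k C x) \<le> 2 / p_fun k x * (\<Sum>j. norm (fps_nth E j) / real j * x ^ j)"
proof -
  define B where "B = Abs_fps (\<lambda>j. norm (fps_nth E j))"
  define H where "H = Abs_fps (\<lambda>j. norm (fps_nth E j) / real j)"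
  have RE: "fps_conv_radius E \<ge> 1" by (rule fps_conv_radius_ode[OF ode C])
  have RB: "fps_conv_radius B \<ge> 1" using RE by (simp add: B_def fps_conv_radius_def)
  have H': "fps_X * fps_deriv H = B"
  proof (rule fps_ext)
    fix j show "fps_nth (fps_X * fps_deriv H) j = fps_nth B j"
      using E[of 0] by (cases j) (simp_all add: H_def B_def del: of_nat_Suc)
  qed
  have RH: "fps_conv_radius H \<ge> 1"
  proof (rule fps_conv_radius_geI)
    fix t :: real assume t: "0 < t" "t < 1"
    have "ereal (norm t) < fps_conv_radius B"
      using t RB by (intro less_le_trans[OF _ RB]) auto
    then have "summable (\<lambda>n. norm (fps_nth B n * t ^ n))" by (rule norm_summable_fps)
    then show "summable (\<lambda>n. fps_nth H n * of_real t ^ n)"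
    proof (rule summable_comparison_test'[where N = 0])
      fix j :: nat
      have "norm (fps_nth E j) / j \<le> norm (fps_nth E j)"
        by (cases "j = 0") (auto simp: divide_le_eq mult_le_cancel_left1)
      then show "norm (fps_nth H j * of_real t ^ j) \<le> norm (fps_nth B j * t ^ j)"
        using t by (simp add: H_def B_def abs_mult mult_right_mono del: times_divide_eq_left)
    qed
  qed
  have rad: "ereal (norm t) < fps_conv_radius B" "ereal (norm t) < fps_conv_radius H"
    "ereal (norm (of_real t :: complex)) < fps_conv_radius E" if "0 \<le> t" "t < 1" for t :: real
    using that by (auto intro: less_le_trans[OF _ RB] less_le_trans[OF _ RH] less_le_trans[OF _ RE])
  have rad': "ereal (norm t) < fps_conv_radius (fps_deriv H)" if "0 \<le> t" "t < 1" for t :: real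
    using rad(2)[OF that] fps_conv_radius_deriv by (rule less_le_trans)
  have sums: "(\<lambda>j. norm (fps_nth E j) * t ^ j) sums eval_fps B t"
    "(\<lambda>j. norm (fps_nth E j) / j * t ^ j) sums eval_fps H t" if "0 \<le> t" "t < 1" for t :: real
    using sums_eval_fps[OF rad(1)[OF that]] sums_eval_fps[OF rad(2)[OF that]] by (simp_all add: B_def H_def)
  have BH: "t * eval_fps (fps_deriv H) t = eval_fps B t" if "0 \<le> t" "t < 1" for t :: real
    using arg_cong[OF H', of "\<lambda>F. eval_fps F t"] rad'[OF that] by (simp add: eval_fps_mult)
  \<comment> \<open>Nonzero coefficients have index at least n + 1, and H divides each coefficient
    by its index.\<close>
  have HB: "(real n + 1) * eval_fps H t \<le> eval_fps B t" if t: "0 \<le> t" "t < 1" for t :: real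
  proof (rule sums_le[OF _ sums_mult[OF sums(2)[OF t]] sums(1)[OF t]])
    fix j
    show "(real n + 1) * (norm (fps_nth E j) / j * t ^ j) \<le> norm (fps_nth E j) * t ^ j"
    proof (cases "j \<le> n")
      case False
      then have "(real n + 1) / j \<le> 1" by (simp add: divide_le_eq)
      then have "(real n + 1) / j * (norm (fps_nth E j) * t ^ j) \<le> 1 * (norm (fps_nth E j) * t ^ j)"
        using t by (intro mult_right_mono) auto
      then show ?thesis by simp
    qed (use E in simp)
  qed
  have normE: "norm (eval_fps E (of_real t)) \<le> eval_fps B t" if t: "0 \<le> t" "t < 1" for t :: real
  proof -
    have "norm (eval_fps E (of_real t)) \<le> (\<Sum>j. norm (fps_nth E j * of_real t ^ j))"
      unfolding eval_fps_def by (rule summable_norm, rule norm_summable_fps, rule rad(3)[OF t])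
    also have "\<dots> = eval_fps B t" using sums(1)[OF t] t by (simp add: norm_mult norm_power sums_iff)
    finally show ?thesis .
  qed
  have Hpos: "eval_fps H t \<ge> 0" and Bpos: "eval_fps B t \<ge> 0" if t: "0 \<le> t" "t < 1" for t :: real
    using sums_le[OF _ sums_zero sums(2)[OF t]] sums_le[OF _ sums_zero sums(1)[OF t]] t by auto
  define d where "d = 1 / (real n + 1)"
  define \<kappa> where "\<kappa> = 1 / (p_fun k x * (1 - x))"
  have \<kappa>: "\<kappa> > 0" using x p_fun_pos[of k x] by (simp add: \<kappa>_def)
  \<comment> \<open>\<open>\<kappa>\<close> is chosen so that 1/p(t) \<le> \<kappa>(1 - t) up to x.
    The extra d compensates the term -H from differentiating 1 - t, since H \<le> d t H'; at x it at
    most doubles the factor, because d \<le> 1 - x.\<close>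
  define \<Psi> where "\<Psi> t = \<kappa> * (eval_fps H t * (1 - t + d))" for t
  define \<psi> where "\<psi> t = \<kappa> * (eval_fps (fps_deriv H) t * (1 - t + d) - eval_fps H t)" for t
  have "norm (ratio_fun k C x - ratio_fun k C 0) \<le> \<Psi> x - \<Psi> 0"
  proof (rule differentiable_bound_general[OF x(1), where f' = "\<lambda>t. eval_fps E (of_real t) / of_real (t * p_fun k t)" and \<phi>' = \<psi>])
    show "continuous_on {0..x} (ratio_fun k C)" by (rule continuous_on_ratio_fun[OF C x(2)])
    have \<Psi>': "(\<Psi> has_real_derivative \<psi> t) (at t)" if t: "0 \<le> t" "t < 1" for t
      unfolding \<Psi>_def \<psi>_def using rad(2)[OF t]
      by (auto intro!: derivative_eq_intros has_field_derivative_eval_fps)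
    show "continuous_on {0..x} \<Psi>"
      using x by (intro continuous_at_imp_continuous_on ballI DERIV_isCont[OF \<Psi>']) auto
    fix t assume t: "0 < t" "t < x"
    then have t': "0 \<le> t" "t < 1" using x by auto
    show "(ratio_fun k C has_vector_derivative eval_fps E (of_real t) / of_real (t * p_fun k t)) (at t)"
      using t t' by (intro has_vector_derivative_ratio_fun[OF ode C])
    show "(\<Psi> has_vector_derivative \<psi> t) (at t)"
      using \<Psi>'[OF t'] by (simp add: has_real_derivative_iff_has_vector_derivative)
    let ?H' = "eval_fps (fps_deriv H) t"
    have H'B: "?H' = eval_fps B t / t" using BH[OF t'] t by (simp add: field_simps)
    have H'0: "?H' \<ge> 0" using Bpos[OF t'] t by (simp add: H'B)
    have p: "1 / p_fun k t \<le> \<kappa> * (1 - t)"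
      using p_fun_growth[of t x k] t t' x p_fun_pos[of k t] p_fun_pos[of k x] by (simp add: \<kappa>_def field_simps)
    have "norm (eval_fps E (of_real t) / of_real (t * p_fun k t)) = norm (eval_fps E (of_real t)) / t * (1 / p_fun k t)"
      using t p_fun_pos[of k t] by (simp add: norm_divide norm_mult)
    also have "\<dots> \<le> ?H' * (\<kappa> * (1 - t))"
      unfolding H'B using normE[OF t'] t t' p Bpos[OF t'] p_fun_pos[of k t] by (intro mult_mono divide_right_mono) auto
    also have "\<dots> \<le> \<psi> t"
    proof -
      have "eval_fps H t \<le> d * eval_fps B t" using HB[OF t'] by (simp add: d_def field_simps)
      also have "eval_fps B t = t * ?H'" by (rule BH[OF t', symmetric])
      also have "d * (t * ?H') \<le> d * (1 * ?H')" using t' H'0 by (intro mult_left_mono mult_right_mono) (auto simp: d_def)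
      finally have "0 \<le> \<kappa> * (d * ?H' - eval_fps H t)" using \<kappa> by simp
      then show ?thesis by (simp add: \<psi>_def algebra_simps)
    qed
    finally show "norm (eval_fps E (of_real t) / of_real (t * p_fun k t)) \<le> \<psi> t" .
  qed
  \<comment> \<open>The coefficient of H at 0 is a quotient by 0, hence 0.\<close>
  moreover have "\<Psi> 0 = 0" by (simp add: \<Psi>_def eval_fps_at_0 H_def)
  ultimately have "norm (ratio_fun k C x) \<le> \<Psi> x" by (simp add: ratio_fun_0[OF C0])
  also have "\<Psi> x \<le> \<kappa> * (eval_fps H x * (2 * (1 - x)))"
    unfolding \<Psi>_def using \<kappa> Hpos[of x] x by (intro mult_left_mono) (auto simp: d_def)
  also have "\<dots> = 2 / p_fun k x * eval_fps H x"
    using x p_fun_pos[of k x] by (simp add: \<kappa>_def divide_simps)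
  finally show "norm (ratio_fun k C x) \<le> 2 / p_fun k x * (\<Sum>j. norm (fps_nth E j) / real j * x ^ j)"
    using sums(2)[of x] x by (simp add: sums_iff)
  show "summable (\<lambda>j. norm (fps_nth E j) / real j * x ^ j)" using sums(2)[of x] x by (simp add: sums_iff)
qed

section \<open>Asymptotics of the coefficients\<close>

lemma coprime_recurrence_bound:
  assumes k: "k > 0"
  obtains K where "K \<ge> 0"
    and "\<And>u N W. coprime_recurrence k u N \<Longrightarrow> (\<And>i. i \<in> {N..<N + k} \<Longrightarrow> norm (u i) \<le> W) \<Longrightarrow>
      \<exists>L. norm ((\<Sum>i=N..<N + k. u i) - of_nat k * L * of_real (real (N + k) powr (-(1 - gam k 0)))) \<le> K * W / real (N + k) \<and>
        (\<forall>n\<ge>N. n \<ge> 1 \<longrightarrow> norm (u n - L * of_real (real n powr (-(1 - gam k 0)))) \<le> K * W * (real n / real (N + k)) powr (-(1 - gam_max k)))"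
proof (rule coprime_recurrence_asymptotics[of k "1 - gam k 0" "1 - gam_max k" "ramanujan_sum k"])
  show "k = 1 \<or> 1 - gam_max k - (1 - gam k 0) < 1"
    using k gam_0_bounds[OF k] gam_max_nonneg[of k] by (cases "k = 1") auto
  show "ramanujan_sum k 0 = k * (1 - (1 - gam k 0))" by (simp add: ramanujan_sum_0 k)
  show "ramanujan_sum k h \<le> k * (1 - (1 - gam_max k))" if "1 \<le> h" "h < k" for h
    using ramanujan_sum_le[OF that] by simp
qed (use k gam_0_bounds[OF k] gam_max_less[OF k] gam_max_nonneg[of k] sum_zeta_units[OF k] that in auto)

text \<open>The constant c is nonzero by positivity: start at N > K and bound the window entries by
  their sum S; then c = 0 would give S \<le> K S/(N + k) < S. The finitely many small n are absorbed
  into C and \<delta>.\<close>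

lemma p_coeff_asymptotics:
  assumes k: "k > 0"
  obtains c :: complex and C \<delta> :: real where "c \<noteq> 0" "C \<ge> 0" "\<delta> > 0"
    "\<And>n. n \<ge> 1 \<Longrightarrow> norm (of_real (p_coeff k n) - c * of_real (real n powr (gam k 0 - 1))) \<le> C * real n powr (gam_max k - 1)"
    "\<And>n. n \<ge> 1 \<Longrightarrow> p_coeff k n \<ge> \<delta> * real n powr (gam k 0 - 1)"
    "\<And>n. n \<ge> 1 \<Longrightarrow> p_coeff k n \<le> (norm c + C) * real n powr (gam k 0 - 1)"
proof -
  define s0 where "s0 = 1 - gam k 0"
  define s1 where "s1 = 1 - gam_max k"
  note params = gam_0_bounds[OF k] gam_max_less[OF k] gam_max_nonneg[of k]
  have s: "0 \<le> s0" "s0 < s1" "s1 \<le> 1" using params by (auto simp: s0_def s1_def)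
  obtain K where K: "K \<ge> 0"
    and asymp: "\<And>u N W. coprime_recurrence k u N \<Longrightarrow> (\<And>i. i \<in> {N..<N + k} \<Longrightarrow> norm (u i) \<le> W) \<Longrightarrow>
      \<exists>L. norm ((\<Sum>i=N..<N + k. u i) - of_nat k * L * of_real (real (N + k) powr (-s0))) \<le> K * W / real (N + k) \<and>
        (\<forall>n\<ge>N. n \<ge> 1 \<longrightarrow> norm (u n - L * of_real (real n powr (-s0))) \<le> K * W * (real n / real (N + k)) powr (-s1))"
    using coprime_recurrence_bound[OF k] unfolding s0_def s1_def by blast
  obtain N :: nat where N: "real N > K" using reals_Archimedean2 by blast
  define S where "S = (\<Sum>i=N..<N + k. p_coeff k i)"
  have S: "S > 0" unfolding S_def using k by (intro sum_pos p_coeff_pos) auto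
  have rec: "coprime_recurrence k (fps_nth (P_fps k)) N"
    by (rule fps_ode_coprime_recurrence[where E = 0]) (simp_all add: P_fps_deriv k)
  have "norm (fps_nth (P_fps k) i) \<le> S" if "i \<in> {N..<N + k}" for i
    using member_le_sum[of i "{N..<N + k}" "p_coeff k"] that p_coeff_nonneg[of k] by (simp add: P_fps_nth S_def)
  from asymp[OF rec this] obtain c :: complex where
    first: "norm (of_real S - of_nat k * c * of_real (real (N + k) powr (-s0))) \<le> K * S / real (N + k)"
    and second: "\<And>n. n \<ge> N \<Longrightarrow> n \<ge> 1 \<Longrightarrow> norm (of_real (p_coeff k n) - c * of_real (real n powr (-s0))) \<le> K * S * (real n / real (N + k)) powr (-s1)"
    by (auto simp: P_fps_nth S_def)
  have c: "c \<noteq> 0"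
  proof
    assume "c = 0"
    then have "S \<le> K * S / real (N + k)" using first S by simp
    also have "\<dots> < S" using N S K by (simp add: divide_less_eq mult.commute[of K])
    finally show False by simp
  qed
  define g where "g n = norm (of_real (p_coeff k n) - c * of_real (real n powr (-s0)))" for n
  \<comment> \<open>The summand at n = 0 is a quotient by 0 powr (-s1) = 0 and hence
    vanishes.\<close>
  define C where "C = (\<Sum>n<N. g n / real n powr (-s1)) + K * S * real (N + k) powr s1"
  have sumC: "(\<Sum>n<N. g n / real n powr (-s1)) \<ge> 0" by (intro sum_nonneg) (simp add: g_def)
  have tail: "K * S * real (N + k) powr s1 \<ge> 0" using K S by simp
  have C: "C \<ge> 0" using sumC tail by (simp add: C_def)
  have 1: "g n \<le> C * real n powr (-s1)" if n: "n \<ge> 1" for n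
  proof (cases "n < N")
    case True
    then have "g n / real n powr (-s1) \<le> (\<Sum>n<N. g n / real n powr (-s1))"
      by (intro member_le_sum) (auto simp: g_def)
    then have "g n / real n powr (-s1) \<le> C" using tail by (simp add: C_def)
    then show ?thesis using n by (simp add: divide_le_eq)
  next
    case False
    then have "g n \<le> K * S * (real n / real (N + k)) powr (-s1)" using second[of n] n by (simp add: g_def)
    also have "\<dots> = K * S * real (N + k) powr s1 * real n powr (-s1)"
      using n k by (simp add: powr_divide powr_minus field_simps)
    also have "\<dots> \<le> C * real n powr (-s1)" using sumC by (intro mult_right_mono) (auto simp: C_def)
    finally show ?thesis .
  qed
  have 2: "p_coeff k n \<le> (norm c + C) * real n powr (-s0)" if n: "n \<ge> 1" for n
  proof -
    have "p_coeff k n \<le> g n + norm (c * of_real (real n powr (-s0)))"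
      using norm_triangle_ineq2[of "of_real (p_coeff k n)" "c * of_real (real n powr (-s0))"] p_coeff_nonneg[of k n] by (simp add: g_def)
    also have "norm (c * of_real (real n powr (-s0))) = norm c * real n powr (-s0)" by (simp add: norm_mult)
    also have "g n \<le> C * real n powr (-s0)"
      using C n s by (intro order_trans[OF 1[OF n]] mult_left_mono powr_mono) auto
    finally show ?thesis by (simp add: algebra_simps)
  qed
  have "\<exists>N0. \<forall>n\<ge>N0. C * real n powr (s0 - s1) < norm c / 2"
  proof -
    have "((\<lambda>n. C * real n powr (s0 - s1)) \<longlongrightarrow> C * 0) sequentially"
      using s by (intro tendsto_mult_left tendsto_neg_powr filterlim_real_sequentially) auto
    then have "eventually (\<lambda>n. C * real n powr (s0 - s1) < norm c / 2) sequentially"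
      using c by (intro order_tendstoD(2)) auto
    then show ?thesis by (simp add: eventually_sequentially)
  qed
  then obtain N0 where N0: "\<And>n. n \<ge> N0 \<Longrightarrow> C * real n powr (s0 - s1) < norm c / 2" by blast
  define \<delta> where "\<delta> = Min (insert (norm c / 2) ((\<lambda>n. p_coeff k n / real n powr (-s0)) ` {1..N0}))"
  have \<delta>: "\<delta> > 0" unfolding \<delta>_def by (subst Min_gr_iff) (use c p_coeff_pos[of k] in auto)
  have 3: "p_coeff k n \<ge> \<delta> * real n powr (-s0)" if n: "n \<ge> 1" for n
  proof (cases "n \<le> N0")
    case True
    then have "\<delta> \<le> p_coeff k n / real n powr (-s0)" unfolding \<delta>_def using n by (intro Min_le) auto
    then show ?thesis using n by (simp add: le_divide_eq)
  next
    case False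
    have "\<delta> * real n powr (-s0) \<le> norm c / 2 * real n powr (-s0)"
      unfolding \<delta>_def by (intro mult_right_mono Min_le) auto
    also have "\<dots> \<le> norm c * real n powr (-s0) - C * real n powr (s0 - s1) * real n powr (-s0)"
    proof -
      have "C * real n powr (s0 - s1) * real n powr (-s0) \<le> norm c / 2 * real n powr (-s0)"
        using N0[of n] False by (intro mult_right_mono) auto
      moreover have "norm c / 2 * r + norm c / 2 * r = norm c * r" for r by simp
      ultimately show ?thesis by (smt (verit))
    qed
    also have "C * real n powr (s0 - s1) * real n powr (-s0) = C * real n powr (-s1)"
      by (simp flip: powr_add)
    also have "norm c * real n powr (-s0) - C * real n powr (-s1) \<le> norm c * real n powr (-s0) - g n"
      using 1[OF n] by simp
    also have "\<dots> \<le> p_coeff k n"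
      using norm_triangle_ineq2[of "c * of_real (real n powr (-s0))" "of_real (p_coeff k n)"] p_coeff_nonneg[of k n]
      by (simp add: g_def norm_mult norm_minus_commute)
    finally show ?thesis .
  qed
  show thesis
    by (rule that[OF c C \<delta>]) (use 1 2 3 in \<open>simp_all add: g_def s0_def s1_def\<close>)
qed

section \<open>The size of p at exp (-1/m)\<close>

lemma sum_powr_le:
  fixes g :: real
  assumes g: "0 < g" "g \<le> 1"
  shows "(\<Sum>n=1..m. real n powr (g - 1)) \<le> real m powr g / g"
proof (induction m)
  case (Suc m)
  show ?case
  proof (cases "m = 0")
    case False
    let ?M = "real (Suc m)"
    \<comment> \<open>Bernoulli at -1/M gives g M^(g-1) \<le> M^g - (M-1)^g, the telescoping form of
      the integral of t^(g-1).\<close>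
    have "real m powr g = ?M powr g * (1 + - (1 / ?M)) powr g"
    proof -
      have "M * (1 + - (1 / M)) = M - 1" if "M > 0" for M :: real
        using that by (simp add: field_simps)
      from this[of ?M] have "real m = ?M * (1 + - (1 / ?M))" by simp
      moreover have "0 \<le> 1 + - (1 / ?M)" by simp
      ultimately show ?thesis by (metis of_nat_0_le_iff powr_mult)
    qed
    also have "\<dots> \<le> ?M powr g * (1 + g * - (1 / ?M))"
      using g False by (intro mult_left_mono powr_Bernoulli_le) (auto simp: field_simps)
    also have "\<dots> = ?M powr g - g * ?M powr (g - 1)" by (simp add: powr_diff algebra_simps)
    finally have "real m powr g / g \<le> (?M powr g - g * ?M powr (g - 1)) / g" using g by (intro divide_right_mono) auto
    also have "\<dots> = ?M powr g / g - ?M powr (g - 1)" using g by (simp add: diff_divide_distrib)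
    finally show ?thesis using Suc by simp
  qed (use g in simp)
qed simp

lemma exp_neg_inverse_bounds:
  assumes "m \<ge> 1"
  shows "0 < exp (- (1 / real m))" "exp (- (1 / real m)) < 1"
    "1 / (real m + 1) \<le> 1 - exp (- (1 / real m))" "1 - exp (- (1 / real m)) \<le> 1 / real m"
proof -
  have m: "real m > 0" using assms by simp
  show "0 < exp (- (1 / real m))" "exp (- (1 / real m)) < 1" using m by auto
  show "1 - exp (- (1 / real m)) \<le> 1 / real m"
    using exp_ge_add_one_self[of "- (1 / real m)"] by simp
  have "exp (- (1 / real m)) = 1 / exp (1 / real m)" by (simp add: exp_minus inverse_eq_divide)
  also have "\<dots> \<le> 1 / (1 + 1 / real m)"
    using m by (intro divide_left_mono exp_ge_add_one_self mult_pos_pos) (auto intro: add_pos_pos)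
  also have "\<dots> = 1 - 1 / (real m + 1)" using m by (simp add: field_simps)
  finally show "1 / (real m + 1) \<le> 1 - exp (- (1 / real m))" by simp
qed

text \<open>Split the series at n = m. Up to m the powers n^(g-1) are summed directly; beyond m they
  are at most m^(g-1), and the geometric series contributes 1/(1 - x) \<le> 2m. Both parts are of
  order m^g.\<close>

lemma p_fun_upper_bound:
  assumes k: "k > 0"
  obtains K where "K > 0" "\<And>m. m \<ge> 1 \<Longrightarrow> p_fun k (exp (- (1 / real m))) \<le> K * real m powr gam k 0"
proof -
  define g where "g = gam k 0"
  have g: "0 < g" "g \<le> 1" using gam_0_bounds[OF k] by (auto simp: g_def)
  obtain c C \<delta> where C: "C \<ge> 0" and up: "\<And>n. n \<ge> 1 \<Longrightarrow> p_coeff k n \<le> (norm (c::complex) + C) * real n powr (g - 1)"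
    using p_coeff_asymptotics[OF k] unfolding g_def by metis
  define B where "B = norm c + C"
  have B: "B \<ge> 0" using C by (simp add: B_def)
  define K where "K = 1 + B / g + 2 * B"
  have "p_fun k (exp (- (1 / real m))) \<le> K * real m powr g" if m: "m \<ge> 1" for m
  proof -
    define x where "x = exp (- (1 / real m))"
    have x: "0 < x" "x < 1" "1 / (real m + 1) \<le> 1 - x" using exp_neg_inverse_bounds[OF m] by (auto simp: x_def)
    have mp: "real m powr g \<ge> 1" using m g by (intro ge_one_powr_ge_zero) auto
    let ?h = "\<lambda>n. if n \<in> {..m} then (if n = 0 then 1 else B * real n powr (g - 1)) else 0"
    have sm: "(\<lambda>n. ?h n + B * real m powr (g - 1) * x ^ n) sums
        ((\<Sum>n\<in>{..m}. if n = 0 then 1 else B * real n powr (g - 1)) + B * real m powr (g - 1) * (1 / (1 - x)))"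
      using x by (intro sums_add sums_mult sums_If_finite_set geometric_sums) auto
    have le: "p_coeff k n * x ^ n \<le> ?h n + B * real m powr (g - 1) * x ^ n" for n
    proof -
      have nn: "B * real m powr (g - 1) * x ^ n \<ge> 0" using B x by simp
      consider "n = 0" | "1 \<le> n" "n \<le> m" | "n > m" by linarith
      then show ?thesis
      proof cases
        case 2
        have "p_coeff k n * x ^ n \<le> p_coeff k n * 1" using x p_coeff_nonneg by (intro mult_left_mono power_le_one) auto
        also have "\<dots> \<le> B * real n powr (g - 1)" using up[of n] 2 by (simp add: B_def)
        finally show ?thesis using 2 nn by simp
      next
        case 3
        have "p_coeff k n \<le> B * real n powr (g - 1)" using up[of n] 3 by (simp add: B_def)
        also have "\<dots> \<le> B * real m powr (g - 1)" using B g m 3 by (intro mult_left_mono powr_mono2') auto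
        finally show ?thesis using 3 x by (simp add: mult_right_mono)
      qed (use nn in simp)
    qed
    have "p_fun k x \<le> (\<Sum>n\<in>{..m}. if n = 0 then 1 else B * real n powr (g - 1)) + B * real m powr (g - 1) * (1 / (1 - x))"
      by (rule sums_le[OF le p_fun_sums sm]) (use x in auto)
    also have "(\<Sum>n\<in>{..m}. if n = 0 then 1 else B * real n powr (g - 1)) = 1 + B * (\<Sum>n=1..m. real n powr (g - 1))"
    proof -
      have "{..m} = insert 0 {1..m}" by auto
      then show ?thesis by (simp add: sum_distrib_left)
    qed
    also have "\<dots> \<le> real m powr g + B * (real m powr g / g)"
      using mp B sum_powr_le[OF g, of m] by (intro add_mono mult_left_mono) auto
    also have "B * real m powr (g - 1) * (1 / (1 - x)) \<le> B * real m powr (g - 1) * (2 * real m)"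
    proof (intro mult_left_mono)
      have "1 / (2 * real m) \<le> 1 / (real m + 1)" using m by (intro divide_left_mono) auto
      then have "1 / (2 * real m) \<le> 1 - x" using x by linarith
      then show "1 / (1 - x) \<le> 2 * real m" using x m by (simp add: field_simps)
    qed (use B in auto)
    also have "B * real m powr (g - 1) * (2 * real m) = 2 * B * real m powr g"
      using m by (simp add: powr_diff)
    finally show ?thesis by (simp add: x_def K_def algebra_simps)
  qed
  moreover have "K > 0" using B g by (auto simp: K_def intro!: add_pos_nonneg)
  ultimately show thesis using that unfolding g_def by blast
qed

text \<open>The series \<open>p G\<^sub>m\<close>, whose \<open>n\<close>-th coefficient is \<open>u\<^sub>m\<^sub>,\<^sub>n\<close>.\<close>

definition U_fps :: "nat \<Rightarrow> nat \<Rightarrow> complex fps" where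
  "U_fps k m = P_fps k * fps_integral0 (fps_X ^ (m - 1) * inverse (P_fps k))"

lemma U_fps_ode:
  assumes m: "m \<ge> 1"
  shows "fps_X * fps_deriv (U_fps k m) = D_fps k * U_fps k m + fps_X ^ m"
proof -
  let ?P = "P_fps k" and ?I = "fps_integral0 (fps_X ^ (m - 1) * inverse (P_fps k))"
  have inv: "inverse ?P * ?P = 1" by (rule inverse_mult_eq_1) (simp add: P_fps_nth)
  have "fps_X * fps_deriv (U_fps k m) = (fps_X * fps_deriv ?P) * ?I + fps_X * fps_X ^ (m - 1) * (inverse ?P * ?P)"
    by (simp add: U_fps_def fps_deriv_fps_integral algebra_simps)
  also have "fps_X * fps_X ^ (m - 1) = (fps_X ^ m :: complex fps)" using m by (simp flip: power_Suc)
  finally show ?thesis unfolding inv P_fps_deriv by (simp add: U_fps_def mult.assoc)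
qed

lemma U_fps_recurrence:
  assumes "m \<ge> 1"
  shows "of_nat n * fps_nth (U_fps k m) n
      = (\<Sum>j=0..n. fps_nth (D_fps k) j * fps_nth (U_fps k m) (n - j)) + (if n = m then 1 else 0)"
  using fps_ode_coeff[OF U_fps_ode[OF assms], of n k] by simp

lemma norm_D_fps_sum_le:
  assumes "\<And>j. j < n \<Longrightarrow> norm (c j) \<le> B j" "\<And>j. j < n \<Longrightarrow> 0 \<le> B j"
  shows "norm (\<Sum>j=0..n. fps_nth (D_fps k) j * c (n - j)) \<le> (\<Sum>j<n. B j)"
proof -
  have "(\<Sum>j=0..n. fps_nth (D_fps k) j * c (n - j)) = (\<Sum>j=1..n. fps_nth (D_fps k) j * c (n - j))"
    by (rule sum.mono_neutral_right) (auto simp: D_fps_def)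
  also have "norm \<dots> \<le> (\<Sum>j=1..n. B (n - j))"
    by (rule sum_norm_le) (use assms in \<open>auto simp: D_fps_def\<close>)
  also have "\<dots> = (\<Sum>j<n. B j)"
    by (rule sum.reindex_bij_witness[of _ "\<lambda>j. n - j" "\<lambda>j. n - j"]) auto
  finally show ?thesis .
qed

lemma U_fps_nth_less: "m \<ge> 1 \<Longrightarrow> n < m \<Longrightarrow> fps_nth (U_fps k m) n = 0"
proof (induction n rule: less_induct)
  case (less n)
  show ?case
  proof (cases "n = 0")
    case False
    have "norm (\<Sum>j=0..n. fps_nth (D_fps k) j * fps_nth (U_fps k m) (n - j)) \<le> (\<Sum>j<n. 0)"
      by (rule norm_D_fps_sum_le) (use less in auto)
    then have "of_nat n * fps_nth (U_fps k m) n = 0"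
      using U_fps_recurrence[of m n k] less by simp
    then show ?thesis using False by simp
  qed (simp add: U_fps_def)
qed

lemma U_fps_nth_self: "m \<ge> 1 \<Longrightarrow> fps_nth (U_fps k m) m = 1 / of_nat m"
proof -
  assume m: "m \<ge> 1"
  have "norm (\<Sum>j=0..m. fps_nth (D_fps k) j * fps_nth (U_fps k m) (m - j)) \<le> (\<Sum>j<m. 0)"
    by (rule norm_D_fps_sum_le) (use m U_fps_nth_less in auto)
  then have "of_nat m * fps_nth (U_fps k m) m = 1" using U_fps_recurrence[of m m k] m by simp
  then show ?thesis using m by (simp add: field_simps)
qed

text \<open>For n > m only the n - m coefficients with indices from m to n - 1 enter the recurrence,
  each at most 1/m by induction. The second bound makes the first window after m smaller by a
  further factor of order 1/m.\<close>

lemma norm_U_fps_le: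
  assumes m: "m \<ge> 1"
  shows "norm (fps_nth (U_fps k m) n) \<le> 1 / real m"
    and "n > m \<Longrightarrow> norm (fps_nth (U_fps k m) n) \<le> (real n - real m) / real m / real n"
proof -
  have "norm (fps_nth (U_fps k m) n) \<le> 1 / real m
     \<and> (n > m \<longrightarrow> norm (fps_nth (U_fps k m) n) \<le> (real n - real m) / real m / real n)"
  proof (induction n rule: less_induct)
    case (less n)
    consider "n < m" | "n = m" | "n > m" by linarith
    then show ?case
    proof cases
      case 3
      have "norm (\<Sum>j=0..n. fps_nth (D_fps k) j * fps_nth (U_fps k m) (n - j)) \<le> (\<Sum>j<n. if m \<le> j then 1 / real m else 0)"
        by (rule norm_D_fps_sum_le) (use less U_fps_nth_less[OF m] in auto)
      also have "\<dots> = (\<Sum>j\<in>{m..<n}. 1 / real m)"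
        by (rule sum.mono_neutral_cong_right) (use 3 in auto)
      also have "\<dots> = (real n - real m) / real m" using 3 by (simp add: of_nat_diff)
      finally have "norm (of_nat n * fps_nth (U_fps k m) n) \<le> (real n - real m) / real m"
        using U_fps_recurrence[OF m, of n k] 3 by simp
      then have "norm (fps_nth (U_fps k m) n) * real n \<le> (real n - real m) / real m"
        by (simp add: norm_mult mult.commute)
      then have a: "norm (fps_nth (U_fps k m) n) \<le> (real n - real m) / real m / real n"
        using 3 by (subst pos_le_divide_eq) auto
      also have "\<dots> = (real n - real m) / real n / real m" by simp
      also have "\<dots> \<le> 1 / real m" using 3 m by (intro divide_right_mono) auto
      finally show ?thesis using a by blast
    qed (use U_fps_nth_less[OF m, of n k] U_fps_nth_self[OF m, of k] in \<open>auto simp: norm_divide\<close>)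
  qed
  then show "norm (fps_nth (U_fps k m) n) \<le> 1 / real m"
    "n > m \<Longrightarrow> norm (fps_nth (U_fps k m) n) \<le> (real n - real m) / real m / real n" by blast+
qed

lemma fps_conv_radius_U: "m \<ge> 1 \<Longrightarrow> fps_conv_radius (U_fps k m) \<ge> 1"
  by (rule fps_conv_radius_bounded) (rule norm_U_fps_le)

section \<open>An Abelian theorem and the limits of u/p_n\<close>

lemma p_fun_unbounded:
  assumes k: "k > 0"
  shows "\<exists>t. 0 \<le> t \<and> t < 1 \<and> p_fun k t > (B::real)"
proof (rule ccontr)
  assume "\<not> ?thesis"
  then have B: "\<And>t. 0 \<le> t \<Longrightarrow> t < 1 \<Longrightarrow> p_fun k t \<le> B" by (auto simp: not_less)
  have partial: "(\<Sum>n<N. p_coeff k n) \<le> B" for N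
  proof (rule tendsto_upperbound)
    show "((\<lambda>t. \<Sum>n<N. p_coeff k n * t ^ n) \<longlongrightarrow> (\<Sum>n<N. p_coeff k n)) (at_left 1)"
      by (auto intro!: tendsto_eq_intros)
    have "eventually (\<lambda>t. t \<in> {0<..<1}) (at_left (1::real))"
      by (rule eventually_at_left_real) simp
    then show "\<forall>\<^sub>F t in at_left 1. (\<Sum>n<N. p_coeff k n * t ^ n) \<le> B"
    proof eventually_elim
      case (elim t)
      have "(\<Sum>n<N. p_coeff k n * t ^ n) \<le> p_fun k t"
      proof -
        have "summable (\<lambda>n. p_coeff k n * t ^ n)" "p_fun k t = (\<Sum>n. p_coeff k n * t ^ n)"
          using elim p_fun_sums[of t k] by (simp_all add: sums_iff)
        then show ?thesis using elim by (simp add: sum_le_suminf p_coeff_nonneg)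
      qed
      also have "\<dots> \<le> B" using elim by (intro B) auto
      finally show ?case .
    qed
  qed simp
  have "summable (p_coeff k)"
    by (rule summableI_nonneg_bounded[OF p_coeff_nonneg partial])
  obtain \<delta> where \<delta>: "\<delta> > 0" "\<And>n. n \<ge> 1 \<Longrightarrow> p_coeff k n \<ge> \<delta> * real n powr (gam k 0 - 1)"
    using p_coeff_asymptotics[OF k] by metis
  \<comment> \<open>Here p_n \<ge> \<delta>/n because \<open>gam k 0\<close> is positive, so bounded
    partial sums would make the harmonic series converge.\<close>
  have "summable (\<lambda>n. \<delta> * inverse (real n))"
  proof (rule summable_comparison_test'[OF \<open>summable (p_coeff k)\<close>, where N = 1])
    fix n :: nat assume n: "n \<ge> 1"
    have "inverse (real n) = real n powr (-1)" using n by (simp add: powr_minus)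
    also have "\<dots> \<le> real n powr (gam k 0 - 1)" using n gam_0_bounds[OF k] by (intro powr_mono) auto
    finally have "\<delta> * inverse (real n) \<le> \<delta> * real n powr (gam k 0 - 1)" using \<delta> by simp
    also have "\<dots> \<le> p_coeff k n" by (rule \<delta>(2)[OF n])
    finally show "norm (\<delta> * inverse (real n)) \<le> p_coeff k n" using \<delta> by simp
  qed
  then have "summable (\<lambda>n. inverse (\<delta>) * (\<delta> * inverse (real n)))" by (rule summable_mult)
  then show False using not_summable_harmonic[where 'a=real] \<delta> by simp
qed

text \<open>Abel's argument: as t tends to 1, the weighted averages C(t)/p(t) come close to the
  limit of C_n/p_n because p(t) is unbounded. \<open>ratio_fun_increment\<close> carries this back
  from t to x, so the integral up to 1 never has to be formed.\<close>

lemma ratio_fun_limit_bound: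
  assumes k: "k > 0" and lim: "(\<lambda>n. fps_nth C n / of_real (p_coeff k n)) \<longlonglongrightarrow> \<Lambda>"
    and ode: "fps_X * fps_deriv C = D_fps k * C + fps_X ^ m" and C: "fps_conv_radius C \<ge> 1"
    and m: "m \<ge> 1" and x: "0 < x" "x < 1"
  shows "norm (\<Lambda> - ratio_fun k C x) \<le> (1 - x) / p_fun k x"
proof (rule field_le_epsilon)
  fix e :: real assume e: "e > 0"
  then obtain N where N: "\<And>n. n \<ge> N \<Longrightarrow> norm (fps_nth C n / of_real (p_coeff k n) - \<Lambda>) < e / 2"
    using LIMSEQ_D[OF lim, of "e / 2"] by auto
  let ?r = "\<lambda>n. norm (fps_nth C n - \<Lambda> * of_real (p_coeff k n))"
  define Q where "Q = (\<Sum>n<N. ?r n)"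
  have Q: "Q \<ge> 0" by (simp add: Q_def sum_nonneg)
  \<comment> \<open>The head n < N contributes at most Q, and t0 makes Q/p(t) at most e/2; the tail
    supplies the other e/2.\<close>
  obtain t0 where t0: "0 \<le> t0" "t0 < 1" "p_fun k t0 > 2 * Q / e" using p_fun_unbounded[OF k] by blast
  define t where "t = max t0 x"
  have t: "x \<le> t" "t < 1" "0 < t" using t0 x by (auto simp: t_def)
  have "p_fun k t0 \<le> p_fun k t" using t0 x by (intro p_fun_mono) (auto simp: t_def)
  then have pt: "p_fun k t > 2 * Q / e" using t0 by simp
  have r: "?r n \<le> e / 2 * p_coeff k n" if "n \<ge> N" for n
  proof -
    have "fps_nth C n - \<Lambda> * of_real (p_coeff k n) = (fps_nth C n / of_real (p_coeff k n) - \<Lambda>) * of_real (p_coeff k n)"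
      using p_coeff_pos[of k n] by (simp add: field_simps)
    also have "norm \<dots> \<le> e / 2 * p_coeff k n"
      unfolding norm_mult using N[OF that] p_coeff_pos[of k n] e by (intro mult_mono) auto
    finally show ?thesis .
  qed
  have "(\<lambda>n. fps_nth C n * of_real t ^ n) sums eval_fps C (of_real t)"
    using t by (intro sums_eval_fps norm_less_radius C) auto
  moreover have "(\<lambda>n. \<Lambda> * (of_real (p_coeff k n) * of_real t ^ n)) sums (\<Lambda> * of_real (p_fun k t))"
    using p_coeff_sums[of "of_real t" k] t by (intro sums_mult) (simp add: p_fun_of_real)
  ultimately have s: "(\<lambda>n. (fps_nth C n - \<Lambda> * of_real (p_coeff k n)) * of_real t ^ n) sums (eval_fps C (of_real t) - \<Lambda> * of_real (p_fun k t))"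
    using sums_diff by (fastforce simp: algebra_simps)
  have s2: "(\<lambda>n. (if n \<in> {..<N} then ?r n else 0) + e / 2 * (p_coeff k n * t ^ n)) sums (Q + e / 2 * p_fun k t)"
    unfolding Q_def using t by (intro sums_add sums_mult sums_If_finite_set p_fun_sums) auto
  have "norm (eval_fps C (of_real t) - \<Lambda> * of_real (p_fun k t)) \<le> Q + e / 2 * p_fun k t"
  proof (rule norm_sums_le[OF s s2])
    fix n
    have pn: "0 \<le> e / 2 * (p_coeff k n * t ^ n)" using e t p_coeff_nonneg[of k n] by simp
    show "norm ((fps_nth C n - \<Lambda> * of_real (p_coeff k n)) * of_real t ^ n) \<le> (if n \<in> {..<N} then ?r n else 0) + e / 2 * (p_coeff k n * t ^ n)"
    proof (cases "n < N")
      case True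
      have "?r n * t ^ n \<le> ?r n * 1" using t by (intro mult_left_mono power_le_one) auto
      then show ?thesis using True pn t by (simp add: norm_mult norm_power)
    next
      case False
      have "?r n * t ^ n \<le> e / 2 * p_coeff k n * t ^ n" using r[of n] False t by (intro mult_right_mono) auto
      then show ?thesis using False t by (simp add: norm_mult norm_power)
    qed
  qed
  then have "norm (eval_fps C (of_real t) - \<Lambda> * of_real (p_fun k t)) / p_fun k t \<le> (Q + e / 2 * p_fun k t) / p_fun k t"
    using p_fun_pos[of k t] by (intro divide_right_mono) auto
  also have "\<dots> = Q / p_fun k t + e / 2" using p_fun_pos[of k t] by (simp add: add_divide_distrib)
  also have "Q / p_fun k t \<le> e / 2" using pt e p_fun_pos[of k t] by (simp add: field_simps)
  also have "norm (eval_fps C (of_real t) - \<Lambda> * of_real (p_fun k t)) / p_fun k t = norm (ratio_fun k C t - \<Lambda>)"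
  proof -
    have "ratio_fun k C t - \<Lambda> = (eval_fps C (of_real t) - \<Lambda> * of_real (p_fun k t)) / of_real (p_fun k t)"
      using p_fun_pos[of k t] by (simp add: ratio_fun_def diff_divide_distrib)
    then show ?thesis using p_fun_pos[of k t] by (simp add: norm_divide)
  qed
  finally have "norm (\<Lambda> - ratio_fun k C t) \<le> e" by (simp add: norm_minus_commute)
  moreover have "norm (ratio_fun k C t - ratio_fun k C x) \<le> (1 - x) / p_fun k x"
    by (rule ratio_fun_increment[OF ode C m x(1) t(1,2)])
  ultimately show "norm (\<Lambda> - ratio_fun k C x) \<le> (1 - x) / p_fun k x + e"
    using norm_triangle_ineq[of "\<Lambda> - ratio_fun k C t" "ratio_fun k C t - ratio_fun k C x"] by simp
qed

text \<open>The recurrence starts at m + 1, just past the impulse z^m, where the window is bounded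
  by k/m^2 and the scale M = m + 1 + k is comparable to m. This gives L of order m^(s0-2) and an
  error of order n^(-s1) m^(s1-2) for u_n - L n^(-s0). Division by p_n, with \<Lambda> = L/c, turns
  n^(-s1) into n^(-\<beta>).\<close>

lemma U_fps_ratio_asymptotics:
  assumes k: "k > 0"
  obtains C where "C \<ge> 0"
    "\<And>m. m \<ge> 1 \<Longrightarrow> \<exists>\<Lambda>. norm \<Lambda> \<le> C * real m powr (-1 - gam k 0) \<and>
       (\<forall>n>m. norm (fps_nth (U_fps k m) n / of_real (p_coeff k n) - \<Lambda>) \<le> C * real n powr (- beta_exp k) * real m powr (-1 - gam_max k))"
proof -
  define s0 where "s0 = 1 - gam k 0"
  define s1 where "s1 = 1 - gam_max k"
  have e: "gam k 0 - 1 = - s0" "gam_max k - 1 = - s1" "-1 - gam k 0 = s0 - 2" "-1 - gam_max k = s1 - 2" "- beta_exp k = s0 - s1"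
    by (simp_all add: s0_def s1_def beta_exp_def)
  note params = gam_0_bounds[OF k] gam_max_less[OF k] gam_max_nonneg[of k]
  have s: "0 \<le> s0" "s0 < s1" "s1 \<le> 1" using params by (auto simp: s0_def s1_def)
  obtain c :: complex and Cp \<delta> where c: "c \<noteq> 0" and Cp: "Cp \<ge> 0" and \<delta>: "\<delta> > 0"
    and p: "\<And>n. n \<ge> 1 \<Longrightarrow> norm (of_real (p_coeff k n) - c * of_real (real n powr (-s0))) \<le> Cp * real n powr (-s1)"
      "\<And>n. n \<ge> 1 \<Longrightarrow> p_coeff k n \<ge> \<delta> * real n powr (-s0)"
    using p_coeff_asymptotics[OF k] unfolding e by metis
  obtain K where K: "K \<ge> 0"
    and asymp: "\<And>u N W. coprime_recurrence k u N \<Longrightarrow> (\<And>i. i \<in> {N..<N + k} \<Longrightarrow> norm (u i) \<le> W) \<Longrightarrow>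
      \<exists>L. norm ((\<Sum>i=N..<N + k. u i) - of_nat k * L * of_real (real (N + k) powr (-s0))) \<le> K * W / real (N + k) \<and>
        (\<forall>n\<ge>N. n \<ge> 1 \<longrightarrow> norm (u n - L * of_real (real n powr (-s0))) \<le> K * W * (real n / real (N + k)) powr (-s1))"
    using coprime_recurrence_bound[OF k] unfolding s0_def s1_def by blast
  define C1 where "C1 = (k + K) * (real k * (real k + 2))"
  define C2 where "C2 = K * real k * (real k + 2)"
  define C where "C = C1 / norm c + (C2 + C1 / norm c * Cp) / \<delta>"
  have C12: "C1 \<ge> 0" "C2 \<ge> 0" using K by (auto simp: C1_def C2_def)
  have C: "C \<ge> 0" "C1 / norm c \<le> C" "(C2 + C1 / norm c * Cp) / \<delta> \<le> C" using C12 \<delta> Cp by (auto simp: C_def)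
  show thesis
  proof (rule that[OF C(1)], unfold e)
    fix m :: nat assume m: "m \<ge> 1"
    let ?u = "fps_nth (U_fps k m)"
    define W where "W = real k / real m ^ 2"
    have W0: "W \<ge> 0" by (simp add: W_def)
    define M where "M = real (m + 1 + k)"
    have M: "real m \<le> M" "M \<le> (real k + 2) * real m" "M \<ge> 1"
    proof -
      have "1 * 1 \<le> real m * 1" "real k * 1 \<le> real k * real m" using m by (intro mult_mono; simp)+
      then show "M \<le> (real k + 2) * real m" by (simp add: M_def algebra_simps)
    qed (use m in \<open>auto simp: M_def\<close>)
    have powM: "M powr r \<le> (real k + 2) * real m powr r" if "0 \<le> r" "r \<le> 1" for r
    proof -
      have "M powr r \<le> ((real k + 2) * real m) powr r" using M that by (intro powr_mono2) auto
      also have "\<dots> = (real k + 2) powr r * real m powr r" by (simp add: powr_mult)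
      also have "(real k + 2) powr r \<le> (real k + 2) powr 1" using that by (intro powr_mono) auto
      finally show ?thesis by (simp add: mult_right_mono)
    qed
    have rec: "coprime_recurrence k ?u (m + 1)"
      by (rule fps_ode_coprime_recurrence[OF U_fps_ode[OF m] _ k]) simp
    have bd: "norm (?u i) \<le> W" if i: "i \<in> {m + 1..<m + 1 + k}" for i
    proof -
      have "norm (?u i) \<le> (real i - real m) / real m / real i" using i by (intro norm_U_fps_le(2)[OF m]) auto
      also have "\<dots> \<le> real k / real m / real m" using i m by (intro frac_le divide_right_mono) auto
      finally show ?thesis by (simp add: W_def power2_eq_square)
    qed
    obtain L where
      first: "norm ((\<Sum>i=m + 1..<m + 1 + k. ?u i) - of_nat k * L * of_real (M powr (-s0))) \<le> K * W / M"
      and second: "\<And>n. n \<ge> m + 1 \<Longrightarrow> norm (?u n - L * of_real (real n powr (-s0))) \<le> K * W * (real n / M) powr (-s1)"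
      using asymp[OF rec bd] unfolding M_def by auto
    have normL: "norm L \<le> C1 * real m powr (s0 - 2)"
    proof -
      have "real k * norm L * M powr (-s0) = norm (of_nat k * L * of_real (M powr (-s0)))" by (simp add: norm_mult)
      also have "\<dots> \<le> norm (\<Sum>i=m + 1..<m + 1 + k. ?u i) + K * W / M"
        using first norm_triangle_ineq2[of "of_nat k * L * of_real (M powr (-s0))" "\<Sum>i=m + 1..<m + 1 + k. ?u i"]
        by (simp add: norm_minus_commute)
      also have "norm (\<Sum>i=m + 1..<m + 1 + k. ?u i) \<le> (\<Sum>i=m + 1..<m + 1 + k. W)"
        by (rule sum_norm_le) (rule bd)
      also have "K * W / M \<le> K * W / 1" using K W0 M by (intro divide_left_mono) auto
      finally have "real k * norm L * M powr (-s0) \<le> (k + K) * W" by (simp add: algebra_simps)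
      moreover have "1 * (norm L * M powr (-s0)) \<le> real k * (norm L * M powr (-s0))" using k by (intro mult_right_mono) auto
      ultimately have "norm L * M powr (-s0) \<le> (k + K) * W" by simp
      then have "norm L * M powr (-s0) * M powr s0 \<le> (k + K) * W * M powr s0" by (intro mult_right_mono) auto
      then have "norm L \<le> (k + K) * W * M powr s0" using M by (simp add: mult.assoc flip: powr_add)
      also have "\<dots> \<le> (k + K) * W * ((real k + 2) * real m powr s0)"
        using K W0 s by (intro mult_left_mono powM) auto
      also have "\<dots> = C1 * real m powr (s0 - 2)"
        using m by (simp add: C1_def W_def powr_diff)
      finally show ?thesis .
    qed
    define \<Lambda> where "\<Lambda> = L / c"
    have norm\<Lambda>: "norm \<Lambda> \<le> C1 / norm c * real m powr (s0 - 2)"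
      using divide_right_mono[OF normL, of "norm c"] by (simp add: \<Lambda>_def norm_divide)
    have "norm (?u n / of_real (p_coeff k n) - \<Lambda>) \<le> C * real n powr (s0 - s1) * real m powr (s1 - 2)" if n: "n > m" for n
    proof -
      have n1: "n \<ge> 1" using n by simp
      let ?R = "real n powr (-s1) * real m powr (s1 - 2)"
      have a: "norm (?u n - L * of_real (real n powr (-s0))) \<le> C2 * ?R"
      proof -
        have "norm (?u n - L * of_real (real n powr (-s0))) \<le> K * W * (real n / M) powr (-s1)" using second[of n] n by simp
        also have "\<dots> = K * W * real n powr (-s1) * M powr s1"
          using n1 M by (simp add: powr_divide powr_minus divide_simps)
        also have "\<dots> \<le> K * W * real n powr (-s1) * ((real k + 2) * real m powr s1)"
          using K W0 s by (intro mult_left_mono powM) auto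
        also have "\<dots> = C2 * ?R" using m by (simp add: C2_def W_def powr_diff)
        finally show ?thesis .
      qed
      have b: "norm (\<Lambda> * (of_real (p_coeff k n) - c * of_real (real n powr (-s0)))) \<le> C1 / norm c * Cp * ?R"
      proof -
        have "norm \<Lambda> \<le> C1 / norm c * real m powr (s1 - 2)"
          using m s C12 by (intro order_trans[OF norm\<Lambda>] mult_left_mono powr_mono) auto
        then have "norm \<Lambda> * norm (of_real (p_coeff k n) - c * of_real (real n powr (-s0))) \<le> C1 / norm c * real m powr (s1 - 2) * (Cp * real n powr (-s1))"
          using p(1)[OF n1] C12 by (intro mult_mono) auto
        then show ?thesis by (simp add: norm_mult mult_ac)
      qed
      \<comment> \<open>L n^(-s0) is exchanged for \<Lambda> p_n; the difference is \<Lambda> times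
        the error in the asymptotics of p_n, which is of no larger order because s0 < s1.\<close>
      have eq: "?u n - \<Lambda> * of_real (p_coeff k n) = (?u n - L * of_real (real n powr (-s0))) - \<Lambda> * (of_real (p_coeff k n) - c * of_real (real n powr (-s0)))"
        using c by (simp add: \<Lambda>_def algebra_simps)
      have "norm (?u n - \<Lambda> * of_real (p_coeff k n)) \<le> C2 * ?R + C1 / norm c * Cp * ?R"
        unfolding eq by (rule order_trans[OF norm_triangle_ineq4 add_mono[OF a b]])
      then have num: "norm (?u n - \<Lambda> * of_real (p_coeff k n)) \<le> (C2 + C1 / norm c * Cp) * ?R" by (simp add: distrib_right)
      have pn: "p_coeff k n > 0" by (rule p_coeff_pos)
      have "?u n / of_real (p_coeff k n) - \<Lambda> = (?u n - \<Lambda> * of_real (p_coeff k n)) / of_real (p_coeff k n)"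
        using pn by (simp add: diff_divide_distrib)
      also have "norm \<dots> \<le> ((C2 + C1 / norm c * Cp) * ?R) / (\<delta> * real n powr (-s0))"
        unfolding norm_divide using num p(2)[OF n1] pn \<delta> n1 C12 Cp by (intro frac_le) (auto intro!: mult_nonneg_nonneg add_nonneg_nonneg)
      also have "\<dots> = (C2 + C1 / norm c * Cp) / \<delta> * real n powr (s0 - s1) * real m powr (s1 - 2)"
      proof -
        have "real n powr (s0 - s1) = real n powr (-s1) / real n powr (-s0)" by (simp flip: powr_diff)
        then show ?thesis by simp
      qed
      also have "\<dots> \<le> C * real n powr (s0 - s1) * real m powr (s1 - 2)"
        using C by (intro mult_right_mono) auto
      finally show ?thesis .
    qed
    moreover have "norm \<Lambda> \<le> C * real m powr (s0 - 2)"
      using norm\<Lambda> C(2) by (meson mult_right_mono order_trans powr_ge_zero)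
    ultimately show "\<exists>\<Lambda>. norm \<Lambda> \<le> C * real m powr (s0 - 2) \<and>
       (\<forall>n>m. norm (?u n / of_real (p_coeff k n) - \<Lambda>) \<le> C * real n powr (s0 - s1) * real m powr (s1 - 2))"
      by blast
  qed
qed

section \<open>The main estimate\<close>

lemma fps_conv_radius_mult_geI:
  fixes A B :: "complex fps"
  shows "fps_conv_radius A \<ge> 1 \<Longrightarrow> fps_conv_radius B \<ge> 1 \<Longrightarrow> fps_conv_radius (A * B) \<ge> 1"
  using fps_conv_radius_mult[of A B] by (meson min.boundedI order_trans)

lemma fps_conv_radius_diff_geI:
  fixes A B :: "complex fps"
  shows "fps_conv_radius A \<ge> 1 \<Longrightarrow> fps_conv_radius B \<ge> 1 \<Longrightarrow> fps_conv_radius (A - B) \<ge> 1"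
  using fps_conv_radius_diff[of A B] by (meson min.boundedI order_trans)

lemma fps_conv_radius_const_geI: "fps_conv_radius (fps_const (c::complex)) \<ge> 1"
  by simp

lemma of_real_less_radius:
  "0 \<le> x \<Longrightarrow> x < 1 \<Longrightarrow> fps_conv_radius C \<ge> 1 \<Longrightarrow> ereal (norm (of_real x :: complex)) < fps_conv_radius C"
  by (rule norm_less_radius) simp_all

lemma ratio_fun_diff:
  assumes "fps_conv_radius A \<ge> 1" "fps_conv_radius B \<ge> 1" "0 \<le> x" "x < 1"
  shows "ratio_fun k (A - B) x = ratio_fun k A x - ratio_fun k B x"
  unfolding ratio_fun_def using assms
  by (subst eval_fps_diff[OF of_real_less_radius of_real_less_radius]) (simp_all add: diff_divide_distrib)

lemma ratio_fun_cmult: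
  assumes "fps_conv_radius A \<ge> 1" "0 \<le> x" "x < 1"
  shows "ratio_fun k (fps_const c * A) x = c * ratio_fun k A x"
  unfolding ratio_fun_def using assms
  by (subst eval_fps_mult[OF of_real_less_radius of_real_less_radius]) simp_all

lemma fps_nth_deriv_mult_P:
  "fps_nth (fps_X * fps_deriv (Abs_fps a) * P_fps k) m = S_sum k a m"
proof -
  have X: "fps_nth (fps_X * fps_deriv (Abs_fps a)) j = a j * of_nat j" for j
    by (cases j) (simp_all add: mult.commute)
  have "fps_nth (fps_X * fps_deriv (Abs_fps a) * P_fps k) m = (\<Sum>j=0..m. a j * of_nat j * of_real (p_coeff k (m - j)))"
    unfolding fps_mult_nth[of "fps_X * fps_deriv (Abs_fps a)"] X P_fps_nth ..
  also have "\<dots> = S_sum k a m"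
    unfolding S_sum_def by (rule sum.mono_neutral_right) auto
  finally show ?thesis .
qed

section \<open>Finite expansion in the series U with a remainder\<close>

context
  fixes k :: nat and a :: "nat \<Rightarrow> complex" and f :: "complex \<Rightarrow> complex"
  assumes f: "\<And>z. norm z < 1 \<Longrightarrow> (\<lambda>n. a n * z ^ n) sums f z"
begin

text \<open>Stopping the expansion of (f - a 0) p at n avoids any question of convergence: the
  coefficients of the remainder up to n vanish, and its values on the unit interval fall under
  \<open>ratio_fun_tail_bound\<close>.\<close>

definition remainder_fps :: "nat \<Rightarrow> complex fps" where
  "remainder_fps n = (Abs_fps a - fps_const (a 0)) * P_fps k - (\<Sum>m=1..n. fps_const (S_sum k a m) * U_fps k m)"

lemma remainder_fps_Suc: "remainder_fps (Suc n) = remainder_fps n - fps_const (S_sum k a (Suc n)) * U_fps k (Suc n)"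
  by (simp add: remainder_fps_def)

lemma fps_conv_radius_a: "fps_conv_radius (Abs_fps a) \<ge> 1"
proof (rule fps_conv_radius_geI)
  fix t :: real assume "0 < t" "t < 1"
  then show "summable (\<lambda>n. fps_nth (Abs_fps a) n * of_real t ^ n)"
    using f[of "of_real t"] by (simp add: sums_iff)
qed

lemma fps_conv_radius_remainder: "fps_conv_radius (remainder_fps n) \<ge> 1"
proof (induction n)
  case 0
  show ?case
    by (simp add: remainder_fps_def fps_conv_radius_mult_geI fps_conv_radius_diff_geI fps_conv_radius_a fps_conv_radius_P)
next
  case (Suc n)
  then show ?case unfolding remainder_fps_Suc
    by (intro fps_conv_radius_diff_geI fps_conv_radius_mult_geI fps_conv_radius_const_geI fps_conv_radius_U) simp_all
qed

text \<open>At n = 0 the inhomogeneity is z f' p, whose coefficients are the S(f;j); each subtracted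
  multiple of a series U removes exactly the next term.\<close>

lemma remainder_fps_ode:
  "fps_X * fps_deriv (remainder_fps n) = D_fps k * remainder_fps n
     + Abs_fps (\<lambda>j. if j \<le> n then 0 else S_sum k a j)"
proof (induction n)
  case 0
  have "Abs_fps (\<lambda>j. if j \<le> 0 then 0 else S_sum k a j) = Abs_fps (S_sum k a)"
    by (rule fps_ext) (simp add: S_sum_def)
  also have "\<dots> = fps_X * fps_deriv (Abs_fps a) * P_fps k"
    by (rule fps_ext) (simp only: fps_nth_deriv_mult_P fps_nth_Abs_fps)
  finally have E: "Abs_fps (\<lambda>j. if j \<le> 0 then 0 else S_sum k a j) = fps_X * fps_deriv (Abs_fps a) * P_fps k" .
  have "fps_X * fps_deriv (remainder_fps 0)
      = fps_X * fps_deriv (Abs_fps a) * P_fps k + (Abs_fps a - fps_const (a 0)) * (fps_X * fps_deriv (P_fps k))"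
    by (simp add: remainder_fps_def algebra_simps)
  then show ?case unfolding E P_fps_deriv by (simp add: remainder_fps_def algebra_simps)
next
  case (Suc n)
  let ?s = "fps_const (S_sum k a (Suc n))"
  have E: "Abs_fps (\<lambda>j. if j \<le> Suc n then 0 else S_sum k a j)
      = Abs_fps (\<lambda>j. if j \<le> n then 0 else S_sum k a j) - ?s * fps_X ^ Suc n"
    by (rule fps_ext) (auto simp: fps_mult_left_const_nth fps_X_power_nth le_Suc_eq simp del: power_Suc)
  have "fps_X * fps_deriv (remainder_fps (Suc n))
      = fps_X * fps_deriv (remainder_fps n) - ?s * (fps_X * fps_deriv (U_fps k (Suc n)))"
    unfolding remainder_fps_Suc by (simp add: algebra_simps)
  also have "fps_X * fps_deriv (U_fps k (Suc n)) = D_fps k * U_fps k (Suc n) + fps_X ^ Suc n"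
    by (rule U_fps_ode) simp
  finally show ?case unfolding E Suc remainder_fps_Suc
    by (simp add: algebra_simps del: power_Suc)
qed

text \<open>Up to index n the recurrence is homogeneous and expresses each coefficient through
  strictly earlier ones, so they vanish with coefficient 0.\<close>

lemma remainder_fps_nth_le: "i \<le> n \<Longrightarrow> fps_nth (remainder_fps n) i = 0"
proof (induction i rule: less_induct)
  case (less i)
  show ?case
  proof (cases "i = 0")
    case True
    have "(\<Sum>m=1..n. fps_nth (fps_const (S_sum k a m) * U_fps k m) 0) = 0"
      by (rule sum.neutral) (simp add: U_fps_nth_less)
    then show ?thesis using True by (simp add: remainder_fps_def fps_sum_nth)
  next
    case False
    have "norm (\<Sum>j=0..i. fps_nth (D_fps k) j * fps_nth (remainder_fps n) (i - j)) \<le> (\<Sum>j<i. 0)"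
      by (rule norm_D_fps_sum_le) (use less in auto)
    then have "of_nat i * fps_nth (remainder_fps n) i = 0"
      using fps_ode_coeff[OF remainder_fps_ode, of i n] less.prems by simp
    then show ?thesis using False by simp
  qed
qed

lemma coefficient_identity:
  "(\<Sum>j=0..n. a j * of_real (p_coeff k (n - j)))
     = a 0 * of_real (p_coeff k n) + (\<Sum>m=1..n. S_sum k a m * fps_nth (U_fps k m) n)"
proof -
  have "fps_nth (remainder_fps n) n = fps_nth (Abs_fps a * P_fps k) n - a 0 * fps_nth (P_fps k) n - (\<Sum>m=1..n. S_sum k a m * fps_nth (U_fps k m) n)"
    by (simp add: remainder_fps_def left_diff_distrib fps_sum_nth)
  then have "fps_nth (Abs_fps a * P_fps k) n = a 0 * fps_nth (P_fps k) n + (\<Sum>m=1..n. S_sum k a m * fps_nth (U_fps k m) n)"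
    using remainder_fps_nth_le[of n n] by (simp add: algebra_simps)
  then show ?thesis by (simp add: fps_mult_nth P_fps_nth)
qed

lemma value_identity:
  assumes x: "0 \<le> x" "x < 1"
  shows "f (of_real x) = a 0 + (\<Sum>m=1..n. S_sum k a m * ratio_fun k (U_fps k m) x) + ratio_fun k (remainder_fps n) x"
proof (induction n)
  case 0
  have px: "p_fun k x \<noteq> 0" using p_fun_pos[of k x] by simp
  have r0: "remainder_fps 0 = (Abs_fps a - fps_const (a 0)) * P_fps k" by (simp add: remainder_fps_def)
  have fx: "eval_fps (Abs_fps a) (of_real x) = f (of_real x)"
    using f[of "of_real x"] x by (simp add: eval_fps_def sums_iff)
  have "ratio_fun k (remainder_fps 0) x = eval_fps (Abs_fps a - fps_const (a 0)) (of_real x) * eval_fps (P_fps k) (of_real x) / of_real (p_fun k x)"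
    unfolding r0 ratio_fun_def using x
    by (subst eval_fps_mult[OF of_real_less_radius of_real_less_radius])
      (simp_all add: fps_conv_radius_diff_geI fps_conv_radius_a fps_conv_radius_P)
  also have "eval_fps (Abs_fps a - fps_const (a 0)) (of_real x) = f (of_real x) - a 0"
    using x fx by (subst eval_fps_diff[OF of_real_less_radius of_real_less_radius]) (simp_all add: fps_conv_radius_a)
  also have "(f (of_real x) - a 0) * eval_fps (P_fps k) (of_real x) / of_real (p_fun k x) = f (of_real x) - a 0"
    using x px by (simp add: eval_P_fps p_fun_of_real)
  finally show ?case by simp
next
  case (Suc n)
  have "ratio_fun k (remainder_fps (Suc n)) x = ratio_fun k (remainder_fps n) x - S_sum k a (Suc n) * ratio_fun k (U_fps k (Suc n)) x"
    unfolding remainder_fps_Suc using x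
    by (simp add: ratio_fun_diff ratio_fun_cmult fps_conv_radius_remainder fps_conv_radius_U fps_conv_radius_mult_geI)
  then show ?case using Suc by simp
qed

text \<open>At x = exp (-1/n) the condition 1 - x \<ge> 1/(n + 1) of
  \<open>ratio_fun_tail_bound\<close> holds. The terms are nonnegative, so the ordered and the
  unordered sum agree.\<close>

lemma remainder_bound:
  assumes n: "n \<ge> 1"
  shows "norm (ratio_fun k (remainder_fps n) (exp (- (1 / real n))))
     \<le> 2 / p_fun k (exp (- (1 / real n))) * (\<Sum>\<^sub>\<infinity>j\<in>{n<..}. norm (S_sum k a j) / real j * exp (- (real j / real n)))"
proof -
  define x where "x = exp (- (1 / real n))"
  have x: "0 < x" "x < 1" "1 / (real n + 1) \<le> 1 - x" using exp_neg_inverse_bounds[OF n] by (simp_all add: x_def)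
  let ?E = "Abs_fps (\<lambda>j. if j \<le> n then 0 else S_sum k a j)"
  have E: "\<And>j. j \<le> n \<Longrightarrow> fps_nth ?E j = 0" by simp
  note tail = ratio_fun_tail_bound[OF remainder_fps_ode[of n] fps_conv_radius_remainder[of n] remainder_fps_nth_le[OF le0] E x]
  have "((\<lambda>j. norm (fps_nth ?E j) / real j * x ^ j) has_sum (\<Sum>j. norm (fps_nth ?E j) / real j * x ^ j)) UNIV"
    using tail(1) x by (intro sums_nonneg_imp_has_sum summable_sums) auto
  then have "(\<Sum>j. norm (fps_nth ?E j) / real j * x ^ j) = (\<Sum>\<^sub>\<infinity>j. norm (fps_nth ?E j) / real j * x ^ j)"
    by (simp add: infsumI)
  also have "\<dots> = (\<Sum>\<^sub>\<infinity>j\<in>{n<..}. norm (S_sum k a j) / real j * exp (- (real j / real n)))"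
    by (rule infsum_cong_neutral) (auto simp: x_def simp flip: exp_of_nat_mult)
  finally show ?thesis using tail(2) by (simp add: x_def)
qed

end

section \<open>Kernel estimate and conclusion\<close>

theorem theorem19:
  fixes k :: nat
  assumes "k \<ge> 1"
  shows "\<exists>C::real. \<forall>(a :: nat \<Rightarrow> complex) (f :: complex \<Rightarrow> complex).
    (\<forall>z. norm z < 1 \<longrightarrow> (\<lambda>n. a n * z ^ n) sums f z) \<longrightarrow>
    (\<forall>n::nat. n \<ge> 1 \<longrightarrow>
      norm (1 / of_real (p_coeff k n) * (\<Sum>j=0..n. a j * of_real (p_coeff k (n - j)))
            - f (of_real (exp (- (1 / real n))))
            - S_sum k a n / (of_nat n * of_real (p_coeff k n)))
      \<le> C * (1 / real n powr beta_exp k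
                * (\<Sum>j=1..n. norm (S_sum k a j) / p_fun k (exp (- (1 / real j)))
                              * real j powr (beta_exp k - 1))
              + 1 / p_fun k (exp (- (1 / real n)))
                * (\<Sum>\<^sub>\<infinity>j\<in>{n<..}. norm (S_sum k a j) / real j * exp (- (real j / real n)))))"
proof -
  have k: "k > 0" using assms by simp
  define \<beta> where "\<beta> = beta_exp k"
  have \<beta>: "0 < \<beta>" "\<beta> \<le> 1"
    using gam_0_bounds[OF k] gam_max_less[OF k] gam_max_nonneg[of k] by (auto simp: \<beta>_def beta_exp_def)
  obtain C0 where C0: "C0 \<ge> 0" and asymp: "\<And>m. m \<ge> 1 \<Longrightarrow> \<exists>\<Lambda>. norm \<Lambda> \<le> C0 * real m powr (-1 - gam k 0) \<and>
       (\<forall>n>m. norm (fps_nth (U_fps k m) n / of_real (p_coeff k n) - \<Lambda>) \<le> C0 * real n powr (- \<beta>) * real m powr (-1 - gam_max k))"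
    using U_fps_ratio_asymptotics[OF k] unfolding \<beta>_def by blast
  obtain K where K: "K > 0" "\<And>m. m \<ge> 1 \<Longrightarrow> p_fun k (exp (- (1 / real m))) \<le> K * real m powr gam k 0"
    using p_fun_upper_bound[OF k] by blast
  define x where "x n = exp (- (1 / real n))" for n :: nat
  \<comment> \<open>The kernel for m \<le> n costs C0 * K + 1 and the remainder costs 2; their sum
    dominates both.\<close>
  define C where "C = C0 * K + 1 + 2"
  define R where "R n m = real n powr (- \<beta>) * (real m powr (\<beta> - 1) / p_fun k (x m))" for n m
  have R: "R n m \<ge> 0" for n m using p_fun_pos[of k "x m"] by (simp add: R_def)
  \<comment> \<open>The exponent is -1 - \<open>gam_max k\<close>, the power of m in the asymptotics
    of u/p_n; the upper bound on p converts it into the factor 1/p of the claim.\<close>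
  have weight: "real m powr (\<beta> - 1 - gam k 0) \<le> K * (real m powr (\<beta> - 1) / p_fun k (x m))" if m: "m \<ge> 1" for m
  proof -
    have "real m powr (\<beta> - 1 - gam k 0) * p_fun k (x m) \<le> real m powr (\<beta> - 1 - gam k 0) * (K * real m powr gam k 0)"
      using K(2)[OF m] by (intro mult_left_mono) (auto simp: x_def)
    also have "\<dots> = K * real m powr (\<beta> - 1)" by (simp flip: powr_add)
    finally show ?thesis using p_fun_pos[of k "x m"] by (simp add: field_simps)
  qed
  \<comment> \<open>The comparison passes through \<Lambda>: the asymptotics bring u/p_n close to
    \<Lambda>, the Abelian bound brings \<Lambda> close to \<open>G\<^sub>m\<close> at exp (-1/n).
    At m = n the asymptotics do not apply, but there the coefficient of U is exactly 1/n and the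
    subtracted term cancels it; this is the origin of S(f;n)/(n p_n).\<close>
  have kernel: "norm (fps_nth (U_fps k m) n / of_real (p_coeff k n) - (if m = n then 1 / (of_nat n * of_real (p_coeff k n)) else 0)
      - ratio_fun k (U_fps k m) (x n)) \<le> (C0 * K + 1) * R n m" if mn: "1 \<le> m" "m \<le> n" for m n
  proof -
    let ?q = "\<lambda>n. fps_nth (U_fps k m) n / of_real (p_coeff k n)"
    obtain \<Lambda> where \<Lambda>: "norm \<Lambda> \<le> C0 * real m powr (-1 - gam k 0)"
      "\<And>n. n > m \<Longrightarrow> norm (?q n - \<Lambda>) \<le> C0 * real n powr (- \<beta>) * real m powr (-1 - gam_max k)"
      using asymp[OF mn(1)] by blast
    have xn: "0 < x n" "x n < 1" "1 - x n \<le> 1 / real n" using exp_neg_inverse_bounds[of n] mn by (auto simp: x_def)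
    have xm: "0 < x m" "x m \<le> x n" using mn by (auto simp: x_def frac_le)
    have "?q \<longlonglongrightarrow> \<Lambda>"
    proof (rule LIM_zero_cancel, rule Lim_null_comparison)
      show "\<forall>\<^sub>F n in sequentially. norm (?q n - \<Lambda>) \<le> C0 * real n powr (- \<beta>) * real m powr (-1 - gam_max k)"
        using \<Lambda>(2) by (intro eventually_sequentiallyI[of "Suc m"]) simp
      have "(\<lambda>n. C0 * real n powr (- \<beta>) * real m powr (-1 - gam_max k)) \<longlonglongrightarrow> C0 * 0 * real m powr (-1 - gam_max k)"
        using \<beta> by (intro tendsto_intros tendsto_neg_powr filterlim_real_sequentially) auto
      then show "(\<lambda>n. C0 * real n powr (- \<beta>) * real m powr (-1 - gam_max k)) \<longlonglongrightarrow> 0" by simp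
    qed
    then have "norm (\<Lambda> - ratio_fun k (U_fps k m) (x n)) \<le> (1 - x n) / p_fun k (x n)"
      using mn xn by (intro ratio_fun_limit_bound[OF k _ U_fps_ode fps_conv_radius_U]) auto
    also have "\<dots> \<le> (1 / real n) / p_fun k (x m)"
      using xn xm p_fun_mono[of "x m" "x n" k] p_fun_pos[of k "x m"] by (intro frac_le) auto
    also have "\<dots> \<le> R n m"
    proof -
      \<comment> \<open>Since \<beta> \<le> 1 and m \<le> n, the factor n powr (\<beta> - 1) can be
        raised to m powr (\<beta> - 1).\<close>
      have "1 / real n = real n powr (- \<beta>) * real n powr (\<beta> - 1)"
        using mn by (simp flip: powr_add)
      also have "\<dots> \<le> real n powr (- \<beta>) * real m powr (\<beta> - 1)"
        using mn \<beta> by (intro mult_left_mono powr_mono2') auto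
      finally show ?thesis
        using divide_right_mono[of "1 / real n" _ "p_fun k (x m)"] p_fun_pos[of k "x m"] by (simp add: R_def)
    qed
    finally have limit: "norm (\<Lambda> - ratio_fun k (U_fps k m) (x n)) \<le> R n m" .
    show ?thesis
    proof (cases "m = n")
      case True
      \<comment> \<open>With m = n the exponent -1 - \<open>gam k 0\<close> splits as -\<beta> plus
        \<beta> - 1 - \<open>gam k 0\<close>.\<close>
      have "norm \<Lambda> \<le> C0 * (real n powr (- \<beta>) * real m powr (\<beta> - 1 - gam k 0))"
        using \<Lambda>(1) True by (simp flip: powr_add)
      also have "\<dots> \<le> C0 * (real n powr (- \<beta>) * (K * (real m powr (\<beta> - 1) / p_fun k (x m))))"
        using C0 weight mn by (intro mult_left_mono) auto
      also have "\<dots> = C0 * K * R n m" by (simp add: R_def)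
      finally have "norm \<Lambda> \<le> C0 * K * R n m" .
      then have "norm (ratio_fun k (U_fps k m) (x n)) \<le> C0 * K * R n m + R n m"
        using limit norm_triangle_ineq4[of \<Lambda> "\<Lambda> - ratio_fun k (U_fps k m) (x n)"] by simp
      then show ?thesis using True mn by (simp add: U_fps_nth_self distrib_right)
    next
      case False
      have e: "-1 - gam_max k = \<beta> - 1 - gam k 0" by (simp add: \<beta>_def beta_exp_def)
      have "norm (?q n - \<Lambda>) \<le> C0 * real n powr (- \<beta>) * real m powr (\<beta> - 1 - gam k 0)"
        using \<Lambda>(2)[of n] False mn unfolding e by simp
      also have "\<dots> \<le> C0 * real n powr (- \<beta>) * (K * (real m powr (\<beta> - 1) / p_fun k (x m)))"
        using C0 weight mn by (intro mult_left_mono) auto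
      also have "\<dots> = C0 * K * R n m" by (simp add: R_def)
      finally have "norm (?q n - \<Lambda>) \<le> C0 * K * R n m" .
      then have "norm ((?q n - \<Lambda>) + (\<Lambda> - ratio_fun k (U_fps k m) (x n))) \<le> C0 * K * R n m + R n m"
        by (intro order_trans[OF norm_triangle_ineq] add_mono limit)
      then show ?thesis using False by (simp add: distrib_right)
    qed
  qed
  show ?thesis
  proof (intro exI[of _ C] allI impI)
    fix a :: "nat \<Rightarrow> complex" and f :: "complex \<Rightarrow> complex" and n :: nat
    assume "\<forall>z. norm z < 1 \<longrightarrow> (\<lambda>n. a n * z ^ n) sums f z" and n: "n \<ge> 1"
    then have f: "\<And>z. norm z < 1 \<Longrightarrow> (\<lambda>n. a n * z ^ n) sums f z" by blast
    let ?S = "S_sum k a" and ?F = "ratio_fun k (remainder_fps k a n) (x n)"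
    let ?I = "\<Sum>\<^sub>\<infinity>j\<in>{n<..}. norm (?S j) / real j * exp (- (real j / real n))"
    let ?J = "1 / real n powr \<beta> * (\<Sum>j=1..n. norm (?S j) / p_fun k (x j) * real j powr (\<beta> - 1))"
    let ?q = "\<lambda>m. fps_nth (U_fps k m) n / of_real (p_coeff k n) - (if m = n then 1 / (of_nat n * of_real (p_coeff k n)) else 0)
      - ratio_fun k (U_fps k m) (x n)"
    have xn: "0 \<le> x n" "x n < 1" using n by (auto simp: x_def)
    have pn: "complex_of_real (p_coeff k n) \<noteq> 0" using p_coeff_pos[of k n] by simp
    \<comment> \<open>The coefficient identity divided by p_n and the value identity both start with
      a 0, which cancels; what remains is linear in the S(f;m) apart from the remainder.\<close>
    have eq: "1 / of_real (p_coeff k n) * (\<Sum>j=0..n. a j * of_real (p_coeff k (n - j)))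
            - f (of_real (x n)) - ?S n / (of_nat n * of_real (p_coeff k n))
        = (\<Sum>m=1..n. ?S m * ?q m) - ?F"
    proof -
      have "(\<Sum>m=1..n. ?S m * (if m = n then 1 / (of_nat n * of_real (p_coeff k n)) else 0))
          = (\<Sum>m=1..n. if m = n then ?S n / (of_nat n * of_real (p_coeff k n)) else 0)"
        by (rule sum.cong) auto
      also have "\<dots> = ?S n / (of_nat n * of_real (p_coeff k n))" using n by simp
      finally have "(\<Sum>m=1..n. ?S m * ?q m) = (\<Sum>m=1..n. ?S m * fps_nth (U_fps k m) n) / of_real (p_coeff k n)
          - ?S n / (of_nat n * of_real (p_coeff k n)) - (\<Sum>m=1..n. ?S m * ratio_fun k (U_fps k m) (x n))"
        by (simp only: right_diff_distrib sum_subtractf sum_divide_distrib times_divide_eq_right)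
      moreover have "1 / of_real (p_coeff k n) * (\<Sum>j=0..n. a j * of_real (p_coeff k (n - j)))
          = a 0 + (\<Sum>m=1..n. ?S m * fps_nth (U_fps k m) n) / of_real (p_coeff k n)"
      proof -
        have "(\<Sum>j=0..n. a j * of_real (p_coeff k (n - j))) = a 0 * of_real (p_coeff k n) + (\<Sum>m=1..n. ?S m * fps_nth (U_fps k m) n)"
          by (rule coefficient_identity[OF f])
        then show ?thesis using pn by (simp add: add_divide_distrib)
      qed
      moreover have "f (of_real (x n)) = a 0 + (\<Sum>m=1..n. ?S m * ratio_fun k (U_fps k m) (x n)) + ?F"
        by (rule value_identity[OF f xn])
      ultimately show ?thesis by simp
    qed
    have "norm ((\<Sum>m=1..n. ?S m * ?q m) - ?F) \<le> (\<Sum>m=1..n. norm (?S m) * ((C0 * K + 1) * R n m)) + 2 * (1 / p_fun k (x n) * ?I)"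
    proof (intro order_trans[OF norm_triangle_ineq4] add_mono sum_norm_le)
      fix m assume "m \<in> {1..n}"
      then show "norm (?S m * ?q m) \<le> norm (?S m) * ((C0 * K + 1) * R n m)"
        unfolding norm_mult by (intro mult_left_mono kernel) auto
    next
      show "norm ?F \<le> 2 * (1 / p_fun k (x n) * ?I)"
        using remainder_bound[where a = a and k = k, OF f n] by (simp add: x_def)
    qed
    also have "(\<Sum>m=1..n. norm (?S m) * ((C0 * K + 1) * R n m)) = (C0 * K + 1) * ?J"
      unfolding sum_distrib_left by (rule sum.cong) (simp_all add: R_def powr_minus_divide)
    also have "(C0 * K + 1) * ?J + 2 * (1 / p_fun k (x n) * ?I) \<le> C * ?J + C * (1 / p_fun k (x n) * ?I)"
    proof (intro add_mono mult_right_mono)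
      show "0 \<le> ?J" using n by (intro mult_nonneg_nonneg sum_nonneg divide_nonneg_pos p_fun_pos) auto
      show "0 \<le> 1 / p_fun k (x n) * ?I"
        using p_fun_pos[of k "x n"] by (intro mult_nonneg_nonneg infsum_nonneg) auto
    qed (use C0 K in \<open>simp_all add: C_def\<close>)
    finally show "norm (1 / of_real (p_coeff k n) * (\<Sum>j=0..n. a j * of_real (p_coeff k (n - j)))
            - f (of_real (exp (- (1 / real n))))
            - S_sum k a n / (of_nat n * of_real (p_coeff k n)))
      \<le> C * (1 / real n powr beta_exp k
                * (\<Sum>j=1..n. norm (S_sum k a j) / p_fun k (exp (- (1 / real j)))
                              * real j powr (beta_exp k - 1))
              + 1 / p_fun k (exp (- (1 / real n)))
                * (\<Sum>\<^sub>\<infinity>j\<in>{n<..}. norm (S_sum k a j) / real j * exp (- (real j / real n))))"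
      unfolding eq[unfolded x_def] x_def \<beta>_def distrib_left .
  qed
qed

end
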